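(* Let $n$ be a positive odd integer. For generic $x,y\in\mathbb{C}^*$, \[ f_{n,n+4,n}(x,y,q)=g_{n,n+4,n}(x,y,q,y^n/x^n,x^n/y^n)-\Theta_{n,4}(x,y,q), \] where, writing $Q=q^{4(2n+4)}$, \[ \Theta_{n,4}(x,y,q):=\frac{q^{-(n^2+n-3)}x^{-(n-3)/2}y^{(n+1)/2}\,j(y/x;Q)}{j(y^n/x^n;q^{4n(2n+4)})\,j(-q^{2n+8}x^4;Q)\,j(-q^{2n+8}y^4;Q)}\Big\{J_{4n,16n}S_1-qJ_{8n,16n}S_2\Big\}, \] with \begin{align*} S_1:=&\frac{j(q^{6n+16}x^2y^2;Q)\,j(-q^{2(2n+4)}y/x;Q)\,j(q^{n+4}xy;q^{2(2n+4)})}{J_{2(2n+4)}^3J_{8(2n+4)}}\\ &\cdot\Big\{j(-q^{2n+8}x^2y^2;Q)\,j(q^{2(2n+4)}y^2/x^2;Q)\,J_{4(2n+4)}^2+\frac{q^{n+4}x^2\,j(-q^{6n+16}x^2y^2;Q)\,j(q^{2(2n+4)}y/x;Q)^2\,j(-y/x;Q)^2}{J_{4(2n+4)}}\Big\},\\ S_2:=&\frac{j(q^{2n+8}x^2y^2;Q)\,j(-y/x;Q)\,j(q^{3n+8}xy;q^{2(2n+4)})}{J_{2(2n+4)}^2}\\ &\cdot\Big\{\frac{q^{n+1}j(-q^{2n+8}x^2y^2;Q)\,j(q^{2(2n+4)}y^2/x^2;Q)\,J_{8(2n+4)}}{y\,J_{4(2n+4)}}+\frac{qx\,j(-q^{6n+16}x^2y^2;Q)\,j(q^{4(2n+4)}y^2/x^2;q^{8(2n+4)})^2}{J_{8(2n+4)}}\Big\}.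 \end{align*}
   Context: Let $q\in\mathbb{C}$ with $0<|q|<1$. $j(x;q):=(x;q)_\infty(q/x;q)_\infty(q;q)_\infty=\sum_{n\in\mathbb{Z}}(-1)^nq^{\binom n2}x^n$; $J_{a,m}:=j(q^a;q^m)$; $J_m:=J_{m,3m}=\prod_{i\ge1}(1-q^{mi})$. $m(x,q,z):=\frac{1}{j(z;q)}\sum_{r\in\mathbb{Z}}\frac{(-1)^rq^{\binom r2}z^r}{1-q^{r-1}xz}$. With $\mathrm{sg}(r)=1$ for $r\ge0$, $-1$ for $r<0$: $f_{a,b,c}(x,y,q):=\sum_{\mathrm{sg}(r)=\mathrm{sg}(s)}\mathrm{sg}(r)(-1)^{r+s}x^ry^sq^{a\binom r2+brs+c\binom s2}$ and \begin{align*} g_{a,b,c}(x,y,q,z_1,z_0):=&\sum_{t=0}^{a-1}(-y)^tq^{c\binom t2}j(q^{bt}x;q^a)\,m\Big(-q^{a\binom{b+1}{2}-c\binom{a+1}{2}-t(b^2-ac)}\frac{(-y)^a}{(-x)^b},q^{a(b^2-ac)},z_0\Big)\\ &+\sum_{t=0}^{c-1}(-x)^tq^{a\binom t2}j(q^{bt}y;q^c)\,m\Big(-q^{c\binom{b+1}{2}-a\binom{c+1}{2}-t(b^2-ac)}\frac{(-x)^c}{(-y)^b},q^{c(b^2-ac)},z_1\Big). \end{align*} "Generic" means no poles occur in the Appell–Lerch sums or theta quotients. *)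

theory Defs
  imports "HOL-Analysis.Analysis"
begin

text \<open>Binomial coefficient \<open>r choose 2\<close> at an arbitrary integer.\<close>
definition tri :: "int \<Rightarrow> int" where
  "tri r = (r * (r - 1)) div 2"

definition qpoch_inf :: "complex \<Rightarrow> complex \<Rightarrow> complex" where
  "qpoch_inf x q = (\<Prod>i. 1 - x * q ^ i)"

definition jtheta :: "complex \<Rightarrow> complex \<Rightarrow> complex" where
  "jtheta x q = qpoch_inf x q * qpoch_inf (q / x) q * qpoch_inf q q"

definition J2 :: "int \<Rightarrow> int \<Rightarrow> complex \<Rightarrow> complex" where
  "J2 a m q = jtheta (q powi a) (q powi m)"

definition J1 :: "int \<Rightarrow> complex \<Rightarrow> complex" where
  "J1 m q = J2 m (3 * m) q"

definition appell_m :: "complex \<Rightarrow> complex \<Rightarrow> complex \<Rightarrow> complex" where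
  "appell_m x q z =
     (1 / jtheta z q) *
     (\<Sum>\<^sub>\<infinity>r\<in>(UNIV :: int set).
        ((-1) powi r * q powi (tri r) * z powi r) / (1 - q powi (r - 1) * x * z))"

text \<open>No summand of \<open>appell_m x q z\<close>, and not its prefactor, has a pole.\<close>
definition appell_no_pole :: "complex \<Rightarrow> complex \<Rightarrow> complex \<Rightarrow> bool" where
  "appell_no_pole x q z \<longleftrightarrow>
     jtheta z q \<noteq> 0 \<and> (\<forall>r::int. 1 - q powi (r - 1) * x * z \<noteq> 0)"

text \<open>Unlike \<open>sgn\<close>, this takes the value 1 at 0.\<close>
definition sg :: "int \<Rightarrow> int" where
  "sg r = (if r \<ge> 0 then 1 else -1)"

definition hecke_f ::
  "int \<Rightarrow> int \<Rightarrow> int \<Rightarrow> complex \<Rightarrow> complex \<Rightarrow> complex \<Rightarrow> complex" where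
  "hecke_f a b c x y q =
     (\<Sum>\<^sub>\<infinity>(r, s)\<in>{(r, s). sg r = sg s}.
        of_int (sg r) * (-1) powi (r + s) * x powi r * y powi s *
        q powi (a * tri r + b * r * s + c * tri s))"

text \<open>First argument of the Appell--Lerch sums in the first sum defining \<open>hecke_g\<close>; the
  second sum arises from it by exchanging \<open>a\<close> with \<open>c\<close> and \<open>x\<close> with \<open>y\<close>.\<close>
definition hecke_g_arg ::
  "int \<Rightarrow> int \<Rightarrow> int \<Rightarrow> complex \<Rightarrow> complex \<Rightarrow> complex \<Rightarrow> int \<Rightarrow> complex" where
  "hecke_g_arg a b c x y q t =
     - (q powi (a * tri (b + 1) - c * tri (a + 1) - t * (b\<^sup>2 - a * c)) *
        ((- y) powi a / (- x) powi b))"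

definition hecke_g ::
  "int \<Rightarrow> int \<Rightarrow> int \<Rightarrow> complex \<Rightarrow> complex \<Rightarrow> complex \<Rightarrow> complex \<Rightarrow> complex \<Rightarrow> complex" where
  "hecke_g a b c x y q z1 z0 =
     (\<Sum>t\<in>{0..a - 1}. (- y) powi t * q powi (c * tri t) *
        jtheta (q powi (b * t) * x) (q powi a) *
        appell_m (hecke_g_arg a b c x y q t) (q powi (a * (b\<^sup>2 - a * c))) z0) +
     (\<Sum>t\<in>{0..c - 1}. (- x) powi t * q powi (a * tri t) *
        jtheta (q powi (b * t) * y) (q powi c) *
        appell_m (hecke_g_arg c b a y x q t) (q powi (c * (b\<^sup>2 - a * c))) z1)"

definition hecke_g_no_pole ::
  "int \<Rightarrow> int \<Rightarrow> int \<Rightarrow> complex \<Rightarrow> complex \<Rightarrow> complex \<Rightarrow> complex \<Rightarrow> complex \<Rightarrow> bool" where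
  "hecke_g_no_pole a b c x y q z1 z0 \<longleftrightarrow>
     (\<forall>t\<in>{0..a - 1}.
        appell_no_pole (hecke_g_arg a b c x y q t) (q powi (a * (b\<^sup>2 - a * c))) z0) \<and>
     (\<forall>t\<in>{0..c - 1}.
        appell_no_pole (hecke_g_arg c b a y x q t) (q powi (c * (b\<^sup>2 - a * c))) z1)"

definition S1 :: "int \<Rightarrow> complex \<Rightarrow> complex \<Rightarrow> complex \<Rightarrow> complex" where
  "S1 n x y q =
     (let N = 2 * n + 4; Q = q powi (4 * N) in
      (jtheta (q powi (6 * n + 16) * x\<^sup>2 * y\<^sup>2) Q *
       jtheta (- (q powi (2 * N) * y / x)) Q *
       jtheta (q powi (n + 4) * x * y) (q powi (2 * N))) /
      ((J1 (2 * N) q) ^ 3 * J1 (8 * N) q) *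
      (jtheta (- (q powi (2 * n + 8) * x\<^sup>2 * y\<^sup>2)) Q *
         jtheta (q powi (2 * N) * y\<^sup>2 / x\<^sup>2) Q * (J1 (4 * N) q)\<^sup>2 +
       (q powi (n + 4) * x\<^sup>2 * jtheta (- (q powi (6 * n + 16) * x\<^sup>2 * y\<^sup>2)) Q *
         (jtheta (q powi (2 * N) * y / x) Q)\<^sup>2 * (jtheta (- (y / x)) Q)\<^sup>2) /
       J1 (4 * N) q))"

definition S2 :: "int \<Rightarrow> complex \<Rightarrow> complex \<Rightarrow> complex \<Rightarrow> complex" where
  "S2 n x y q =
     (let N = 2 * n + 4; Q = q powi (4 * N) in
      (jtheta (q powi (2 * n + 8) * x\<^sup>2 * y\<^sup>2) Q *
       jtheta (- (y / x)) Q *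
       jtheta (q powi (3 * n + 8) * x * y) (q powi (2 * N))) /
      (J1 (2 * N) q)\<^sup>2 *
      ((q powi (n + 1) * jtheta (- (q powi (2 * n + 8) * x\<^sup>2 * y\<^sup>2)) Q *
         jtheta (q powi (2 * N) * y\<^sup>2 / x\<^sup>2) Q * J1 (8 * N) q) /
       (y * J1 (4 * N) q) +
       (q * x * jtheta (- (q powi (6 * n + 16) * x\<^sup>2 * y\<^sup>2)) Q *
         (jtheta (q powi (4 * N) * y\<^sup>2 / x\<^sup>2) (q powi (8 * N)))\<^sup>2) /
       J1 (8 * N) q))"

text \<open>Meant for odd \<open>n\<close>, where the divisions by 2 in the exponents are exact.\<close>
definition Theta4 :: "int \<Rightarrow> complex \<Rightarrow> complex \<Rightarrow> complex \<Rightarrow> complex" where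
  "Theta4 n x y q =
     (let N = 2 * n + 4; Q = q powi (4 * N) in
      (q powi (- (n\<^sup>2 + n - 3)) * x powi (- ((n - 3) div 2)) * y powi ((n + 1) div 2) *
       jtheta (y / x) Q) /
      (jtheta (y powi n / x powi n) (q powi (4 * n * N)) *
       jtheta (- (q powi (2 * n + 8) * x ^ 4)) Q *
       jtheta (- (q powi (2 * n + 8) * y ^ 4)) Q) *
      (J2 (4 * n) (16 * n) q * S1 n x y q - q * J2 (8 * n) (16 * n) q * S2 n x y q))"

text \<open>The other denominators of \<open>Theta4\<close> are products of \<open>y\<close> and of factors
  \<open>J1 m q\<close> with \<open>m > 0\<close>, which never vanish for \<open>y \<noteq> 0\<close> and \<open>0 < |q| < 1\<close>.\<close>
definition Theta4_no_pole :: "int \<Rightarrow> complex \<Rightarrow> complex \<Rightarrow> complex \<Rightarrow> bool" where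
  "Theta4_no_pole n x y q \<longleftrightarrow>
     (let N = 2 * n + 4; Q = q powi (4 * N) in
      jtheta (y powi n / x powi n) (q powi (4 * n * N)) \<noteq> 0 \<and>
      jtheta (- (q powi (2 * n + 8) * x ^ 4)) Q \<noteq> 0 \<and>
      jtheta (- (q powi (2 * n + 8) * y ^ 4)) Q \<noteq> 0)"

end

theory Submission
  imports Defs "HOL-Complex_Analysis.Complex_Analysis" "HOL-Library.Nat_Bijection"
begin

text \<open>
  Write \<open>n = 2h + 1\<close>, \<open>Q = q^(8n+16)\<close>, \<open>P = Q^n\<close>, \<open>w = y^n/x^n\<close>, \<open>X = -q^(2n+8) x^4\<close>,
  \<open>Y = -q^(2n+8) y^4\<close>, and let \<open>E = j(w;P) (f - g + \<Theta>)\<close>, considered as a function of \<open>y\<close> for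
  fixed \<open>x\<close>.  The factor \<open>j(w;P)\<close> removes the prefactors of the Appell--Lerch sums; their remaining
  denominators are \<open>1 - Q^k/X\<close>, free of \<open>y\<close>, and \<open>1 - Q^k/Y\<close>.  Shifting the lattice of summation of
  \<open>f\<close> by \<open>(n+4, -n)\<close> gives \<open>E(Qy) = (Q^(h+1)/X) E(y)\<close>.

  Hence \<open>E\<close> vanishes as soon as its poles at \<open>Y = Q^k\<close> cancel: a function holomorphic for \<open>y \<noteq> 0\<close>
  with \<open>E(Qy) = C E(y)\<close> is zero unless \<open>C\<close> is a power of \<open>Q\<close>, and \<open>X\<close> is no power of \<open>Q\<close> because
  \<open>j(X;Q) \<noteq> 0\<close>.  At each pole exactly one summand of one Appell--Lerch sum is singular, with
  numerator a multiple of a theta function \<open>j(c;q^n)\<close> where \<open>c^2 = \<plusminus>i q^n\<close> up to shifts.  Its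
  even and odd parts are \<open>J_{8n,16n}\<close> and \<open>-c (1 \<mp> i) J_{4n,16n}\<close>, and there the sums \<open>S\<^sub>1\<close>, \<open>S\<^sub>2\<close>
  collapse to multiples of \<open>j(X;Q)\<close>.
\<close>


section \<open>Infinite products\<close>

text \<open>The vector \<open>(n + 4, - n)\<close> is orthogonal to the first axis for the quadratic
  form in the exponent of \<open>f\<close>, so translating by it rescales \<open>y\<close> alone, by
  \<open>q\<close> to the power \<open>(n+4)^2 - n^2 = 8n+16\<close>; this is the origin of
  \<open>Q\<close>. The translation moves the two quadrants \<open>sg r = sg s\<close>, and the
  discrepancy consists of \<open>n + 4\<close> full rows and \<open>n\<close> full columns. The
  summands of \<open>g\<close> leave exactly the same rows and columns behind, because splitting 1
  off a fraction \<open>1 / (1 - k)\<close> produces a complete theta series. So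
  \<open>f - g\<close> obeys a homogeneous equation although neither part is evaluated. What
  \<open>f - g\<close> lacks is holomorphy: \<open>f\<close> has no poles in \<open>y\<close>, the
  second half of \<open>g\<close> has. The theta quotient is a correction with the same multiplier
  and matching singular parts. It can be evaluated at the poles because there a rescaled
  \<open>y\<close> is a primitive eighth root of unity. Since division by 0 gives 0,
  \<open>E\<close> has accidental values at the poles. Hence analyticity and the functional equation
  are asserted only in punctured neighbourhoods and carried over by limits.\<close>

lemma qpoch_inf_convergent:
  fixes q x :: complex
  assumes "norm q < 1"
  shows "convergent_prod (\<lambda>i. 1 - x * q ^ i)"
proof -
  have "summable (\<lambda>i. norm (- x * q ^ i))"
    using assms by (auto simp: norm_mult norm_power intro!: summable_mult summable_geometric)
  hence "abs_convergent_prod (\<lambda>i. 1 + (- x * q ^ i))"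
    by (subst abs_convergent_prod_conv_summable) auto
  thus ?thesis
    using abs_convergent_prod_imp_convergent_prod by fastforce
qed

lemma qpoch_inf_LIMSEQ:
  assumes "norm q < 1"
  shows "(\<lambda>N. \<Prod>i<N. 1 - x * q ^ i) \<longlonglongrightarrow> qpoch_inf x q"
proof -
  have "(\<lambda>N. \<Prod>i\<le>N. 1 - x * q ^ i) \<longlonglongrightarrow> qpoch_inf x q"
    unfolding qpoch_inf_def using qpoch_inf_convergent[OF assms] by (rule convergent_prod_LIMSEQ)
  thus ?thesis
    by (subst (asm) LIMSEQ_lessThan_iff_atMost [symmetric])
qed

text \<open>The factors are grouped by the residue of the exponent modulo \<open>m\<close>. The
  grouped partial products are the subsequence of partial products of length \<open>N * m\<close>,
  so the limits agree.\<close>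

lemma qpoch_inf_split:
  assumes "norm q < 1" "m > 0"
  shows "qpoch_inf x q = (\<Prod>j<m. qpoch_inf (x * q ^ j) (q ^ m))"
proof -
  have "norm (q ^ m) < 1"
    using assms by (simp add: norm_power power_less_one_iff)
  hence "(\<lambda>N. \<Prod>j<m. \<Prod>i<N. 1 - (x * q ^ j) * (q ^ m) ^ i) \<longlonglongrightarrow> (\<Prod>j<m. qpoch_inf (x * q ^ j) (q ^ m))"
    by (intro tendsto_prod qpoch_inf_LIMSEQ)
  also have "(\<lambda>N. \<Prod>j<m. \<Prod>i<N. 1 - (x * q ^ j) * (q ^ m) ^ i) = (\<lambda>N. \<Prod>i<N * m. 1 - x * q ^ i)"
  proof
    fix N
    show "(\<Prod>j<m. \<Prod>i<N. 1 - (x * q ^ j) * (q ^ m) ^ i) = (\<Prod>i<N * m. 1 - x * q ^ i)"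
    proof (subst prod.swap, subst prod.nat_group[symmetric], rule prod.cong[OF refl])
      fix k
      show "(\<Prod>j<m. 1 - (x * q ^ j) * (q ^ m) ^ k) = (\<Prod>i\<in>{k * m..<k * m + m}. 1 - x * q ^ i)"
        by (rule prod.reindex_bij_witness[of _ "\<lambda>i. i - k * m" "\<lambda>j. j + k * m"])
           (auto simp: power_add power_mult[symmetric] mult_ac)
    qed
  qed
  finally have "(\<lambda>N. \<Prod>i<N * m. 1 - x * q ^ i) \<longlonglongrightarrow> (\<Prod>j<m. qpoch_inf (x * q ^ j) (q ^ m))" .
  moreover have "(\<lambda>N. \<Prod>i<N * m. 1 - x * q ^ i) \<longlonglongrightarrow> qpoch_inf x q"
    using LIMSEQ_subseq_LIMSEQ[OF qpoch_inf_LIMSEQ[OF assms(1), of x], of "\<lambda>N. N * m"] assms(2)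
    by (simp add: strict_mono_def o_def)
  ultimately show ?thesis
    using LIMSEQ_unique by blast
qed

lemma qpoch_inf_unfold:
  assumes "norm q < 1"
  shows "qpoch_inf x q = (1 - x) * qpoch_inf (x * q) q"
proof -
  have "(\<lambda>N. (1 - x) * (\<Prod>i<N. 1 - (x * q) * q ^ i)) \<longlonglongrightarrow> (1 - x) * qpoch_inf (x * q) q"
    by (intro tendsto_intros qpoch_inf_LIMSEQ assms)
  also have "(\<lambda>N. (1 - x) * (\<Prod>i<N. 1 - (x * q) * q ^ i)) = (\<lambda>N. \<Prod>i<Suc N. 1 - x * q ^ i)"
    by (subst prod.lessThan_Suc_shift) (simp add: mult_ac o_def)
  finally have "(\<lambda>N. \<Prod>i<Suc N. 1 - x * q ^ i) \<longlonglongrightarrow> (1 - x) * qpoch_inf (x * q) q" .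
  moreover have "(\<lambda>N. \<Prod>i<Suc N. 1 - x * q ^ i) \<longlonglongrightarrow> qpoch_inf x q"
    using qpoch_inf_LIMSEQ[OF assms] by (rule LIMSEQ_Suc)
  ultimately show ?thesis
    using LIMSEQ_unique by blast
qed

lemma qpoch_inf_eq_0_iff:
  assumes "norm q < 1"
  shows "qpoch_inf x q = 0 \<longleftrightarrow> (\<exists>i. x * q ^ i = 1)"
proof -
  have "(\<lambda>i. 1 - x * q ^ i) has_prod qpoch_inf x q"
    unfolding qpoch_inf_def using qpoch_inf_convergent[OF assms] by blast
  from has_prod_eq_0_iff[OF this] show ?thesis by force
qed

lemma qpoch_inf_2:
  assumes "norm q < 1"
  shows "qpoch_inf x q = qpoch_inf x (q\<^sup>2) * qpoch_inf (x * q) (q\<^sup>2)"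
  using qpoch_inf_split[OF assms, of 2 x] by (simp add: lessThan_nat_numeral eval_nat_numeral mult.commute)

lemma qpoch_inf_3:
  assumes "norm q < 1"
  shows "qpoch_inf x q = qpoch_inf x (q ^ 3) * qpoch_inf (x * q) (q ^ 3) * qpoch_inf (x * q\<^sup>2) (q ^ 3)"
  using qpoch_inf_split[OF assms, of 3 x] by (simp add: lessThan_nat_numeral eval_nat_numeral mult_ac)

lemma qpoch_inf_square:
  assumes "norm q < 1"
  shows "qpoch_inf (x\<^sup>2) (q\<^sup>2) = qpoch_inf x q * qpoch_inf (- x) q"
proof -
  have "(\<lambda>N. (\<Prod>i<N. 1 - x * q ^ i) * (\<Prod>i<N. 1 - (- x) * q ^ i)) \<longlonglongrightarrow> qpoch_inf x q * qpoch_inf (- x) q"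
    by (intro tendsto_intros qpoch_inf_LIMSEQ assms)
  also have "(\<lambda>N. (\<Prod>i<N. 1 - x * q ^ i) * (\<Prod>i<N. 1 - (- x) * q ^ i)) = (\<lambda>N. \<Prod>i<N. 1 - x\<^sup>2 * (q\<^sup>2) ^ i)"
    by (rule ext, subst prod.distrib[symmetric], rule prod.cong)
       (auto simp: power2_eq_square power_mult_distrib algebra_simps)
  finally have "(\<lambda>N. \<Prod>i<N. 1 - x\<^sup>2 * (q\<^sup>2) ^ i) \<longlonglongrightarrow> qpoch_inf x q * qpoch_inf (- x) q" .
  moreover have "norm (q\<^sup>2) < 1"
    using assms by (simp add: norm_power power_less_one_iff)
  ultimately show ?thesis
    using LIMSEQ_unique qpoch_inf_LIMSEQ by blast
qed

lemma qpoch_inf_self_nonzero: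
  assumes "norm q < 1"
  shows "qpoch_inf q q \<noteq> 0"
proof
  assume "qpoch_inf q q = 0"
  then obtain i where "q * q ^ i = 1"
    using qpoch_inf_eq_0_iff[OF assms] by blast
  hence "norm q ^ Suc i = 1"
    by (metis norm_one norm_power power_Suc)
  moreover have "norm q ^ Suc i < 1"
    using assms by (simp add: power_less_one_iff del: power_Suc)
  ultimately show False by simp
qed

text \<open>The three products in \<open>jtheta (q powi m) (q powi (3 * m))\<close> run through the
  exponents of \<open>q powi m\<close> in the residue classes 1, 2 and 0 modulo 3.\<close>

lemma J1_eq_qpoch_inf:
  assumes "norm q < 1" "m > 0" "q \<noteq> 0"
  shows "J1 m q = qpoch_inf (q powi m) (q powi m)"
proof -
  have n: "norm (q powi m) < 1"
    using assms by (simp add: norm_power_int power_int_def norm_power power_less_one_iff)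
  have 3: "q powi (3 * m) = (q powi m) ^ 3"
    by (simp add: power_int_mult mult.commute[of 3])
  show ?thesis
    unfolding J1_def J2_def jtheta_def 3 using assms qpoch_inf_3[OF n, of "q powi m"]
    by (simp add: power3_eq_cube power2_eq_square mult_ac)
qed

section \<open>The theta function as a product\<close>

lemma jtheta_reflect: "q \<noteq> 0 \<Longrightarrow> jtheta (q / x) q = jtheta x q"
  unfolding jtheta_def by (cases "x = 0") (auto simp: mult_ac)

text \<open>The factor \<open>1 - x\<close> is lost in one product, \<open>1 - 1 / x\<close> is
  gained in the other, and the quotient of the two is \<open>- 1 / x\<close>.\<close>

lemma jtheta_mult_base:
  assumes "norm q < 1" "q \<noteq> 0" "x \<noteq> 0"
  shows "jtheta (q * x) q = - jtheta x q / x"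
proof -
  have "jtheta (q * x) q = qpoch_inf (q * x) q * ((1 - 1 / x) * qpoch_inf (q / x) q) * qpoch_inf q q"
    unfolding jtheta_def using qpoch_inf_unfold[OF assms(1), of "1 / x"] assms(2) by (simp add: mult.commute)
  moreover have "jtheta x q = (1 - x) * qpoch_inf (q * x) q * qpoch_inf (q / x) q * qpoch_inf q q"
    unfolding jtheta_def using qpoch_inf_unfold[OF assms(1), of x] by (simp add: mult.commute)
  ultimately show ?thesis
    using assms(2,3) by (simp add: divide_simps) (simp add: algebra_simps)
qed

lemma jtheta_inverse:
  assumes "norm q < 1" "q \<noteq> 0" "x \<noteq> 0"
  shows "jtheta (1 / x) q = - jtheta x q / x"
  using jtheta_mult_base[OF assms] jtheta_reflect[of q "q * x"] assms by simp

lemma tri_Suc: "tri (r + 1) = tri r + r"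
proof -
  have "(r + 1) * (r + 1 - 1) = r * (r - 1) + 2 * r" by (simp add: algebra_simps)
  thus ?thesis unfolding tri_def by simp
qed

lemma two_tri: "2 * tri r = r * (r - 1)"
  unfolding tri_def by (rule dvd_mult_div_cancel) simp

lemma tri_0 [simp]: "tri 0 = 0" and tri_1 [simp]: "tri 1 = 0"
  by (simp_all add: tri_def)

lemma jtheta_shift:
  assumes "norm q < 1" "q \<noteq> 0" "x \<noteq> 0"
  shows "jtheta (q powi m * x) q = (-1) powi m * q powi (- tri m) * x powi (- m) * jtheta x q"
proof -
  define F where "F = (\<lambda>m. jtheta (q powi m * x) q = (-1) powi m * q powi (- tri m) * x powi (- m) * jtheta x q)"
  \<comment> \<open>An equivalence, because the induction over the integers descends as well as
    ascends.\<close>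
  have step: "F m \<longleftrightarrow> F (m + 1)" for m
  proof -
    have "jtheta (q powi (m + 1) * x) q = - jtheta (q powi m * x) q / (q powi m * x)"
      using jtheta_mult_base[OF assms(1,2), of "q powi m * x"] assms by (simp add: power_int_add mult_ac)
    hence "F (m + 1) \<longleftrightarrow> - jtheta (q powi m * x) q / (q powi m * x)
        = - ((-1) powi m * q powi (- tri m) * x powi (- m) * jtheta x q) / (q powi m * x)"
      unfolding F_def using assms
      by (simp add: power_int_add tri_Suc power_int_diff power_int_minus divide_inverse mult_ac)
    thus ?thesis
      unfolding F_def using assms by simp
  qed
  have "F m"
  proof (induction m rule: int_induct[of _ 0])
    case base
    show ?case by (simp add: F_def)
  next
    case (step1 i)
    thus ?case using step by blast
  next
    case (step2 i)
    thus ?case using step[of "i - 1"] by simp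
  qed
  thus ?thesis by (simp add: F_def)
qed

lemma jtheta_eq_0_iff:
  assumes "norm q < 1" "q \<noteq> 0" "x \<noteq> 0"
  shows "jtheta x q = 0 \<longleftrightarrow> (\<exists>m::int. x = q powi m)"
proof
  assume "jtheta x q = 0"
  hence "qpoch_inf x q = 0 \<or> qpoch_inf (q / x) q = 0"
    using qpoch_inf_self_nonzero[OF assms(1)] by (simp add: jtheta_def)
  thus "\<exists>m::int. x = q powi m"
  proof
    assume "qpoch_inf x q = 0"
    then obtain i where "x * q ^ i = 1" using qpoch_inf_eq_0_iff[OF assms(1)] by blast
    hence "x = q powi (- int i)" using assms by (simp add: power_int_minus field_simps)
    thus ?thesis by blast
  next
    assume "qpoch_inf (q / x) q = 0"
    then obtain i where "q / x * q ^ i = 1" using qpoch_inf_eq_0_iff[OF assms(1)] by blast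
    hence "x = q powi (int (Suc i))" using assms by (simp add: field_simps del: of_nat_Suc)
    thus ?thesis by blast
  qed
next
  assume "\<exists>m::int. x = q powi m"
  then obtain m :: int where m: "x = q powi m" by blast
  have "qpoch_inf 1 q = 0" using qpoch_inf_unfold[OF assms(1), of 1] by simp
  hence "jtheta 1 q = 0" by (simp add: jtheta_def)
  thus "jtheta x q = 0" using jtheta_shift[OF assms(1,2), of 1 m] by (simp add: m)
qed


section \<open>Jacobi's triple product identity\<close>

definition theta_term :: "complex \<Rightarrow> complex \<Rightarrow> int \<Rightarrow> complex" where
  "theta_term q x r = (-1) powi r * q powi (tri r) * x powi r"

lemma summable_gauss:
  fixes p z :: real
  assumes "0 < p" "p < 1" "0 < z"
  shows "summable (\<lambda>n::nat. p powi (tri (int n)) * z ^ n)"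
proof -
  have "(\<lambda>n. p ^ n * z) \<longlonglongrightarrow> 0 * z"
    using assms by (intro tendsto_intros LIMSEQ_power_zero) auto
  hence "eventually (\<lambda>n. p ^ n * z < 1 / 2) sequentially"
    by (intro order_tendstoD(2)[of _ "0 * z"]) auto
  then obtain N where N: "\<And>n. n \<ge> N \<Longrightarrow> p ^ n * z < 1 / 2"
    by (auto simp: eventually_sequentially)
  show ?thesis
  proof (rule summable_ratio_test[of "1 / 2" N])
    fix n assume n: "n \<ge> N"
    have tri: "tri (int (Suc n)) = tri (int n) + int n"
      using tri_Suc[of "int n"] by (simp add: add.commute)
    have "norm (p powi (tri (int (Suc n))) * z ^ Suc n) = (p ^ n * z) * norm (p powi (tri (int n)) * z ^ n)"
      unfolding tri using assms by (simp add: power_int_add norm_mult)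
    also have "\<dots> \<le> 1 / 2 * norm (p powi (tri (int n)) * z ^ n)"
      using N[OF n] by (intro mult_right_mono) auto
    finally show "norm (p powi (tri (int (Suc n))) * z ^ Suc n) \<le> 1 / 2 * norm (p powi (tri (int n)) * z ^ n)" .
  qed simp
qed

lemma tri_uminus: "tri (- r) = tri r + r"
proof -
  have "2 * tri (- r) = 2 * (tri r + r)"
    unfolding distrib_left two_tri by (simp add: algebra_simps)
  thus ?thesis by simp
qed

lemma summable_on_gauss:
  fixes p z :: real
  assumes "0 < p" "p < 1" "0 < z"
  shows "(\<lambda>r::int. p powi (tri r) * z powi r) summable_on UNIV"
proof -
  let ?f = "\<lambda>r::int. p powi (tri r) * z powi r"
  have pos: "?f r \<ge> 0" for r using assms by auto
  have 1: "?f summable_on (int ` UNIV)"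
  proof (subst summable_on_reindex)
    show "(?f \<circ> int) summable_on UNIV"
      using summable_gauss[OF assms] by (intro summable_nonneg_imp_summable_on) (auto simp: o_def pos assms less_imp_le)
  qed auto
  have 2: "?f summable_on ((\<lambda>n. - int n) ` UNIV)"
  proof (subst summable_on_reindex)
    \<comment> \<open>The negative half is a series of the same kind:
      \<open>tri (- n) = tri n + n\<close> replaces \<open>z\<close> by
      \<open>p / z\<close>.\<close>
    have "summable (\<lambda>n. p powi (tri (int n)) * (p / z) ^ n)"
      using assms by (intro summable_gauss) auto
    also have "(\<lambda>n. p powi (tri (int n)) * (p / z) ^ n) = ?f \<circ> (\<lambda>n. - int n)"
      using assms by (auto simp: o_def tri_uminus power_int_add power_int_minus power_divide field_simps)
    finally show "(?f \<circ> (\<lambda>n. - int n)) summable_on UNIV"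
      unfolding o_def by (intro summable_nonneg_imp_summable_on) (auto simp: pos assms less_imp_le)
  qed (auto simp: inj_on_def)
  have "UNIV = int ` UNIV \<union> (\<lambda>n. - int n) ` UNIV"
  proof (rule UNIV_eq_I)
    fix r :: int
    show "r \<in> int ` UNIV \<union> (\<lambda>n. - int n) ` UNIV"
      by (cases r rule: int_cases2) auto
  qed
  thus ?thesis using summable_on_union[OF 1 2] by simp
qed

lemma norm_theta_term: "norm (theta_term q x r) = norm q powi (tri r) * norm x powi r"
  by (simp add: theta_term_def norm_mult norm_power_int)

lemma summable_norm_theta_term:
  assumes "norm q < 1" "q \<noteq> 0" "x \<noteq> 0"
  shows "(\<lambda>r. norm (theta_term q x r)) summable_on UNIV"
  unfolding norm_theta_term using assms by (intro summable_on_gauss) auto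

section \<open>Gaussian binomial coefficients and the finite triple product\<close>

fun qbin :: "complex \<Rightarrow> nat \<Rightarrow> nat \<Rightarrow> complex" where
  "qbin q N 0 = 1"
| "qbin q 0 (Suc k) = 0"
| "qbin q (Suc N) (Suc k) = q ^ Suc k * qbin q N (Suc k) + qbin q N k"

lemma qbin_eq_0: "N < k \<Longrightarrow> qbin q N k = 0"
  by (induction q N k rule: qbin.induct) auto

text \<open>Taking out the first factor \<open>1 - x\<close> leaves the product at
  \<open>x * q\<close>, hence \<open>x\<close> varies in the induction. Comparing coefficients
  yields the recursion of \<open>qbin\<close>, a form of Pascal's rule.\<close>

lemma qbinomial_theorem:
  assumes "q \<noteq> 0"
  shows "(\<Prod>i<N. 1 - x * q ^ i) = (\<Sum>k\<le>N. (-1) ^ k * q powi (tri (int k)) * qbin q N k * x ^ k)"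
proof (induction N arbitrary: x)
  case 0
  show ?case by simp
next
  case (Suc N)
  let ?a = "\<lambda>N k. (-1) ^ k * q powi (tri (int k)) * qbin q N k"
  have tri: "q powi tri (1 + int k) = q powi tri (int k) * q ^ k" for k
    using tri_Suc[of "int k"] assms by (simp add: power_int_add add.commute)
  let ?S = "\<Sum>k\<le>N. ?a N k * (x * q) ^ k"
  have "?S = (\<Sum>k\<le>Suc N. ?a N k * (x * q) ^ k)"
    by (simp add: qbin_eq_0)
  also have "\<dots> = 1 + (\<Sum>k\<le>N. ?a N (Suc k) * (x * q) ^ Suc k)"
    by (subst sum.atMost_Suc_shift) simp
  finally have S: "?S = 1 + (\<Sum>k\<le>N. ?a N (Suc k) * (x * q) ^ Suc k)" .
  have "(\<Prod>i<Suc N. 1 - x * q ^ i) = (1 - x) * (\<Prod>i<N. 1 - (x * q) * q ^ i)"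
    by (subst prod.lessThan_Suc_shift) (simp add: mult_ac)
  also have "\<dots> = ?S - x * ?S"
    unfolding Suc.IH by (simp add: algebra_simps)
  also have "\<dots> = 1 + (\<Sum>k\<le>N. ?a N (Suc k) * (x * q) ^ Suc k) - x * ?S"
    by (subst (1) S) (rule refl)
  also have "\<dots> = 1 + (\<Sum>k\<le>N. ?a N (Suc k) * (x * q) ^ Suc k - x * (?a N k * (x * q) ^ k))"
    unfolding sum_subtractf sum_distrib_left by (rule add_diff_eq[symmetric])
  also have "\<dots> = 1 + (\<Sum>k\<le>N. ?a (Suc N) (Suc k) * x ^ Suc k)"
  proof (rule arg_cong[of _ _ "\<lambda>z. 1 + z"], rule sum.cong[OF refl])
    fix k
    define t where "t = q powi tri (int k)"
    have t: "q powi tri (int (Suc k)) = t * q ^ k"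
      using tri[of k] by (simp add: t_def)
    show "?a N (Suc k) * (x * q) ^ Suc k - x * (?a N k * (x * q) ^ k) = ?a (Suc N) (Suc k) * x ^ Suc k"
      unfolding t t_def[symmetric] power_mult_distrib by (simp add: algebra_simps)
  qed
  also have "\<dots> = (\<Sum>k\<le>Suc N. ?a (Suc N) k * x ^ k)"
    by (subst sum.atMost_Suc_shift) simp
  finally show ?case .
qed

text \<open>A product identity instead of a quotient, so that it survives at roots of unity. The
  induction is on \<open>m + k\<close> because both neighbours in Pascal's rule have the same upper
  index.\<close>

lemma qbin_closed_form:
  "qbin q (m + k) k * (\<Prod>i<k. 1 - q * q ^ i) * (\<Prod>i<m. 1 - q * q ^ i) = (\<Prod>i<m + k. 1 - q * q ^ i)"
proof (induction "m + k" arbitrary: m k)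
  case 0
  thus ?case by simp
next
  case (Suc N)
  let ?F = "\<lambda>N. \<Prod>i<N. 1 - q * q ^ i"
  show ?case
  proof (cases k)
    case 0
    thus ?thesis by simp
  next
    case k: (Suc k')
    show ?thesis
    proof (cases m)
      case 0
      have "qbin q k k = 1" for k
        by (induction k) (auto simp: qbin_eq_0)
      thus ?thesis using 0 by simp
    next
      case m: (Suc m')
      have N: "N = m' + Suc k'" "N = m + k'" "m + k = Suc N" using Suc.hyps(2) k m by auto
      have 1: "qbin q N (Suc k') * ?F (Suc k') * ?F m' = ?F N"
        using Suc.hyps(1)[of m' "Suc k'"] N by simp
      have 2: "qbin q N k' * ?F k' * ?F m = ?F N"
        using Suc.hyps(1)[of m k'] N by simp
      have "qbin q (m + k) k * ?F k * ?F m = 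
         q ^ Suc k' * (1 - q * q ^ m') * (qbin q N (Suc k') * ?F (Suc k') * ?F m')
         + (1 - q * q ^ k') * (qbin q N k' * ?F k' * ?F m)"
      proof -
        have "qbin q (m + k) k = q ^ Suc k' * qbin q N (Suc k') + qbin q N k'"
          unfolding N(3) by (simp add: k)
        note 1 = this
        have 2: "?F m = (1 - q * q ^ m') * ?F m'" "?F k = (1 - q * q ^ k') * ?F k'"
            "?F (Suc k') = (1 - q * q ^ k') * ?F k'"
          by (simp_all add: m k)
        show ?thesis unfolding 1 2 by (simp add: algebra_simps)
      qed
      also have "\<dots> = (1 - q * q ^ N) * ?F N"
        unfolding 1 2 unfolding N(1) by (simp add: algebra_simps power_add)
      finally show ?thesis unfolding N(3) by (simp add: mult_ac)
    qed
  qed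
qed

text \<open>The \<open>q\<close>-binomial theorem for \<open>2 * n\<close> factors starting at
  \<open>x * q powi (- n)\<close>. The upper half is the first product; each lower factor
  \<open>1 - x / q ^ j\<close> is \<open>- x / q ^ j\<close> times
  \<open>1 - q ^ j / x\<close>.\<close>

lemma finite_triple_product:
  assumes "q \<noteq> 0" "x \<noteq> 0"
  shows "(\<Prod>i<n. 1 - x * q ^ i) * (\<Prod>i<n. 1 - (q / x) * q ^ i) =
         (\<Sum>k\<le>2*n. theta_term q x (int k - int n) * qbin q (2 * n) k)"
proof -
  define y where "y = x * q powi (- int n)"
  have y0: "y \<noteq> 0" using assms by (simp add: y_def)
  have "(\<Prod>i<2*n. 1 - y * q ^ i) = (\<Prod>i<n. 1 - y * q ^ i) * (\<Prod>i<n. 1 - y * q ^ (i + n))"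
    using prod.nat_group[of "\<lambda>i. 1 - y * q ^ i" n 2, symmetric]
    by (simp add: mult.commute lessThan_nat_numeral eval_nat_numeral atLeast0LessThan
        prod.shift_bounds_nat_ivl[of _ 0 n n, simplified])
  also have "(\<Prod>i<n. 1 - y * q ^ (i + n)) = (\<Prod>i<n. 1 - x * q ^ i)"
    using assms by (intro prod.cong) (auto simp: y_def power_int_minus power_add)
  also have "(\<Prod>i<n. 1 - y * q ^ i) = (\<Prod>i<n. - x * q powi (- int (Suc i)) * (1 - (q / x) * q ^ i))"
  proof (rule prod.reindex_bij_witness[of _ "\<lambda>i. n - Suc i" "\<lambda>i. n - Suc i"])
    fix i assume i: "i \<in> {..<n}"
    define j where "j = n - Suc i"
    have "n = i + Suc j" using i by (auto simp: j_def)
    thus "- x * q powi (- int (Suc (n - Suc i))) * (1 - (q / x) * q ^ (n - Suc i)) = 1 - y * q ^ i"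
      unfolding j_def[symmetric] y_def using assms
      by (simp add: power_int_minus power_add field_simps del: of_nat_Suc)
  qed auto
  also have "\<dots> = (\<Prod>i<n. - x * q powi (- int (Suc i))) * (\<Prod>i<n. 1 - (q / x) * q ^ i)"
    by (rule prod.distrib)
  also have "(\<Prod>i<n. - x * q powi (- int (Suc i))) = (-1) powi int n * x ^ n * q powi (- tri (int n + 1))"
  proof (induction n)
    case 0
    thus ?case by simp
  next
    case (Suc n)
    have "tri (int (Suc n) + 1) = tri (int n + 1) + int (Suc n)"
      using tri_Suc[of "int n + 1"] by simp
    thus ?case using Suc assms
      by (simp add: power_int_add power_int_diff power_int_minus field_simps)
  qed
  finally have "(\<Prod>i<n. 1 - x * q ^ i) * (\<Prod>i<n. 1 - (q / x) * q ^ i) =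
     (-1) powi int n * x powi (- int n) * q powi (tri (int n + 1)) * (\<Prod>i<2*n. 1 - y * q ^ i)"
    using assms by (simp add: power_int_minus field_simps)
  also have "(\<Prod>i<2*n. 1 - y * q ^ i) = (\<Sum>k\<le>2*n. (-1) ^ k * q powi (tri (int k)) * qbin q (2*n) k * y ^ k)"
    using assms by (intro qbinomial_theorem)
  also have "(-1) powi int n * x powi (- int n) * q powi (tri (int n + 1)) * \<dots> =
     (\<Sum>k\<le>2*n. theta_term q x (int k - int n) * qbin q (2 * n) k)"
    unfolding sum_distrib_left
  proof (rule sum.cong)
    fix k
    have e: "tri (int n + 1) + tri (int k) - int n * int k = tri (int k - int n)"
    proof -
      have "2 * (tri (int n + 1) + tri (int k) - int n * int k) = 2 * tri (int k - int n)"
        unfolding distrib_left right_diff_distrib two_tri by (simp add: algebra_simps)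
      thus ?thesis by simp
    qed
    have "q powi tri (int k - int n) = q powi (tri (int n + 1)) * q powi tri (int k) * (q powi (- int n)) ^ k"
      unfolding e[symmetric] power_int_diff[OF disjI1[OF assms(1)]]
      using assms by (simp add: power_int_add power_int_minus power_int_power power_inverse field_simps power_int_mult)
         (simp add: mult.commute flip: power_mult)
    thus "(-1) powi int n * x powi (- int n) * q powi (tri (int n + 1)) * ((-1) ^ k * q powi (tri (int k)) * qbin q (2*n) k * y ^ k) =
       theta_term q x (int k - int n) * qbin q (2 * n) k"
      unfolding theta_term_def y_def using assms
      by (simp add: power_mult_distrib power_int_diff power_int_minus field_simps)
  qed auto
  finally show ?thesis .
qed

text \<open>Tannery's theorem for series over the naturals, transported along the bijection
  \<open>int_decode\<close>.\<close>

lemma infsum_int_tannery: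
  fixes a :: "nat \<Rightarrow> int \<Rightarrow> complex"
  assumes lim: "\<And>r. (\<lambda>n. a n r) \<longlonglongrightarrow> b r"
    and bound: "\<And>n r. norm (a n r) \<le> M r" and M: "M summable_on UNIV"
  shows "(\<lambda>n. \<Sum>\<^sub>\<infinity>r. a n r) \<longlonglongrightarrow> (\<Sum>\<^sub>\<infinity>r. b r)"
proof -
  have bound': "norm (b r) \<le> M r" for r
    by (rule LIMSEQ_le_const2[OF tendsto_norm[OF lim]]) (use bound in auto)
  have conv: "infsum f UNIV = suminf (\<lambda>k. f (int_decode k))" if "\<And>r. norm (f r) \<le> M r" for f :: "int \<Rightarrow> complex"
  proof -
    have "f summable_on UNIV"
      by (rule abs_summable_summable, rule Infinite_Sum.abs_summable_on_comparison_test'[OF M], rule that)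
    hence "(f has_sum infsum f UNIV) UNIV" by simp
    hence "((\<lambda>k. f (int_decode k)) has_sum infsum f UNIV) UNIV"
      using has_sum_reindex_bij_betw[OF bij_int_decode, of f] by simp
    thus ?thesis by (intro sums_unique has_sum_imp_sums)
  qed
  have "summable (\<lambda>k. M (int_decode k))"
    using summable_on_reindex_bij_betw[OF bij_int_decode, of M] M by (intro summable_on_imp_summable) simp
  moreover have "\<forall>\<^sub>F (k, n) in at_top \<times>\<^sub>F sequentially. norm (a n (int_decode k)) \<le> M (int_decode k)"
    using bound by (intro always_eventually) auto
  ultimately have "(\<lambda>n. suminf (\<lambda>k. a n (int_decode k))) \<longlonglongrightarrow> suminf (\<lambda>k. b (int_decode k))"
    using tannerys_theorem[of "\<lambda>k n. a n (int_decode k)" "\<lambda>k. b (int_decode k)" sequentially "\<lambda>k. M (int_decode k)"] lim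
    by auto
  thus ?thesis by (simp add: conv[of "a _", OF bound] conv[of b, OF bound'])
qed

text \<open>The limit of \<open>finite_triple_product\<close>. For fixed \<open>r\<close> the
  Gaussian coefficient tends to \<open>1 / qpoch_inf q q\<close>. It is bounded uniformly because
  the finite products and their reciprocals are, so a constant times the theta term is a
  majorant.\<close>

theorem jacobi_triple_product:
  assumes "norm q < 1" "q \<noteq> 0" "x \<noteq> 0"
  shows "(theta_term q x has_sum jtheta x q) UNIV"
proof -
  let ?F = "\<lambda>N. \<Prod>i<N. 1 - q * q ^ i"
  let ?L = "qpoch_inf q q"
  note lim = qpoch_inf_LIMSEQ[OF assms(1)]
  have L0: "?L \<noteq> 0" by (rule qpoch_inf_self_nonzero[OF assms(1)])
  have F0: "?F N \<noteq> 0" for N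
  proof -
    have "q * q ^ i \<noteq> 1" for i
      using qpoch_inf_eq_0_iff[OF assms(1), of q] L0 by blast
    thus ?thesis by auto
  qed
  obtain B1 where B1: "\<And>N. norm (?F N) \<le> B1"
    using convergent_imp_Bseq[OF convergentI[OF lim[of q]]] unfolding Bseq_def by blast
  have lim2: "(\<lambda>N. 1 / ?F N) \<longlonglongrightarrow> 1 / ?L"
    by (intro tendsto_intros lim L0)
  obtain B2 where B2: "\<And>N. norm (1 / ?F N) \<le> B2"
    using convergent_imp_Bseq[OF convergentI[OF lim2]] unfolding Bseq_def by blast
  have B2': "B2 \<ge> 0" by (rule order_trans[OF norm_ge_zero B2[of 0]])
  have B1': "B1 \<ge> 0" by (rule order_trans[OF norm_ge_zero B1[of 0]])
  have qb: "qbin q N k = ?F N * (1 / ?F k) * (1 / ?F (N - k))" if "k \<le> N" for N k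
    using qbin_closed_form[of q "N - k" k] that F0[of k] F0[of "N - k"] by (simp add: field_simps)
  \<comment> \<open>Extension by 0 beyond \<open>\<bar>r\<bar> \<le> n\<close> puts all the finite
    sums on one index set, as dominated convergence requires.\<close>
  define a where "a = (\<lambda>n r. if \<bar>r\<bar> \<le> int n then theta_term q x r * qbin q (2 * n) (nat (r + int n)) else 0)"
  define M where "M = (\<lambda>r. norm (theta_term q x r) * (B1 * B2 * B2))"
  have bound: "norm (a n r) \<le> M r" for n r
  proof (cases "\<bar>r\<bar> \<le> int n")
    case True
    have "norm (qbin q (2*n) (nat (r + int n))) \<le> B1 * B2 * B2"
    proof -
      have "qbin q (2*n) (nat (r + int n)) = ?F (2*n) * (1 / ?F (nat (r + int n))) * (1 / ?F (2*n - nat (r + int n)))"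
        using True by (intro qb) auto
      thus ?thesis
        by (simp only: norm_mult) (intro mult_mono B1 B2 B1' B2' mult_nonneg_nonneg norm_ge_zero)
    qed
    thus ?thesis using True by (auto simp: a_def M_def norm_mult intro!: mult_left_mono)
  qed (auto simp: a_def M_def B1' B2')
  have M: "M summable_on UNIV"
    unfolding M_def by (intro summable_on_cmult_left summable_norm_theta_term assms)
  have lim3: "(\<lambda>n. a n r) \<longlonglongrightarrow> theta_term q x r * (1 / ?L)" for r
  proof -
    have A: "filterlim (\<lambda>n. 2 * n) sequentially sequentially"
      "filterlim (\<lambda>n. nat (r + int n)) sequentially sequentially"
      "filterlim (\<lambda>n. 2 * n - nat (r + int n)) sequentially sequentially"
      unfolding filterlim_at_top
    proof safe
      fix Z :: nat
      show "\<forall>\<^sub>F n in sequentially. Z \<le> 2 * n"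
        by (rule eventually_sequentiallyI[of Z]) simp
      show "\<forall>\<^sub>F n in sequentially. Z \<le> nat (r + int n)"
        by (rule eventually_sequentiallyI[of "nat \<bar>r\<bar> + Z"]) linarith
      show "\<forall>\<^sub>F n in sequentially. Z \<le> 2 * n - nat (r + int n)"
        by (rule eventually_sequentiallyI[of "nat \<bar>r\<bar> + Z"]) linarith
    qed
    have "(\<lambda>n. theta_term q x r * (?F (2 * n) * (1 / ?F (nat (r + int n))) * (1 / ?F (2 * n - nat (r + int n)))))
       \<longlonglongrightarrow> theta_term q x r * (?L * (1 / ?L) * (1 / ?L))"
      by (intro tendsto_mult tendsto_const filterlim_compose[OF lim A(1)]
          filterlim_compose[OF lim2 A(2)] filterlim_compose[OF lim2 A(3)])
    moreover have "eventually (\<lambda>n. theta_term q x r * (?F (2 * n) * (1 / ?F (nat (r + int n))) * (1 / ?F (2 * n - nat (r + int n)))) = a n r) sequentially"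
      using eventually_ge_at_top[of "nat \<bar>r\<bar>"]
    proof eventually_elim
      case (elim n)
      thus ?case unfolding a_def using qb[of "nat (r + int n)" "2 * n"] by auto
    qed
    ultimately have "(\<lambda>n. a n r) \<longlonglongrightarrow> theta_term q x r * (?L * (1 / ?L) * (1 / ?L))"
      by (rule Lim_transform_eventually)
    thus ?thesis using L0 by simp
  qed
  have sum_a: "infsum (a n) UNIV = (\<Prod>i<n. 1 - x * q ^ i) * (\<Prod>i<n. 1 - (q / x) * q ^ i)" for n
  proof -
    have "infsum (a n) UNIV = infsum (a n) {- int n..int n}"
      by (rule infsum_cong_neutral) (auto simp: a_def)
    also have "\<dots> = sum (a n) {- int n..int n}" by simp
    also have "\<dots> = (\<Sum>k\<le>2*n. theta_term q x (int k - int n) * qbin q (2 * n) k)"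
      by (rule sum.reindex_bij_witness[of _ "\<lambda>k. int k - int n" "\<lambda>r. nat (r + int n)"])
         (auto simp: a_def nat_le_iff)
    finally show ?thesis using finite_triple_product[OF assms(2,3)] by simp
  qed
  have "(\<lambda>n. infsum (a n) UNIV) \<longlonglongrightarrow> qpoch_inf x q * qpoch_inf (q / x) q"
    unfolding sum_a by (intro tendsto_intros lim)
  moreover have "(\<lambda>n. infsum (a n) UNIV) \<longlonglongrightarrow> infsum (\<lambda>r. theta_term q x r * (1 / ?L)) UNIV"
    by (rule infsum_int_tannery[OF lim3 bound M])
  ultimately have "infsum (\<lambda>r. theta_term q x r * (1 / ?L)) UNIV = qpoch_inf x q * qpoch_inf (q / x) q"
    by (intro LIMSEQ_unique)
  hence "infsum (theta_term q x) UNIV = jtheta x q"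
    using L0 by (subst (asm) infsum_cmult_left') (auto simp: jtheta_def field_simps)
  moreover have "theta_term q x summable_on UNIV"
    by (rule abs_summable_summable[OF summable_norm_theta_term[OF assms]])
  ultimately show ?thesis by (simp add: has_sum_iff)
qed


section \<open>Theta identities\<close>

lemma tri_exponents:
  "tri (2 * i) = 4 * tri i + i" "tri (2 * i + 1) = 4 * tri i + 3 * i"
  "tri (i - j) + tri (i + j) = 2 * tri i + (2 * tri j + j)"
  "tri (i - j + 1) + tri (i + j) = (2 * tri i + i) + 2 * tri j"
proof -
  show "tri (2 * i) = 4 * tri i + i" "tri (2 * i + 1) = 4 * tri i + 3 * i"
    using two_tri[of "2 * i"] two_tri[of "2 * i + 1"] two_tri[of i] by (simp_all add: algebra_simps)
  show "tri (i - j) + tri (i + j) = 2 * tri i + (2 * tri j + j)"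
    using two_tri[of "i - j"] two_tri[of "i + j"] two_tri[of i] two_tri[of j] by (simp add: algebra_simps)
  show "tri (i - j + 1) + tri (i + j) = (2 * tri i + i) + 2 * tri j"
    using two_tri[of "i - j + 1"] two_tri[of "i + j"] two_tri[of i] two_tri[of j] by (simp add: algebra_simps)
qed

lemma has_sum_even_odd:
  fixes f :: "int \<Rightarrow> 'a::topological_comm_monoid_add"
  assumes "((\<lambda>i. f (2 * i)) has_sum a) UNIV" "((\<lambda>i. f (2 * i + 1)) has_sum b) UNIV"
  shows "(f has_sum (a + b)) UNIV"
proof -
  have "(f has_sum a) (range (\<lambda>i. 2 * i))"
    using assms(1) by (subst has_sum_reindex) (auto simp: inj_on_def o_def)
  moreover have "(f has_sum b) (range (\<lambda>i. 2 * i + 1))"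
    using assms(2) by (subst has_sum_reindex) (auto simp: inj_on_def o_def)
  moreover have "range (\<lambda>i::int. 2 * i) \<inter> range (\<lambda>i. 2 * i + 1) = {}"
    by (auto, presburger)
  ultimately have "(f has_sum (a + b)) (range (\<lambda>i. 2 * i) \<union> range (\<lambda>i. 2 * i + 1))"
    by (rule has_sum_Un_disjoint)
  moreover have "range (\<lambda>i::int. 2 * i) \<union> range (\<lambda>i. 2 * i + 1) = UNIV"
  proof (rule UNIV_eq_I[symmetric])
    fix r :: int
    show "r \<in> range (\<lambda>i. 2 * i) \<union> range (\<lambda>i. 2 * i + 1)"
      by (cases "even r") (auto elim: evenE oddE)
  qed
  ultimately show ?thesis by simp
qed

lemma power_int_uminus_1_mult: "(-1 :: complex) powi i * (- z) powi i = z powi i"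
  by (simp flip: power_int_mult_distrib)

lemma power_power_int: "((z :: complex) ^ k) powi i = (z powi i) ^ k"
  by (metis mult.commute power_int_mult power_int_of_nat)

lemma power_int_minus_one_sq [simp]: "((-1 :: complex) powi i)\<^sup>2 = 1"
  by (simp add: power2_eq_square)

text \<open>Even and odd indices are summed separately; \<open>tri_exponents\<close> shows that each
  half has base \<open>q ^ 4\<close>. The sign of \<open>theta_term\<close> is constant on a parity
  class, and the minus signs in the new arguments compensate for the sign built into
  \<open>theta_term\<close> there.\<close>

lemma jtheta_even_odd:
  assumes "norm q < 1" "q \<noteq> 0" "z \<noteq> 0"
  shows "jtheta z q = jtheta (- (q * z\<^sup>2)) (q ^ 4) - z * jtheta (- (q ^ 3 * z\<^sup>2)) (q ^ 4)"
proof -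
  have q4: "norm (q ^ 4) < 1" using assms by (simp add: norm_power power_less_one_iff)
  have 1: "theta_term q z (2 * i) = theta_term (q ^ 4) (- (q * z\<^sup>2)) i" for i
  proof -
    have "theta_term (q ^ 4) (- (q * z\<^sup>2)) i = (q ^ 4) powi tri i * ((-1) powi i * (- (q * z\<^sup>2)) powi i)"
      by (simp add: theta_term_def)
    thus ?thesis
      unfolding power_int_uminus_1_mult unfolding theta_term_def tri_exponents using assms
      by (simp add: power_int_add power_int_mult power_int_mult_distrib power_power_int mult_ac)
  qed
  have 2: "theta_term q z (2 * i + 1) = - z * theta_term (q ^ 4) (- (q ^ 3 * z\<^sup>2)) i" for i
  proof -
    have "theta_term (q ^ 4) (- (q ^ 3 * z\<^sup>2)) i = (q ^ 4) powi tri i * ((-1) powi i * (- (q ^ 3 * z\<^sup>2)) powi i)"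
      by (simp add: theta_term_def)
    thus ?thesis
      unfolding power_int_uminus_1_mult unfolding theta_term_def tri_exponents using assms
      by (simp add: power_int_add power_int_mult power_int_mult_distrib power_power_int mult_ac)
  qed
  have "(theta_term q z has_sum (jtheta (- (q * z\<^sup>2)) (q ^ 4) + - z * jtheta (- (q ^ 3 * z\<^sup>2)) (q ^ 4))) UNIV"
    by (rule has_sum_even_odd; unfold 1 2;
        (rule has_sum_cmult_right)?; rule jacobi_triple_product) (use assms q4 in auto)
  thus ?thesis
    using jacobi_triple_product[OF assms] has_sum_unique by fastforce
qed

lemma summable_on_product:
  fixes f :: "'i \<Rightarrow> real" and g :: "'j \<Rightarrow> real"
  assumes "f summable_on A" "g summable_on B" "\<And>i. f i \<ge> 0" "\<And>j. g j \<ge> 0"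
  shows "(\<lambda>(i, j). f i * g j) summable_on A \<times> B"
proof (rule summable_on_SigmaI)
  show "((\<lambda>j. case (i, j) of (i, j) \<Rightarrow> f i * g j) has_sum f i * infsum g B) B" for i
    using assms(2) by (simp add: has_sum_cmult_right)
  show "(\<lambda>i. f i * infsum g B) summable_on A"
    using assms(1) by (rule summable_on_cmult_left)
qed (use assms in auto)

lemma has_sum_product:
  fixes f :: "'i \<Rightarrow> complex" and g :: "'j \<Rightarrow> complex"
  assumes "(f has_sum a) A" "(g has_sum b) B"
    and "(\<lambda>i. norm (f i)) summable_on A" "(\<lambda>j. norm (g j)) summable_on B"
  shows "((\<lambda>(i, j). f i * g j) has_sum (a * b)) (A \<times> B)"
proof (rule has_sum_SigmaI)
  show "((\<lambda>j. case (i, j) of (i, j) \<Rightarrow> f i * g j) has_sum f i * b) B" for i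
    using assms(2) by (simp add: has_sum_cmult_right)
  show "((\<lambda>i. f i * b) has_sum a * b) A"
    using assms(1) by (rule has_sum_cmult_left)
  have "(\<lambda>p. norm ((\<lambda>(i, j). f i * g j) p)) summable_on A \<times> B"
    using summable_on_product[OF assms(3,4)] by (simp add: case_prod_unfold norm_mult)
  thus "(\<lambda>(i, j). f i * g j) summable_on A \<times> B"
    by (rule abs_summable_summable)
qed

lemma has_sum_theta_product:
  assumes "norm q < 1" "q \<noteq> 0" "x \<noteq> 0" "norm q' < 1" "q' \<noteq> 0" "y \<noteq> 0"
  shows "((\<lambda>(i, j). theta_term q x i * theta_term q' y j) has_sum (jtheta x q * jtheta y q')) UNIV"
  using has_sum_product[OF jacobi_triple_product[OF assms(1-3)] jacobi_triple_product[OF assms(4-6)]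
    summable_norm_theta_term[OF assms(1-3)] summable_norm_theta_term[OF assms(4-6)]] by simp

text \<open>The double series is split by the parity of \<open>a + b\<close>. With
  \<open>(a, b) = (i - j, i + j)\<close> or \<open>(i - j + 1, i + j)\<close> the exponent
  \<open>tri a + tri b\<close> has no mixed term, so each half is a product of two series of base
  \<open>q\<^sup>2\<close>.\<close>

lemma jtheta_product:
  assumes "norm q < 1" "q \<noteq> 0" "x \<noteq> 0" "y \<noteq> 0"
  shows "jtheta x q * jtheta y q = jtheta (- (x * y)) (q\<^sup>2) * jtheta (- (q * y / x)) (q\<^sup>2)
     - x * (jtheta (- (q * x * y)) (q\<^sup>2) * jtheta (- (y / x)) (q\<^sup>2))"
proof -
  have q2: "norm (q\<^sup>2) < 1" using assms by (simp add: norm_power power_less_one_iff)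
  let ?F = "\<lambda>(a, b). theta_term q x a * theta_term q y b"
  have s: "(-1 :: complex) powi (i - j) * (-1) powi (i + j) = 1" for i j :: int
    by (simp flip: power_int_add)
  have 1: "?F (i - j, i + j) = theta_term (q\<^sup>2) (- (x * y)) i * theta_term (q\<^sup>2) (- (q * y / x)) j" for i j
  proof -
    have "?F (i - j, i + j) = q powi (tri (i - j) + tri (i + j)) * (x powi (i - j) * y powi (i + j))"
      unfolding theta_term_def using s[of i j] assms by (simp add: power_int_add mult_ac)
    also have "\<dots> = theta_term (q\<^sup>2) (- (x * y)) i * theta_term (q\<^sup>2) (- (q * y / x)) j"
    proof -
      have "theta_term (q\<^sup>2) (- (x * y)) i * theta_term (q\<^sup>2) (- (q * y / x)) j =
          (q\<^sup>2) powi tri i * ((-1) powi i * (- (x * y)) powi i) * ((q\<^sup>2) powi tri j * ((-1) powi j * (- (q * y / x)) powi j))"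
        by (simp add: theta_term_def)
      thus ?thesis
        unfolding power_int_uminus_1_mult tri_exponents using assms
        by (simp add: power_int_add power_int_mult power_int_mult_distrib power_int_divide_distrib power_int_diff power_power_int)
    qed
    finally show ?thesis .
  qed
  have s2: "(-1 :: complex) powi (i - j + 1) * (-1) powi (i + j) = -1" for i j :: int
    using s[of i j] by (simp add: power_int_add)
  have 2: "?F (i - j + 1, i + j) = - x * (theta_term (q\<^sup>2) (- (q * x * y)) i * theta_term (q\<^sup>2) (- (y / x)) j)" for i j
  proof -
    have "?F (i - j + 1, i + j) = - (q powi (tri (i - j + 1) + tri (i + j)) * (x powi (i - j + 1) * y powi (i + j)))"
      unfolding theta_term_def using s2[of i j] assms by (simp add: power_int_add mult_ac)
    also have "\<dots> = - x * (theta_term (q\<^sup>2) (- (q * x * y)) i * theta_term (q\<^sup>2) (- (y / x)) j)"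
    proof -
      have "theta_term (q\<^sup>2) (- (q * x * y)) i * theta_term (q\<^sup>2) (- (y / x)) j =
          (q\<^sup>2) powi tri i * ((-1) powi i * (- (q * x * y)) powi i) * ((q\<^sup>2) powi tri j * ((-1) powi j * (- (y / x)) powi j))"
        by (simp add: theta_term_def)
      thus ?thesis
        unfolding power_int_uminus_1_mult tri_exponents using assms
        by (simp add: power_int_add power_int_mult power_int_mult_distrib power_int_divide_distrib power_int_diff power_power_int)
    qed
    finally show ?thesis .
  qed
  have A: "(?F has_sum (jtheta (- (x * y)) (q\<^sup>2) * jtheta (- (q * y / x)) (q\<^sup>2))) (range (\<lambda>(i, j). (i - j, i + j)))"
  proof (subst has_sum_reindex)
    have "?F \<circ> (\<lambda>(i, j). (i - j, i + j)) = (\<lambda>(i, j). theta_term (q\<^sup>2) (- (x * y)) i * theta_term (q\<^sup>2) (- (q * y / x)) j)"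
      using 1 by (auto simp: fun_eq_iff)
    thus "(?F \<circ> (\<lambda>(i, j). (i - j, i + j)) has_sum (jtheta (- (x * y)) (q\<^sup>2) * jtheta (- (q * y / x)) (q\<^sup>2))) UNIV"
      using has_sum_theta_product[of "q\<^sup>2" "- (x * y)" "q\<^sup>2" "- (q * y / x)"] assms q2 by simp
  qed (auto simp: inj_on_def)
  have B: "(?F has_sum (- x * (jtheta (- (q * x * y)) (q\<^sup>2) * jtheta (- (y / x)) (q\<^sup>2)))) (range (\<lambda>(i, j). (i - j + 1, i + j)))"
  proof (subst has_sum_reindex)
    have "?F \<circ> (\<lambda>(i, j). (i - j + 1, i + j)) = (\<lambda>p. - x * (case p of (i, j) \<Rightarrow> theta_term (q\<^sup>2) (- (q * x * y)) i * theta_term (q\<^sup>2) (- (y / x)) j))"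
      using 2 by (auto simp: fun_eq_iff)
    thus "(?F \<circ> (\<lambda>(i, j). (i - j + 1, i + j)) has_sum (- x * (jtheta (- (q * x * y)) (q\<^sup>2) * jtheta (- (y / x)) (q\<^sup>2)))) UNIV"
      using has_sum_cmult_right[OF has_sum_theta_product[of "q\<^sup>2" "- (q * x * y)" "q\<^sup>2" "- (y / x)"], of "- x"] assms q2 by simp
  qed (auto simp: inj_on_def)
  have U: "range (\<lambda>(i::int, j). (i - j, i + j)) \<union> range (\<lambda>(i, j). (i - j + 1, i + j)) = UNIV"
  proof (rule UNIV_eq_I[symmetric])
    fix p :: "int \<times> int"
    obtain a b where p: "p = (a, b)" by (cases p)
    show "p \<in> range (\<lambda>(i::int, j). (i - j, i + j)) \<union> range (\<lambda>(i, j). (i - j + 1, i + j))"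
    proof (cases "even (a + b)")
      case True
      then obtain k where "a + b = 2 * k" by (elim evenE)
      hence "p = (\<lambda>(i, j). (i - j, i + j)) (k, b - k)" by (simp add: p)
      thus ?thesis by blast
    next
      case False
      then obtain k where "a + b = 2 * k + 1" by (elim oddE)
      hence "p = (\<lambda>(i, j). (i - j + 1, i + j)) (k, b - k)" by (simp add: p)
      thus ?thesis by blast
    qed
  qed
  have D: "range (\<lambda>(i::int, j). (i - j, i + j)) \<inter> range (\<lambda>(i, j). (i - j + 1, i + j)) = {}"
    by (auto, presburger)
  have "(?F has_sum (jtheta (- (x * y)) (q\<^sup>2) * jtheta (- (q * y / x)) (q\<^sup>2)
     + - x * (jtheta (- (q * x * y)) (q\<^sup>2) * jtheta (- (y / x)) (q\<^sup>2)))) UNIV"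
    using has_sum_Un_disjoint[OF A B D] unfolding U .
  thus ?thesis
    using has_sum_theta_product[of q x q y] assms has_sum_unique by fastforce
qed

lemma jtheta_base_square:
  assumes "norm p < 1" "p \<noteq> 0" "u \<noteq> 0"
  shows "jtheta u p * (qpoch_inf (p\<^sup>2) (p\<^sup>2))\<^sup>2 = jtheta u (p\<^sup>2) * jtheta (p * u) (p\<^sup>2) * qpoch_inf p p"
proof -
  have "qpoch_inf (p / u) p = qpoch_inf (p / u) (p\<^sup>2) * qpoch_inf (p\<^sup>2 / u) (p\<^sup>2)"
    using qpoch_inf_2[OF assms(1), of "p / u"] by (simp add: power2_eq_square)
  moreover have "p\<^sup>2 / (p * u) = p / u" using assms by (simp add: power2_eq_square)
  ultimately show ?thesis
    unfolding jtheta_def using qpoch_inf_2[OF assms(1), of u] 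
    by (simp add: mult_ac) (simp add: power2_eq_square)
qed

lemma jtheta_square:
  assumes "norm p < 1"
  shows "jtheta (u\<^sup>2) (p\<^sup>2) * (qpoch_inf p p)\<^sup>2 = jtheta u p * jtheta (- u) p * qpoch_inf (p\<^sup>2) (p\<^sup>2)"
  using qpoch_inf_square[OF assms, of u] qpoch_inf_square[OF assms, of "p / u"]
  unfolding jtheta_def by (simp add: power_divide power2_eq_square mult_ac)

text \<open>\<open>jtheta_square\<close> separates \<open>u\<close> and \<open>- u\<close> over the
  base \<open>p\<close>, then \<open>jtheta_base_square\<close> passes to the base
  \<open>p\<^sup>2\<close>; the surplus constants do not vanish and cancel.\<close>

lemma jtheta_four:
  assumes "norm p < 1" "p \<noteq> 0" "u \<noteq> 0"
  shows "jtheta (u\<^sup>2) (p\<^sup>2) * qpoch_inf (p\<^sup>2) (p\<^sup>2) ^ 3 =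
    jtheta u (p\<^sup>2) * jtheta (p * u) (p\<^sup>2) * jtheta (- u) (p\<^sup>2) * jtheta (- (p * u)) (p\<^sup>2)"
proof -
  let ?P = "qpoch_inf p p" and ?R = "qpoch_inf (p\<^sup>2) (p\<^sup>2)"
  have nz: "?P \<noteq> 0" by (rule qpoch_inf_self_nonzero[OF assms(1)])
  have "norm (p\<^sup>2) < 1" using assms by (simp add: norm_power power_less_one_iff)
  hence nz2: "?R \<noteq> 0" by (rule qpoch_inf_self_nonzero)
  have "(jtheta (u\<^sup>2) (p\<^sup>2) * ?R ^ 3) * (?P\<^sup>2 * ?R) = (jtheta u p * ?R\<^sup>2) * (jtheta (- u) p * ?R\<^sup>2) * ?R"
    using jtheta_square[OF assms(1), of u] by (simp add: eval_nat_numeral mult_ac)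
  also have "\<dots> = (jtheta u (p\<^sup>2) * jtheta (p * u) (p\<^sup>2) * jtheta (- u) (p\<^sup>2) * jtheta (- (p * u)) (p\<^sup>2)) * (?P\<^sup>2 * ?R)"
    using jtheta_base_square[OF assms] jtheta_base_square[OF assms(1,2), of "- u"] assms(3)
    by (simp add: power2_eq_square mult_ac)
  finally show ?thesis using nz nz2 by simp
qed

text \<open>By \<open>jtheta_product\<close> the two products on the left have the same two
  constituents and differ in one sign; by \<open>jtheta_even_odd\<close> these constituents also
  make up \<open>jtheta (v * u) p\<close>. The coefficients match because
  \<open>1 + v = (1 - v) * v\<close>.\<close>

lemma jtheta_addition:
  assumes "norm p < 1" "p \<noteq> 0" "u \<noteq> 0" "v\<^sup>2 = -1"
  shows "jtheta u (p\<^sup>2) * jtheta (- (p * u)) (p\<^sup>2) - v * (jtheta (p * u) (p\<^sup>2) * jtheta (- u) (p\<^sup>2))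
     = (1 - v) * jtheta p (p ^ 4) * jtheta (v * u) p"
proof -
  have p2: "norm (p\<^sup>2) < 1" using assms by (simp add: norm_power power_less_one_iff)
  have vv: "v * v = -1" and v0: "v \<noteq> 0" using assms(4) by (auto simp: power2_eq_square)
  let ?A = "jtheta (p * u\<^sup>2) (p ^ 4)" and ?B = "jtheta (p ^ 3 * u\<^sup>2) (p ^ 4)" and ?J = "jtheta p (p ^ 4)"
  have p4: "(p\<^sup>2)\<^sup>2 = p ^ 4" by simp
  have J: "jtheta (p ^ 3) (p ^ 4) = ?J"
    using jtheta_reflect[of "p ^ 4" p] assms(2) by (simp add: eval_nat_numeral)
  have 1: "jtheta u (p\<^sup>2) * jtheta (- (p * u)) (p\<^sup>2) = ?A * ?J - u * (?B * ?J)"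
    using jtheta_product[OF p2, of u "- (p * u)"] assms J unfolding p4
    by (simp add: eval_nat_numeral mult_ac)
  have 2: "jtheta (- u) (p\<^sup>2) * jtheta (p * u) (p\<^sup>2) = ?A * ?J + u * (?B * ?J)"
    using jtheta_product[OF p2, of "- u" "p * u"] assms J unfolding p4
    by (simp add: eval_nat_numeral mult_ac)
  have 3: "jtheta (v * u) p = ?A - v * u * ?B"
    using jtheta_even_odd[OF assms(1,2), of "v * u"] assms v0 by (simp add: power_mult_distrib)
  have "jtheta u (p\<^sup>2) * jtheta (- (p * u)) (p\<^sup>2) - v * (jtheta (p * u) (p\<^sup>2) * jtheta (- u) (p\<^sup>2))
    = (1 - v) * ?A * ?J - (1 + v) * u * ?B * ?J"
    unfolding 1 using 2 by (simp add: mult.commute[of "jtheta (p * u) (p\<^sup>2)"]) (simp add: algebra_simps)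
  also have "1 + v = (1 - v) * v" using vv by (simp add: algebra_simps)
  finally show ?thesis unfolding 3 by (simp add: algebra_simps)
qed

text \<open>Here \<open>c\<close> is a square root of \<open>p\<close> times a primitive eighth root
  of unity. After the parity split each product at \<open>v\<close> meets its partner at
  \<open>- v\<close>, and \<open>qpoch_inf_square\<close> merges them into one that contains only
  \<open>v\<^sup>2 = -1\<close>. In the odd part the product at \<open>v\<close> has the unpaired
  first factor \<open>1 - v\<close>.\<close>

lemma jtheta_eighth_root:
  assumes "norm p < 1" "p \<noteq> 0" "v\<^sup>2 = -1" "c\<^sup>2 = v * p"
  shows "jtheta c p = jtheta (p ^ 8) (p ^ 16) - c * (1 - v) * jtheta (p ^ 4) (p ^ 16)"
proof -
  have v0: "v \<noteq> 0" using assms(3) by auto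
  have iv: "1 / v = - v" using assms(3) v0 by (simp add: power2_eq_square divide_simps)
  have c0: "c \<noteq> 0" using assms v0 by auto
  have n: "norm (p ^ k) < 1" if "k > 0" for k using assms that by (simp add: norm_power power_less_one_iff)
  have pw: "(p ^ 2)\<^sup>2 = p ^ 4" "(p ^ 4)\<^sup>2 = p ^ 8" "(p ^ 8)\<^sup>2 = p ^ 16" "p * p = p\<^sup>2" 
    "p ^ 4 * p ^ 4 = p ^ 8" "p ^ 8 * p ^ 8 = p ^ 16" "p ^ 4 * p ^ 8 = p ^ 12"
    by (simp_all add: eval_nat_numeral mult_ac)
  let ?P = "\<lambda>k m. qpoch_inf (p ^ k) (p ^ m)"
  have "p * c\<^sup>2 = v * p\<^sup>2" "p ^ 3 * c\<^sup>2 = v * p ^ 4"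
    unfolding assms(4) by (simp_all add: eval_nat_numeral)
  hence "jtheta c p = jtheta (- (v * p\<^sup>2)) (p ^ 4) - c * jtheta (- (v * p ^ 4)) (p ^ 4)"
    using jtheta_even_odd[OF assms(1,2) c0] by simp
  note main = this
  have 44: "?P 4 4 = ?P 4 8 * ?P 8 8"
    using qpoch_inf_2[OF n[of 4, simplified], of "p ^ 4"] by (simp only: pw)
  have A: "jtheta (- (v * p\<^sup>2)) (p ^ 4) = jtheta (p ^ 8) (p ^ 16)"
  proof -
    have "p ^ 4 / (- (v * p\<^sup>2)) = v * p\<^sup>2"
      using assms v0 iv by (simp add: eval_nat_numeral field_simps)
    hence 1: "jtheta (- (v * p\<^sup>2)) (p ^ 4) = (qpoch_inf (v * p\<^sup>2) (p ^ 4) * qpoch_inf (- (v * p\<^sup>2)) (p ^ 4)) * ?P 4 4"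
      unfolding jtheta_def by (simp add: mult_ac)
    have 2: "qpoch_inf (v * p\<^sup>2) (p ^ 4) * qpoch_inf (- (v * p\<^sup>2)) (p ^ 4) = qpoch_inf (- (p ^ 4)) (p ^ 8)"
      using qpoch_inf_square[OF n[of 4, simplified], of "v * p\<^sup>2"] assms pw by (simp add: power_mult_distrib)
    have 3: "?P 8 16 = ?P 4 8 * qpoch_inf (- (p ^ 4)) (p ^ 8)"
      using qpoch_inf_square[OF n[of 8, simplified], of "p ^ 4"] by (simp only: pw)
    have 4: "?P 8 8 = ?P 8 16 * ?P 16 16"
      using qpoch_inf_2[OF n[of 8, simplified], of "p ^ 8"] by (simp only: pw)
    have "p ^ 16 / p ^ 8 = p ^ 8" using assms by (simp add: divide_simps flip: power_add)
    hence 5: "jtheta (p ^ 8) (p ^ 16) = ?P 8 16 * (?P 8 16 * ?P 16 16)" 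
      unfolding jtheta_def by (simp add: mult_ac)
    have "c * (b * d) = a * (a * e)" if "a = b * c" "d = a * e" for a b c d e :: complex
      using that by simp
    from this[OF 3 4] show ?thesis unfolding 1 2 44 5 .
  qed
  have B: "jtheta (- (v * p ^ 4)) (p ^ 4) = (1 - v) * jtheta (p ^ 4) (p ^ 16)"
  proof -
    have "p ^ 4 / (- (v * p ^ 4)) = - (1 / v)"
      using assms v0 by simp
    hence "p ^ 4 / (- (v * p ^ 4)) = v"
      unfolding iv by simp
    hence 1: "jtheta (- (v * p ^ 4)) (p ^ 4) = (qpoch_inf v (p ^ 4) * qpoch_inf (- (v * p ^ 4)) (p ^ 4)) * ?P 4 4"
      unfolding jtheta_def by (simp add: mult_ac)
    have 2: "qpoch_inf v (p ^ 4) = (1 - v) * qpoch_inf (v * p ^ 4) (p ^ 4)"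
      by (rule qpoch_inf_unfold) (use n in auto)
    have 3: "qpoch_inf (- (p ^ 8)) (p ^ 8) = qpoch_inf (v * p ^ 4) (p ^ 4) * qpoch_inf (- (v * p ^ 4)) (p ^ 4)"
      using qpoch_inf_square[OF n[of 4, simplified], of "v * p ^ 4"] assms pw by (simp add: power_mult_distrib)
    have 4: "?P 16 16 = ?P 8 8 * qpoch_inf (- (p ^ 8)) (p ^ 8)"
      using qpoch_inf_square[OF n[of 8, simplified], of "p ^ 8"] by (simp only: pw)
    have 5: "?P 4 8 = ?P 4 16 * ?P 12 16"
      using qpoch_inf_2[OF n[of 8, simplified], of "p ^ 4"] by (simp only: pw)
    have "p ^ 16 / p ^ 4 = p ^ 12" using assms by (simp add: divide_simps flip: power_add)
    hence 6: "jtheta (p ^ 4) (p ^ 16) = (?P 4 16 * ?P 12 16) * ?P 16 16" 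
      unfolding jtheta_def by (simp add: mult_ac)
    have "(r * a) * b * (c * d) = r * (c * (d * e))" if "e = a * b" for r a b c d e :: complex
      using that by simp
    from this[OF 3, of "1 - v"] show ?thesis unfolding 1 2 6 5[symmetric] 44 4 .
  qed
  show ?thesis unfolding main A B by simp
qed


section \<open>The theta quotients \<open>S\<^sub>1\<close> and \<open>S\<^sub>2\<close>\<close>

text \<open>With \<open>\<rho> = q^(2n+4)\<close>, these are \<open>j(y/x;\<rho>^4) S\<^sub>1\<close> and, up to a factor, \<open>j(y/x;\<rho>^4) S\<^sub>2\<close> after
  \<open>x\<close> and \<open>y\<close> have absorbed the factor \<open>q^((n+4)/2)\<close>.\<close>
definition W1 :: "complex \<Rightarrow> complex \<Rightarrow> complex \<Rightarrow> complex" where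
  "W1 \<rho> x y = jtheta (y / x) (\<rho> ^ 4) *
     (jtheta (\<rho>\<^sup>2 * x\<^sup>2 * y\<^sup>2) (\<rho> ^ 4) * jtheta (- (\<rho>\<^sup>2 * y / x)) (\<rho> ^ 4) * jtheta (x * y) (\<rho>\<^sup>2)) /
     (qpoch_inf (\<rho>\<^sup>2) (\<rho>\<^sup>2) ^ 3 * qpoch_inf (\<rho> ^ 8) (\<rho> ^ 8)) *
     (jtheta (- (x\<^sup>2 * y\<^sup>2)) (\<rho> ^ 4) * jtheta (\<rho>\<^sup>2 * y\<^sup>2 / x\<^sup>2) (\<rho> ^ 4) * (qpoch_inf (\<rho> ^ 4) (\<rho> ^ 4))\<^sup>2 +
      x\<^sup>2 * jtheta (- (\<rho>\<^sup>2 * x\<^sup>2 * y\<^sup>2)) (\<rho> ^ 4) * (jtheta (\<rho>\<^sup>2 * y / x) (\<rho> ^ 4))\<^sup>2 *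
        (jtheta (- (y / x)) (\<rho> ^ 4))\<^sup>2 / qpoch_inf (\<rho> ^ 4) (\<rho> ^ 4))"

definition W2 :: "complex \<Rightarrow> complex \<Rightarrow> complex \<Rightarrow> complex" where
  "W2 \<rho> x y = jtheta (y / x) (\<rho> ^ 4) *
     (jtheta (x\<^sup>2 * y\<^sup>2) (\<rho> ^ 4) * jtheta (- (y / x)) (\<rho> ^ 4) * jtheta (\<rho> * x * y) (\<rho>\<^sup>2)) /
     (qpoch_inf (\<rho>\<^sup>2) (\<rho>\<^sup>2))\<^sup>2 *
     (\<rho> * jtheta (- (x\<^sup>2 * y\<^sup>2)) (\<rho> ^ 4) * jtheta (\<rho>\<^sup>2 * y\<^sup>2 / x\<^sup>2) (\<rho> ^ 4) * qpoch_inf (\<rho> ^ 8) (\<rho> ^ 8) /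
        (y * qpoch_inf (\<rho> ^ 4) (\<rho> ^ 4)) +
      x * jtheta (- (\<rho>\<^sup>2 * x\<^sup>2 * y\<^sup>2)) (\<rho> ^ 4) * (jtheta (\<rho> ^ 4 * y\<^sup>2 / x\<^sup>2) (\<rho> ^ 8))\<^sup>2 /
        qpoch_inf (\<rho> ^ 8) (\<rho> ^ 8))"

section \<open>Quasi-periodicity of \<open>W1\<close> and \<open>W2\<close>\<close>

lemma jtheta_shift_1:
  assumes "norm q < 1" "q \<noteq> 0" "x \<noteq> 0" "z = q * x"
  shows "jtheta z q = - jtheta x q / x"
  using jtheta_mult_base assms by simp

lemma jtheta_shift_2:
  assumes "norm q < 1" "q \<noteq> 0" "x \<noteq> 0" "z = q\<^sup>2 * x"
  shows "jtheta z q = jtheta x q / (q * x\<^sup>2)"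
  using jtheta_mult_base[OF assms(1,2), of "q * x"] jtheta_mult_base[OF assms(1-3)] assms
  by (simp add: power2_eq_square mult_ac)

context
  fixes \<rho> x y :: complex
  assumes \<rho>: "norm \<rho> < 1" "\<rho> \<noteq> 0" and xy: "x \<noteq> 0" "y \<noteq> 0"
begin

lemma norm_rho_power: "k > 0 \<Longrightarrow> norm (\<rho> ^ k) < 1"
  using \<rho> by (simp add: norm_power power_less_one_iff)

text \<open>Every theta factor contributes a monomial. The point is that the two summands in the
  braces acquire the same one, so that their sum is quasi-periodic as well.\<close>

lemma W_shift_snd:
  shows "W1 \<rho> x (\<rho> ^ 4 * y) = - W1 \<rho> x y / (x ^ 4 * y ^ 16 * \<rho> ^ 24)"
    and "W2 \<rho> x (\<rho> ^ 4 * y) = - W2 \<rho> x y / (x ^ 4 * y ^ 16 * \<rho> ^ 24)"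
proof -
  note n = norm_rho_power
  have e: 
    "jtheta (\<rho> ^ 4 * y / x) (\<rho> ^ 4) = - jtheta (y / x) (\<rho> ^ 4) / (y / x)"
    "jtheta (- (\<rho> ^ 4 * y / x)) (\<rho> ^ 4) = - jtheta (- (y / x)) (\<rho> ^ 4) / (- (y / x))"
    "jtheta (\<rho>\<^sup>2 * (\<rho> ^ 4 * y) / x) (\<rho> ^ 4) = - jtheta (\<rho>\<^sup>2 * y / x) (\<rho> ^ 4) / (\<rho>\<^sup>2 * y / x)"
    "jtheta (- (\<rho>\<^sup>2 * (\<rho> ^ 4 * y) / x)) (\<rho> ^ 4) = - jtheta (- (\<rho>\<^sup>2 * y / x)) (\<rho> ^ 4) / (- (\<rho>\<^sup>2 * y / x))"
    "jtheta (\<rho> ^ 4 * (\<rho> ^ 4 * y)\<^sup>2 / x\<^sup>2) (\<rho> ^ 8) = - jtheta (\<rho> ^ 4 * y\<^sup>2 / x\<^sup>2) (\<rho> ^ 8) / (\<rho> ^ 4 * y\<^sup>2 / x\<^sup>2)"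
    by (rule jtheta_shift_1, use n in simp, use \<rho> in simp, use \<rho> xy in simp,
        use \<rho> xy in \<open>simp add: eval_nat_numeral mult_ac\<close>)+
  have e2:
    "jtheta (\<rho>\<^sup>2 * x\<^sup>2 * (\<rho> ^ 4 * y)\<^sup>2) (\<rho> ^ 4) = jtheta (\<rho>\<^sup>2 * x\<^sup>2 * y\<^sup>2) (\<rho> ^ 4) / (\<rho> ^ 4 * (\<rho>\<^sup>2 * x\<^sup>2 * y\<^sup>2)\<^sup>2)"
    "jtheta (- (\<rho>\<^sup>2 * x\<^sup>2 * (\<rho> ^ 4 * y)\<^sup>2)) (\<rho> ^ 4) = jtheta (- (\<rho>\<^sup>2 * x\<^sup>2 * y\<^sup>2)) (\<rho> ^ 4) / (\<rho> ^ 4 * (- (\<rho>\<^sup>2 * x\<^sup>2 * y\<^sup>2))\<^sup>2)"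
    "jtheta (x\<^sup>2 * (\<rho> ^ 4 * y)\<^sup>2) (\<rho> ^ 4) = jtheta (x\<^sup>2 * y\<^sup>2) (\<rho> ^ 4) / (\<rho> ^ 4 * (x\<^sup>2 * y\<^sup>2)\<^sup>2)"
    "jtheta (- (x\<^sup>2 * (\<rho> ^ 4 * y)\<^sup>2)) (\<rho> ^ 4) = jtheta (- (x\<^sup>2 * y\<^sup>2)) (\<rho> ^ 4) / (\<rho> ^ 4 * (- (x\<^sup>2 * y\<^sup>2))\<^sup>2)"
    "jtheta (\<rho>\<^sup>2 * (\<rho> ^ 4 * y)\<^sup>2 / x\<^sup>2) (\<rho> ^ 4) = jtheta (\<rho>\<^sup>2 * y\<^sup>2 / x\<^sup>2) (\<rho> ^ 4) / (\<rho> ^ 4 * (\<rho>\<^sup>2 * y\<^sup>2 / x\<^sup>2)\<^sup>2)"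
    "jtheta (x * (\<rho> ^ 4 * y)) (\<rho>\<^sup>2) = jtheta (x * y) (\<rho>\<^sup>2) / (\<rho>\<^sup>2 * (x * y)\<^sup>2)"
    "jtheta (\<rho> * x * (\<rho> ^ 4 * y)) (\<rho>\<^sup>2) = jtheta (\<rho> * x * y) (\<rho>\<^sup>2) / (\<rho>\<^sup>2 * (\<rho> * x * y)\<^sup>2)"
    by (rule jtheta_shift_2, use n in simp, use \<rho> in simp, use \<rho> xy in simp,
        use \<rho> xy in \<open>simp add: eval_nat_numeral mult_ac\<close>)+
  show "W1 \<rho> x (\<rho> ^ 4 * y) = - W1 \<rho> x y / (x ^ 4 * y ^ 16 * \<rho> ^ 24)"
  proof -
    \<comment> \<open>With the theta values as free variables only an identity of rational functions
      remains.\<close>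
    have *: "\<And>a1 a2 a3 a4 a5 a6 a7 a8 a9 P R S. P \<noteq> 0 \<Longrightarrow> R \<noteq> 0 \<Longrightarrow> S \<noteq> 0 \<Longrightarrow>
      (- a1 / (y / x)) * ((a2 / (\<rho> ^ 4 * (\<rho>\<^sup>2 * x\<^sup>2 * y\<^sup>2)\<^sup>2)) * (- a3 / (- (\<rho>\<^sup>2 * y / x))) * (a4 / (\<rho>\<^sup>2 * (x * y)\<^sup>2))) / (P ^ 3 * R) *
       ((a5 / (\<rho> ^ 4 * (- (x\<^sup>2 * y\<^sup>2))\<^sup>2)) * (a6 / (\<rho> ^ 4 * (\<rho>\<^sup>2 * y\<^sup>2 / x\<^sup>2)\<^sup>2)) * S\<^sup>2 +
        x\<^sup>2 * (a7 / (\<rho> ^ 4 * (- (\<rho>\<^sup>2 * x\<^sup>2 * y\<^sup>2))\<^sup>2)) * (- a8 / (\<rho>\<^sup>2 * y / x))\<^sup>2 * (- a9 / (- (y / x)))\<^sup>2 / S) =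
       - (a1 * (a2 * a3 * a4) / (P ^ 3 * R) * (a5 * a6 * S\<^sup>2 + x\<^sup>2 * a7 * a8\<^sup>2 * a9\<^sup>2 / S)) / (x ^ 4 * y ^ 16 * \<rho> ^ 24)"
      using \<rho> xy by (simp add: divide_simps) (simp add: algebra_simps eval_nat_numeral)
    show ?thesis unfolding W1_def e e2
      by (rule *) (rule qpoch_inf_self_nonzero, use n in simp)+
  qed
  show "W2 \<rho> x (\<rho> ^ 4 * y) = - W2 \<rho> x y / (x ^ 4 * y ^ 16 * \<rho> ^ 24)"
  proof -
    have *: "\<And>a1 a2 a3 a4 a5 a6 a7 a8 P R S. P \<noteq> 0 \<Longrightarrow> R \<noteq> 0 \<Longrightarrow> S \<noteq> 0 \<Longrightarrow>
      (- a1 / (y / x)) * ((a2 / (\<rho> ^ 4 * (x\<^sup>2 * y\<^sup>2)\<^sup>2)) * (- a3 / (- (y / x))) * (a4 / (\<rho>\<^sup>2 * (\<rho> * x * y)\<^sup>2))) / P\<^sup>2 *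
       (\<rho> * (a5 / (\<rho> ^ 4 * (- (x\<^sup>2 * y\<^sup>2))\<^sup>2)) * (a6 / (\<rho> ^ 4 * (\<rho>\<^sup>2 * y\<^sup>2 / x\<^sup>2)\<^sup>2)) * R / (\<rho> ^ 4 * y * S) +
        x * (a7 / (\<rho> ^ 4 * (- (\<rho>\<^sup>2 * x\<^sup>2 * y\<^sup>2))\<^sup>2)) * (- a8 / (\<rho> ^ 4 * y\<^sup>2 / x\<^sup>2))\<^sup>2 / R) =
       - (a1 * (a2 * a3 * a4) / P\<^sup>2 * (\<rho> * a5 * a6 * R / (y * S) + x * a7 * a8\<^sup>2 / R)) / (x ^ 4 * y ^ 16 * \<rho> ^ 24)"
      using \<rho> xy by (simp add: divide_simps) (simp add: algebra_simps eval_nat_numeral)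
    show ?thesis unfolding W2_def e e2
      by (rule *) (rule qpoch_inf_self_nonzero, use n in simp)+
  qed
qed

text \<open>This scaling preserves \<open>y / x\<close> and multiplies \<open>y ^ 4\<close> by
  \<open>\<rho> ^ 4\<close>, which will be \<open>Q\<close>. It reduces the condition
  \<open>Y y = Q powi k\<close> to the case \<open>k = 0\<close>.\<close>

lemma W_shift_both:
  shows "W1 \<rho> (\<rho> * x) (\<rho> * y) = W1 \<rho> x y / (\<rho>\<^sup>2 * (x * y) ^ 5)"
    and "W2 \<rho> (\<rho> * x) (\<rho> * y) = W2 \<rho> x y / (\<rho>\<^sup>2 * (x * y) ^ 5)"
proof -
  note n = norm_rho_power
  have r: "\<rho> * y / (\<rho> * x) = y / x" "\<rho>\<^sup>2 * (\<rho> * y) / (\<rho> * x) = \<rho>\<^sup>2 * y / x"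
    "\<rho>\<^sup>2 * (\<rho> * y)\<^sup>2 / (\<rho> * x)\<^sup>2 = \<rho>\<^sup>2 * y\<^sup>2 / x\<^sup>2" "\<rho> ^ 4 * (\<rho> * y)\<^sup>2 / (\<rho> * x)\<^sup>2 = \<rho> ^ 4 * y\<^sup>2 / x\<^sup>2"
    using \<rho> by (simp_all add: eval_nat_numeral)
  have e: 
    "jtheta (\<rho>\<^sup>2 * (\<rho> * x)\<^sup>2 * (\<rho> * y)\<^sup>2) (\<rho> ^ 4) = - jtheta (\<rho>\<^sup>2 * x\<^sup>2 * y\<^sup>2) (\<rho> ^ 4) / (\<rho>\<^sup>2 * x\<^sup>2 * y\<^sup>2)"
    "jtheta (- (\<rho>\<^sup>2 * (\<rho> * x)\<^sup>2 * (\<rho> * y)\<^sup>2)) (\<rho> ^ 4) = - jtheta (- (\<rho>\<^sup>2 * x\<^sup>2 * y\<^sup>2)) (\<rho> ^ 4) / (- (\<rho>\<^sup>2 * x\<^sup>2 * y\<^sup>2))"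
    "jtheta ((\<rho> * x)\<^sup>2 * (\<rho> * y)\<^sup>2) (\<rho> ^ 4) = - jtheta (x\<^sup>2 * y\<^sup>2) (\<rho> ^ 4) / (x\<^sup>2 * y\<^sup>2)"
    "jtheta (- ((\<rho> * x)\<^sup>2 * (\<rho> * y)\<^sup>2)) (\<rho> ^ 4) = - jtheta (- (x\<^sup>2 * y\<^sup>2)) (\<rho> ^ 4) / (- (x\<^sup>2 * y\<^sup>2))"
    "jtheta (\<rho> * x * (\<rho> * y)) (\<rho>\<^sup>2) = - jtheta (x * y) (\<rho>\<^sup>2) / (x * y)"
    "jtheta (\<rho> * (\<rho> * x) * (\<rho> * y)) (\<rho>\<^sup>2) = - jtheta (\<rho> * x * y) (\<rho>\<^sup>2) / (\<rho> * x * y)"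
    by (rule jtheta_shift_1, use n in simp, use \<rho> in simp, use \<rho> xy in simp,
        use \<rho> xy in \<open>simp add: eval_nat_numeral mult_ac\<close>)+
  show "W1 \<rho> (\<rho> * x) (\<rho> * y) = W1 \<rho> x y / (\<rho>\<^sup>2 * (x * y) ^ 5)"
  proof -
    have *: "\<And>a1 a2 a3 a4 a5 a6 a7 a8 a9 P R S. P \<noteq> 0 \<Longrightarrow> R \<noteq> 0 \<Longrightarrow> S \<noteq> 0 \<Longrightarrow>
      a1 * ((- a2 / (\<rho>\<^sup>2 * x\<^sup>2 * y\<^sup>2)) * a3 * (- a4 / (x * y))) / (P ^ 3 * R) *
       ((- a5 / (- (x\<^sup>2 * y\<^sup>2))) * a6 * S\<^sup>2 +
        (\<rho> * x)\<^sup>2 * (- a7 / (- (\<rho>\<^sup>2 * x\<^sup>2 * y\<^sup>2))) * a8\<^sup>2 * a9\<^sup>2 / S) =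
       (a1 * (a2 * a3 * a4) / (P ^ 3 * R) * (a5 * a6 * S\<^sup>2 + x\<^sup>2 * a7 * a8\<^sup>2 * a9\<^sup>2 / S)) / (\<rho>\<^sup>2 * (x * y) ^ 5)"
      using \<rho> xy by (simp add: divide_simps) (simp add: algebra_simps eval_nat_numeral)
    show ?thesis unfolding W1_def e r
      by (rule *) (rule qpoch_inf_self_nonzero, use n in simp)+
  qed
  show "W2 \<rho> (\<rho> * x) (\<rho> * y) = W2 \<rho> x y / (\<rho>\<^sup>2 * (x * y) ^ 5)"
  proof -
    have *: "\<And>a1 a2 a3 a4 a5 a6 a7 a8 P R S. P \<noteq> 0 \<Longrightarrow> R \<noteq> 0 \<Longrightarrow> S \<noteq> 0 \<Longrightarrow>
      a1 * ((- a2 / (x\<^sup>2 * y\<^sup>2)) * a3 * (- a4 / (\<rho> * x * y))) / P\<^sup>2 *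
       (\<rho> * (- a5 / (- (x\<^sup>2 * y\<^sup>2))) * a6 * R / (\<rho> * y * S) +
        \<rho> * x * (- a7 / (- (\<rho>\<^sup>2 * x\<^sup>2 * y\<^sup>2))) * a8\<^sup>2 / R) =
       (a1 * (a2 * a3 * a4) / P\<^sup>2 * (\<rho> * a5 * a6 * R / (y * S) + x * a7 * a8\<^sup>2 / R)) / (\<rho>\<^sup>2 * (x * y) ^ 5)"
      using \<rho> xy by (simp add: divide_simps) (simp add: algebra_simps eval_nat_numeral)
    show ?thesis unfolding W2_def e r
      by (rule *) (rule qpoch_inf_self_nonzero, use n in simp)+
  qed
qed

end

section \<open>Values at primitive eighth roots of unity\<close>

lemma jtheta_quarter_base:
  assumes "norm p < 1" "p \<noteq> 0"
  shows "jtheta p (p ^ 4) * qpoch_inf (p\<^sup>2) (p\<^sup>2) = qpoch_inf p p * qpoch_inf (p ^ 4) (p ^ 4)"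
proof -
  have p2: "norm (p\<^sup>2) < 1" using assms by (simp add: norm_power power_less_one_iff)
  have pw: "(p\<^sup>2)\<^sup>2 = p ^ 4" "p * p\<^sup>2 = p ^ 3" "p * p = p\<^sup>2"
    by (simp_all add: eval_nat_numeral)
  have "p ^ 4 / p = p ^ 3" using assms by (simp add: eval_nat_numeral)
  hence 1: "jtheta p (p ^ 4) = qpoch_inf p (p ^ 4) * qpoch_inf (p ^ 3) (p ^ 4) * qpoch_inf (p ^ 4) (p ^ 4)"
    unfolding jtheta_def by simp
  have 2: "qpoch_inf p (p\<^sup>2) = qpoch_inf p (p ^ 4) * qpoch_inf (p ^ 3) (p ^ 4)"
    using qpoch_inf_2[OF p2, of p] by (simp only: pw)
  have 3: "qpoch_inf p p = qpoch_inf p (p\<^sup>2) * qpoch_inf (p\<^sup>2) (p\<^sup>2)"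
    using qpoch_inf_2[OF assms(1), of p] by (simp only: pw)
  show ?thesis unfolding 1 3 2 by (simp add: mult_ac)
qed

text \<open>In terms of \<open>u = y / x\<close> and the fourth root of unity
  \<open>v = y\<^sup>2\<close>, every theta argument is a power of \<open>u\<close> up to a
  constant. The two summands in the braces then combine into one product of theta functions, and
  \<open>jtheta_four\<close> assembles all factors to \<open>jtheta (u ^ 4)\<close>, which is
  \<open>jtheta (- (x ^ 4))\<close> up to inversion.\<close>

lemma W_at_eighth_root:
  assumes \<rho>: "norm \<rho> < 1" "\<rho> \<noteq> 0" and x: "x \<noteq> 0" and y: "y ^ 4 = -1"
  shows "W1 \<rho> x y = - (1 + y\<^sup>2) * (y / x) * qpoch_inf (\<rho> ^ 4) (\<rho> ^ 4) ^ 3 * jtheta (- (x ^ 4)) (\<rho> ^ 4)"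
    and "W2 \<rho> x y = - y * (y / x) * qpoch_inf (\<rho> ^ 4) (\<rho> ^ 4) ^ 3 * jtheta (- (x ^ 4)) (\<rho> ^ 4)"
proof -
  have y0: "y \<noteq> 0" using y by auto
  define u v where "u = y / x" and "v = y\<^sup>2"
  define p where "p = \<rho>\<^sup>2"
  have u0: "u \<noteq> 0" and xu: "x = y / u" using x y0 by (auto simp: u_def)
  have vv: "v\<^sup>2 = -1" using y by (simp add: v_def flip: power_mult)
  have v0: "v \<noteq> 0" using vv by auto
  have iv: "1 / v = - v" using vv v0 by (simp add: power2_eq_square divide_simps)
  have p: "norm p < 1" "p \<noteq> 0" using \<rho> by (auto simp: p_def norm_power power_less_one_iff)
  have p2: "norm (p\<^sup>2) < 1" "p\<^sup>2 \<noteq> 0" using p by (auto simp: norm_power power_less_one_iff)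
  have pw: "\<rho>\<^sup>2 = p" "\<rho> ^ 4 = p\<^sup>2" "\<rho> ^ 8 = p ^ 4" by (simp_all add: p_def flip: power_mult)
  let ?J2 = "qpoch_inf p p" and ?J4 = "qpoch_inf (p\<^sup>2) (p\<^sup>2)" and ?J8 = "qpoch_inf (p ^ 4) (p ^ 4)"
  have nz: "?J2 \<noteq> 0" "?J4 \<noteq> 0" "?J8 \<noteq> 0"
    by (rule qpoch_inf_self_nonzero, use p in \<open>simp add: norm_power power_less_one_iff\<close>)+
  let ?Q = "p\<^sup>2"
  have uy: "y / x = u" by (simp add: u_def)
  have a1: "x\<^sup>2 * y\<^sup>2 = - (1 / u\<^sup>2)" 
    using y y0 u0 unfolding xu by (simp add: field_simps eval_nat_numeral)
  have a2: "x * y = v / u" using u0 unfolding xu v_def by (simp add: power2_eq_square)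
  have x2: "x\<^sup>2 = v / u\<^sup>2" using u0 unfolding xu v_def by (simp add: power_divide)
  have x4: "- (x ^ 4) = 1 / u ^ 4" unfolding xu by (simp add: power_divide y)
  have X: "jtheta (- (x ^ 4)) ?Q = - jtheta (u ^ 4) ?Q / u ^ 4"
    unfolding x4 by (rule jtheta_inverse) (use p2 u0 in auto)
  have R: "jtheta (p * (1 / u\<^sup>2)) ?Q = jtheta (p * u\<^sup>2) ?Q" "jtheta (- (p * (1 / u\<^sup>2))) ?Q = jtheta (- (p * u\<^sup>2)) ?Q"
    using jtheta_reflect[OF p2(2), of "p * u\<^sup>2"] jtheta_reflect[OF p2(2), of "- (p * u\<^sup>2)"] p u0
    by (simp_all add: power2_eq_square)
  have I: "jtheta (1 / u\<^sup>2) ?Q = - jtheta (u\<^sup>2) ?Q / u\<^sup>2" "jtheta (- (1 / u\<^sup>2)) ?Q = jtheta (- (u\<^sup>2)) ?Q / u\<^sup>2"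
    using jtheta_inverse[OF p2, of "u\<^sup>2"] jtheta_inverse[OF p2, of "- (u\<^sup>2)"] u0 by simp_all
  have four: "jtheta (u\<^sup>2) ?Q * ?J4 ^ 3 = jtheta u ?Q * jtheta (p * u) ?Q * jtheta (- u) ?Q * jtheta (- (p * u)) ?Q"
    by (rule jtheta_four[OF p u0])
  have four': "jtheta (u ^ 4) ?Q * ?J4 ^ 3 = jtheta (u\<^sup>2) ?Q * jtheta (p * u\<^sup>2) ?Q * jtheta (- (u\<^sup>2)) ?Q * jtheta (- (p * u\<^sup>2)) ?Q"
    using jtheta_four[OF p, of "u\<^sup>2"] u0 by simp
  show "W1 \<rho> x y = - (1 + y\<^sup>2) * (y / x) * qpoch_inf (\<rho> ^ 4) (\<rho> ^ 4) ^ 3 * jtheta (- (x ^ 4)) (\<rho> ^ 4)"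
  proof -
    have vu: "jtheta (v / u) p = - v * jtheta (- (v * u)) p / u"
    proof -
      have "v / u = 1 / (- (v * u))" using iv v0 u0 vv by (simp add: field_simps power2_eq_square)
      hence "jtheta (v / u) p = - jtheta (- (v * u)) p / (- (v * u))"
        using jtheta_inverse[OF p, of "- (v * u)"] v0 u0 by simp
      also have "\<dots> = (1 / v) * (jtheta (- (v * u)) p / u)" by simp
      also have "\<dots> = - v * jtheta (- (v * u)) p / u" unfolding iv by simp
      finally show ?thesis .
    qed
    have add: "jtheta u ?Q * jtheta (- (p * u)) ?Q - v * (jtheta (p * u) ?Q * jtheta (- u) ?Q)
       = (1 - v) * (?J2 * ?J8 / ?J4) * jtheta (v * u) p"
    proof -
      have "jtheta p (p ^ 4) = ?J2 * ?J8 / ?J4"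
        using jtheta_quarter_base[OF p] nz by (simp add: field_simps)
      thus ?thesis using jtheta_addition[OF p u0 vv] by simp
    qed
    have sq: "jtheta (- (u\<^sup>2)) ?Q * ?J2\<^sup>2 = jtheta (v * u) p * jtheta (- (v * u)) p * ?J4"
      using jtheta_square[OF p(1), of "v * u"] vv by (simp add: power_mult_distrib)
    \<comment> \<open>\<open>t1\<close>, \<open>t2\<close>, \<open>t4\<close>, \<open>t3\<close> are
      the theta values at \<open>u\<close>, \<open>p * u\<close>, \<open>- u\<close>,
      \<open>- (p * u)\<close>. The first relation makes the bracket divisible by
      \<open>t2 * t4\<close>, with cofactor the left side of \<open>add\<close>; the second one
      assembles the result.\<close>
    have alg: "t1 * (m1 * t3 * (- v * g2 / u)) / (J2 ^ 3 * J8) *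
        (- U2 / u\<^sup>2 * m2 * J4\<^sup>2 + v / u\<^sup>2 * m2 * t2\<^sup>2 * t4\<^sup>2 / J4) = - (1 + v) * u * J4 ^ 3 * (- U4 / u ^ 4)"
      if 1: "U2 * J4 ^ 3 = t1 * t2 * t4 * t3" and 2: "U4 * J4 ^ 3 = U2 * m2 * mU2 * m1"
        and 3: "t1 * t3 - v * (t2 * t4) = (1 - v) * (J2 * J8 / J4) * g1" and 4: "mU2 * J2\<^sup>2 = g1 * g2 * J4"
        and "J2 \<noteq> 0" "J4 \<noteq> 0" "J8 \<noteq> 0"
      for t1 t2 t3 t4 m1 m2 U2 U4 mU2 g1 g2 J2 J4 J8 :: complex
    proof -
      have "- U2 / u\<^sup>2 * m2 * J4\<^sup>2 + v / u\<^sup>2 * m2 * t2\<^sup>2 * t4\<^sup>2 / J4 = 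
         - m2 / (u\<^sup>2 * J4) * (U2 * J4 ^ 3 - v * t2\<^sup>2 * t4\<^sup>2)"
        using that u0 by (simp add: field_simps eval_nat_numeral)
      also have "U2 * J4 ^ 3 - v * t2\<^sup>2 * t4\<^sup>2 = t2 * t4 * (t1 * t3 - v * (t2 * t4))"
        unfolding 1 by (simp add: algebra_simps power2_eq_square)
      finally have e: "- U2 / u\<^sup>2 * m2 * J4\<^sup>2 + v / u\<^sup>2 * m2 * t2\<^sup>2 * t4\<^sup>2 / J4 = 
         - m2 / (u\<^sup>2 * J4) * (t2 * t4 * ((1 - v) * (J2 * J8 / J4) * g1))" unfolding 3 .
      have "t1 * (m1 * t3 * (- v * g2 / u)) / (J2 ^ 3 * J8) * (- m2 / (u\<^sup>2 * J4) * (t2 * t4 * ((1 - v) * (J2 * J8 / J4) * g1)))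
        = v * (1 - v) * (t1 * t2 * t4 * t3) * m1 * m2 * (g1 * g2 * J4) / (u ^ 3 * J2\<^sup>2 * J4 ^ 3)"
        using that(5-7) u0 by (simp add: divide_simps) (simp add: algebra_simps eval_nat_numeral)
      also have "\<dots> = v * (1 - v) * (U2 * m2 * mU2 * m1) / u ^ 3"
        unfolding 1[symmetric] 4[symmetric] using that(5-7) u0 by (simp add: field_simps)
      also have "\<dots> = v * (1 - v) * (U4 * J4 ^ 3) / u ^ 3" unfolding 2 ..
      also have "\<dots> = (1 + v) * (U4 * J4 ^ 3) / u ^ 3"
        using vv by (simp add: algebra_simps power2_eq_square)
      also have "\<dots> = - (1 + v) * u * J4 ^ 3 * (- U4 / u ^ 4)"
        using u0 by (simp add: field_simps eval_nat_numeral)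
      finally show ?thesis unfolding e .
    qed
    have r: "p * y / x = p * u" "p * x\<^sup>2 * y\<^sup>2 = - (p * (1 / u\<^sup>2))" "p * y\<^sup>2 / x\<^sup>2 = p * u\<^sup>2"
      using a1 by (auto simp: u_def power_divide mult.assoc)
    show ?thesis
      unfolding W1_def pw X unfolding uy r unfolding a1 a2 minus_minus unfolding v_def[symmetric] x2 R I vu
      by (rule alg[OF four four' add sq nz])
  qed
  show "W2 \<rho> x y = - y * (y / x) * qpoch_inf (\<rho> ^ 4) (\<rho> ^ 4) ^ 3 * jtheta (- (x ^ 4)) (\<rho> ^ 4)"
  proof -
    let ?g = "jtheta (\<rho> * (v * u)) p" and ?g' = "jtheta (- (\<rho> * (v * u))) p"
    have vu: "jtheta (\<rho> * (v / u)) p = ?g'"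
    proof -
      have "p / (- (\<rho> * (v * u))) = \<rho> * (v / u)" using \<rho> u0 v0 vv by (simp add: p_def field_simps power2_eq_square)
      thus ?thesis using jtheta_reflect[OF p(2), of "- (\<rho> * (v * u))"] by simp
    qed
    have sq: "jtheta (- (p * u\<^sup>2)) ?Q * ?J2\<^sup>2 = ?g * ?g' * ?J4"
      using jtheta_square[OF p(1), of "\<rho> * (v * u)"] vv by (simp add: power_mult_distrib p_def)
    \<comment> \<open>The sum that will appear in the bracket is a parity splitting read backwards;
      the odd part only has to be moved by one base.\<close>
    have add: "jtheta (p\<^sup>2 * u\<^sup>2) (p ^ 4) + \<rho> * v / u * jtheta (u\<^sup>2) (p ^ 4) = ?g"
    proof -
      have p4: "norm (p ^ 4) < 1" "p ^ 4 \<noteq> 0" using p by (auto simp: norm_power power_less_one_iff)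
      have "p * (\<rho> * (v * u))\<^sup>2 = - (p\<^sup>2 * u\<^sup>2)" "p ^ 3 * (\<rho> * (v * u))\<^sup>2 = - (p ^ 4 * u\<^sup>2)"
        using vv by (simp_all add: power_mult_distrib pw(1)) (simp_all add: eval_nat_numeral)
      hence "?g = jtheta (p\<^sup>2 * u\<^sup>2) (p ^ 4) - \<rho> * (v * u) * jtheta (p ^ 4 * u\<^sup>2) (p ^ 4)"
        using jtheta_even_odd[OF p, of "\<rho> * (v * u)"] \<rho> v0 u0 by simp
      also have "jtheta (p ^ 4 * u\<^sup>2) (p ^ 4) = - jtheta (u\<^sup>2) (p ^ 4) / u\<^sup>2"
        by (rule jtheta_mult_base) (use p4 u0 in auto)
      finally show ?thesis using u0 by (simp add: power2_eq_square)
    qed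
    have s1: "jtheta (u\<^sup>2) (p ^ 4) * ?J4\<^sup>2 = jtheta u ?Q * jtheta (- u) ?Q * ?J8"
      using jtheta_square[OF p2(1), of u] by (simp flip: power_mult)
    have s2: "jtheta (u\<^sup>2) ?Q * ?J8\<^sup>2 = jtheta (u\<^sup>2) (p ^ 4) * jtheta (p\<^sup>2 * u\<^sup>2) (p ^ 4) * ?J4"
      using jtheta_base_square[OF p2, of "u\<^sup>2"] u0 by (simp flip: power_mult)
    \<comment> \<open>Eliminating \<open>U2\<close> by the fifth relation exposes \<open>b\<close>
      as a common factor of the bracket; the cofactor is the left side of \<open>add\<close>. The
      sign of the first term comes from \<open>1 / y = - v * y\<close>.\<close>
    have alg: "t1 * (mU2 / u\<^sup>2 * t4 * g') / J2\<^sup>2 * (\<rho> * (- U2 / u\<^sup>2) * m2 * J8 / (y * J4) + x * m2 * b\<^sup>2 / J8)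
        = - y * u * J4 ^ 3 * (- U4 / u ^ 4)"
      if 1: "U4 * J4 ^ 3 = U2 * m2 * mU2 * m1" and 2: "m1 * J2\<^sup>2 = g * g' * J4"
        and 3: "b + \<rho> * v / u * a = g" and 4: "a * J4\<^sup>2 = t1 * t4 * J8" and 5: "U2 * J8\<^sup>2 = a * b * J4"
        and "J2 \<noteq> 0" "J4 \<noteq> 0" "J8 \<noteq> 0"
      for t1 t4 m1 m2 U2 U4 mU2 g g' a b J2 J4 J8 :: complex
    proof -
      have U2: "U2 = a * b * J4 / J8\<^sup>2" using 5 that by (simp add: field_simps)
      have iy: "1 / y = - v * y" using y y0 by (simp add: v_def field_simps eval_nat_numeral)
      have e0: "\<rho> * (- U2 / u\<^sup>2) * m2 * J8 / (y * J4) = \<rho> * v * y * a * b * m2 / (u\<^sup>2 * J8)"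
      proof -
        have "\<rho> * (- U2 / u\<^sup>2) * m2 * J8 / (y * J4) = (1 / y) * (\<rho> * (- U2 / u\<^sup>2) * m2 * J8 / J4)"
          by simp
        thus ?thesis unfolding iy U2 using that u0 by (simp add: field_simps power2_eq_square)
      qed
      have e: "\<rho> * (- U2 / u\<^sup>2) * m2 * J8 / (y * J4) + x * m2 * b\<^sup>2 / J8 = y * m2 * b / (u * J8) * (b + \<rho> * v / u * a)"
        unfolding e0 xu using u0 that(6-8) by (simp add: field_simps power2_eq_square)
      have "t1 * (mU2 / u\<^sup>2 * t4 * g') / J2\<^sup>2 * (y * m2 * b / (u * J8) * g)
         = y * mU2 * m2 * (t1 * t4 * J8) * (g * g' * J4) * b / (J2\<^sup>2 * J8\<^sup>2 * J4 * u ^ 3)"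
        using that(6-8) u0 by (simp add: field_simps eval_nat_numeral)
      also have "\<dots> = y * mU2 * m2 * (a * J4\<^sup>2) * (m1 * J2\<^sup>2) * b / (J2\<^sup>2 * J8\<^sup>2 * J4 * u ^ 3)"
        unfolding 2 4 ..
      also have "\<dots> = y * (U2 * m2 * mU2 * m1) / u ^ 3"
        unfolding U2 using that(6-8) u0 by (simp add: field_simps eval_nat_numeral)
      also have "\<dots> = - y * u * J4 ^ 3 * (- U4 / u ^ 4)"
        unfolding 1[symmetric] using u0 by (simp add: field_simps eval_nat_numeral)
      finally show ?thesis unfolding e 3 .
    qed
    have r: "p * x\<^sup>2 * y\<^sup>2 = - (p * (1 / u\<^sup>2))" "p * y\<^sup>2 / x\<^sup>2 = p * u\<^sup>2" "p\<^sup>2 * y\<^sup>2 / x\<^sup>2 = p\<^sup>2 * u\<^sup>2"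
      "\<rho> * x * y = \<rho> * (v / u)"
      using a1 a2 by (auto simp: u_def power_divide mult.assoc)
    show ?thesis
      unfolding W2_def pw X unfolding uy r unfolding a1 minus_minus unfolding R I vu
      by (rule alg[OF four' sq add s1 s2 nz])
  qed
qed


section \<open>Multiplicatively quasi-periodic functions\<close>

text \<open>Each Taylor coefficient \<open>c\<close> at 0 satisfies
  \<open>Q ^ k * c = \<mu> * c\<close> and therefore vanishes.\<close>

lemma entire_quasi_periodic_eq_0:
  fixes G :: "complex \<Rightarrow> complex"
  assumes hol: "G holomorphic_on UNIV" and eq: "\<And>y. G (Q * y) = \<mu> * G y"
    and ne: "\<And>k::nat. \<mu> \<noteq> Q ^ k"
  shows "G y = 0"
proof (rule holomorphic_fun_eq_0_on_connected[OF hol])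
  fix k
  have "(deriv ^^ k) (\<lambda>w. G (Q * w)) 0 = Q ^ k * (deriv ^^ k) G (Q * 0)"
    by (rule higher_deriv_compose_linear[OF hol, where S = UNIV]) auto
  moreover have "(deriv ^^ k) (\<lambda>w. \<mu> * G w) 0 = \<mu> * (deriv ^^ k) G 0"
    by (rule higher_deriv_cmult[OF hol]) auto
  moreover have "(\<lambda>w. G (Q * w)) = (\<lambda>w. \<mu> * G w)"
    using eq by auto
  ultimately have "Q ^ k * (deriv ^^ k) G 0 = \<mu> * (deriv ^^ k) G 0"
    by auto
  thus "(deriv ^^ k) G 0 = 0" using ne[of k] by simp
qed auto

text \<open>The annulus between \<open>norm Q\<close> and 1 contains a fundamental domain of
  multiplication by \<open>Q\<close>; it reduces estimates near 0 to a compact set.\<close>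

lemma exists_power_annulus:
  fixes Q y :: complex
  assumes "norm Q < 1" "Q \<noteq> 0" "y \<noteq> 0" "norm y \<le> 1"
  obtains k :: nat and z where "y = Q ^ k * z" "norm Q \<le> norm z" "norm z \<le> 1"
proof -
  have "(\<lambda>k. norm Q ^ k) \<longlonglongrightarrow> 0" using assms by (intro LIMSEQ_power_zero) auto
  hence "eventually (\<lambda>k. norm Q ^ k < norm y) sequentially"
    by (rule order_tendstoD(2)) (use assms in auto)
  then obtain k0 where k0: "norm Q ^ k0 < norm y" by (auto simp: eventually_sequentially)
  define k where "k = (LEAST k. norm Q ^ k < norm y)"
  have k: "norm Q ^ k < norm y" unfolding k_def by (rule LeastI[of _ k0]) (rule k0)
  have "k \<noteq> 0" using k assms by (cases k) auto
  then obtain j where j: "k = Suc j" by (cases k) auto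
  have "\<not> norm Q ^ j < norm y"
    using not_less_Least[of j "\<lambda>k. norm Q ^ k < norm y"] j unfolding k_def by auto
  hence j': "norm y \<le> norm Q ^ j" by simp
  show ?thesis
  proof (rule that[of j "y / Q ^ j"])
    show "y = Q ^ j * (y / Q ^ j)" using assms by simp
    show "norm Q \<le> norm (y / Q ^ j)" "norm (y / Q ^ j) \<le> 1"
      using k j' assms by (auto simp: j norm_divide norm_power field_simps)
  qed
qed

text \<open>Multiplication by a high power \<open>y ^ m\<close> brings the multiplier below 1 in
  norm. The values near 0 are then bounded by those on the compact annulus, the singularity at 0 is
  removable, and the Taylor argument applies.\<close>

lemma punctured_quasi_periodic_eq_0:
  fixes G :: "complex \<Rightarrow> complex"
  assumes Q: "norm Q < 1" "Q \<noteq> 0" and hol: "G holomorphic_on - {0}"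
    and eq: "\<And>y. y \<noteq> 0 \<Longrightarrow> G (Q * y) = C * G y"
    and ne: "\<And>k::int. C \<noteq> Q powi k" and y: "y \<noteq> 0"
  shows "G y = 0"
proof -
  have "(\<lambda>m. norm Q ^ m * norm C) \<longlonglongrightarrow> 0 * norm C"
    using Q by (intro tendsto_intros LIMSEQ_power_zero) auto
  hence "eventually (\<lambda>m. norm Q ^ m * norm C < 1) sequentially"
    by (intro order_tendstoD(2)[of _ "0 * norm C"]) auto
  then obtain m where m: "norm Q ^ m * norm C < 1" by (auto simp: eventually_sequentially)
  define \<mu> where "\<mu> = Q ^ m * C"
  define H where "H = (\<lambda>y. y ^ m * G y)"
  have Heq: "H (Q * y) = \<mu> * H y" if "y \<noteq> 0" for y
    using eq[OF that] by (simp add: H_def \<mu>_def power_mult_distrib)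
  have Heqk: "H (Q ^ k * y) = \<mu> ^ k * H y" if "y \<noteq> 0" for y k
  proof (induction k)
    case (Suc k)
    thus ?case using Heq[of "Q ^ k * y"] that Q by (simp add: mult.assoc)
  qed simp
  have Hhol: "H holomorphic_on - {0}" unfolding H_def by (intro holomorphic_intros hol)
  have "compact (H ` {z. norm Q \<le> norm z \<and> norm z \<le> 1})"
  proof (rule compact_continuous_image)
    show "continuous_on {z. norm Q \<le> norm z \<and> norm z \<le> 1} H"
      by (rule holomorphic_on_imp_continuous_on[OF holomorphic_on_subset[OF Hhol]]) (use Q in auto)
    have "{z::complex. norm Q \<le> norm z \<and> norm z \<le> 1} = cball 0 1 - ball 0 (norm Q)" by (auto simp: dist_norm)
    thus "compact {z::complex. norm Q \<le> norm z \<and> norm z \<le> 1}"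
      by (simp add: compact_diff)
  qed
  hence "bounded (H ` {z. norm Q \<le> norm z \<and> norm z \<le> 1})" by (rule compact_imp_bounded)
  then obtain B where "\<forall>v\<in>H ` {z. norm Q \<le> norm z \<and> norm z \<le> 1}. norm v \<le> B"
    unfolding bounded_iff by auto
  hence B: "norm (H z) \<le> B" if "norm Q \<le> norm z" "norm z \<le> 1" for z
    using that by simp
  have bound: "norm (H y) \<le> B" if y: "y \<noteq> 0" "norm y \<le> 1" for y
  proof -
    obtain k z where kz: "y = Q ^ k * z" "norm Q \<le> norm z" "norm z \<le> 1"
      using exists_power_annulus[OF Q y] by blast
    have z0: "z \<noteq> 0" using kz y by auto
    have "norm (H y) = norm \<mu> ^ k * norm (H z)"
      unfolding kz(1) Heqk[OF z0] by (simp add: norm_mult norm_power)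
    also have "\<dots> \<le> 1 * B"
      using m B[OF kz(2,3)] by (intro mult_mono power_le_one) (auto simp: \<mu>_def norm_mult norm_power)
    finally show ?thesis by simp
  qed
  have "\<exists>g. g holomorphic_on UNIV \<and> (\<forall>z\<in>UNIV - {0}. g z = H z)"
  proof (subst holomorphic_on_extend_bounded)
    show "H holomorphic_on UNIV - {0}" using Hhol by (simp add: Compl_eq_Diff_UNIV)
    have "eventually (\<lambda>z::complex. z \<in> ball 0 1 - {0}) (at 0)"
      by (rule eventually_at_in_open) auto
    hence "eventually (\<lambda>z. norm (H z) \<le> B) (at 0)"
      by eventually_elim (use bound in auto)
    thus "\<exists>B. eventually (\<lambda>z. norm (H z) \<le> B) (at 0)" by blast
  qed auto
  then obtain g where g: "g holomorphic_on UNIV" "\<And>z. z \<noteq> 0 \<Longrightarrow> g z = H z" by auto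
  have cont: "isCont g z" for z
    using holomorphic_on_imp_continuous_on[OF g(1)] by (simp add: continuous_on_eq_continuous_at)
  have geq: "g (Q * y) = \<mu> * g y" for y
  proof (cases "y = 0")
    case False
    thus ?thesis using Heq g(2) Q by simp
  next
    case True
    have "((\<lambda>z. g (Q * z) - \<mu> * g z) \<longlongrightarrow> g (Q * 0) - \<mu> * g 0) (at 0)"
      by (intro tendsto_intros isCont_tendsto_compose[OF cont] isContD[OF cont])
    moreover have "eventually (\<lambda>z. g (Q * z) - \<mu> * g z = 0) (at 0)"
      using eventually_neq_at_within[of 0] by eventually_elim (use Heq g(2) Q in auto)
    hence "((\<lambda>z. g (Q * z) - \<mu> * g z) \<longlongrightarrow> 0) (at 0)"
      by (rule tendsto_eventually)
    ultimately have "g (Q * 0) - \<mu> * g 0 = 0"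
      by (rule tendsto_unique[rotated]) auto
    thus ?thesis using True by simp
  qed
  have "g y = 0"
  proof (rule entire_quasi_periodic_eq_0[OF g(1) geq])
    fix k :: nat
    show "\<mu> \<noteq> Q ^ k"
      using ne[of "int k - int m"] Q by (auto simp: \<mu>_def power_int_diff field_simps)
  qed
  thus ?thesis using g(2)[OF y] y by (simp add: H_def)
qed

text \<open>\<open>E\<close> may have accidental values at isolated points, such as zeros of a
  denominator. So the assumptions speak of punctured neighbourhoods, and
  \<open>remove_sings E\<close> inherits the functional equation through limits.\<close>

lemma removable_quasi_periodic_eq_0:
  fixes E :: "complex \<Rightarrow> complex"
  assumes Q: "norm Q < 1" "Q \<noteq> 0"
    and ana: "\<And>y. y \<noteq> 0 \<Longrightarrow> \<exists>g. g analytic_on {y} \<and> eventually (\<lambda>w. E w = g w) (at y)"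
    and eq: "\<And>y. y \<noteq> 0 \<Longrightarrow> eventually (\<lambda>w. E (Q * w) = C * E w) (at y)"
    and ne: "\<And>k::int. C \<noteq> Q powi k" and y: "y \<noteq> 0" "isCont E y"
  shows "E y = 0"
proof -
  let ?G = "remove_sings E"
  have lim: "\<exists>c. E \<midarrow>z\<rightarrow> c" and iso: "isolated_singularity_at E z" if z: "z \<noteq> 0" for z
  proof -
    obtain g where g: "g analytic_on {z}" "eventually (\<lambda>w. E w = g w) (at z)"
      using ana[OF z] by blast
    have "g \<midarrow>z\<rightarrow> g z" using g(1) by (simp add: analytic_at_imp_isCont isContD)
    thus "\<exists>c. E \<midarrow>z\<rightarrow> c" using filterlim_cong[OF refl refl g(2)] by blast
    have "isolated_singularity_at g z" by (rule isolated_singularity_at_analytic[OF g(1)])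
    thus "isolated_singularity_at E z" using isolated_singularity_at_cong[OF g(2) refl] by blast
  qed
  have G: "E \<midarrow>z\<rightarrow> ?G z" if "z \<noteq> 0" for z
    using lim[OF that] remove_sings_eqI by metis
  have hol: "?G holomorphic_on - {0}"
  proof (rule analytic_imp_holomorphic, rule analytic_on_analytic_at[THEN iffD2], rule ballI)
    fix z :: complex assume "z \<in> - {0}"
    hence "z \<noteq> 0" by simp
    thus "?G analytic_on {z}" using remove_sings_analytic_at iso lim by blast
  qed
  have Geq: "?G (Q * z) = C * ?G z" if z: "z \<noteq> 0" for z
  proof -
    have "filterlim (\<lambda>w. Q * w) (at (Q * z)) (at z)"
    proof (rule filterlim_atI)
      show "((\<lambda>w. Q * w) \<longlongrightarrow> Q * z) (at z)" by (intro tendsto_intros)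
      show "eventually (\<lambda>w. Q * w \<noteq> Q * z) (at z)"
        using eventually_neq_at_within[of z] by eventually_elim (use Q in auto)
    qed
    moreover have "E \<midarrow>Q * z\<rightarrow> ?G (Q * z)"
      by (rule G) (use Q z in auto)
    ultimately have "((\<lambda>w. E (Q * w)) \<longlongrightarrow> ?G (Q * z)) (at z)"
      by (rule filterlim_compose[rotated])
    moreover have "((\<lambda>w. E (Q * w)) \<longlongrightarrow> C * ?G z) (at z)"
      using tendsto_mult[OF tendsto_const[of C] G[OF z]] filterlim_cong[OF refl refl eq[OF z]] by blast
    ultimately show ?thesis by (intro tendsto_unique) auto
  qed
  have "?G y = 0" by (rule punctured_quasi_periodic_eq_0[OF Q hol Geq ne y(1)])
  moreover have "?G y = E y" using y(2) by (intro remove_sings_eqI) (simp add: isContD)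
  ultimately show ?thesis by simp
qed

section \<open>Holomorphy of infinite sums\<close>

lemma analytic_at_infsum:
  fixes f :: "'i \<Rightarrow> complex \<Rightarrow> complex"
  assumes M: "M summable_on I"
    and bd: "eventually (\<lambda>w. \<forall>i\<in>I. norm (f i w) \<le> M i) (nhds z)"
    and df: "eventually (\<lambda>w. \<forall>i\<in>I. f i field_differentiable (at w)) (nhds z)"
  shows "(\<lambda>w. infsum (\<lambda>i. f i w) I) analytic_on {z}"
proof -
  obtain d where d: "d > 0" "\<And>w i. dist w z < d \<Longrightarrow> i \<in> I \<Longrightarrow> norm (f i w) \<le> M i \<and> f i field_differentiable (at w)"
    using eventually_conj[OF bd df] unfolding eventually_nhds_metric by blast
  define r where "r = d / 2"
  have r: "r > 0" and r': "\<And>w. w \<in> cball z r \<Longrightarrow> dist w z < d" using d by (auto simp: r_def dist_commute)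
  have ul: "uniform_limit (cball z r) (\<lambda>X y. \<Sum>x\<in>X. f x y) (\<lambda>y. \<Sum>\<^sub>\<infinity>x\<in>I. f x y) (finite_subsets_at_top I)"
    by (rule Weierstrass_m_test_general[OF _ M]) (use d r' in blast)
  have ev: "eventually (\<lambda>X. continuous_on (cball z r) (\<lambda>y. \<Sum>x\<in>X. f x y) \<and>
     (\<lambda>y. \<Sum>x\<in>X. f x y) holomorphic_on ball z r) (finite_subsets_at_top I)"
  proof (rule eventually_finite_subsets_at_top_weakI)
    fix X assume X: "finite X" "X \<subseteq> I"
    have "(\<lambda>y. \<Sum>x\<in>X. f x y) holomorphic_on cball z r"
    proof (rule holomorphic_on_sum)
      fix i assume "i \<in> X"
      thus "f i holomorphic_on cball z r" 
        unfolding holomorphic_on_def using d(2)[of _ i] r' X field_differentiable_at_within by blast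
    qed
    thus "continuous_on (cball z r) (\<lambda>y. \<Sum>x\<in>X. f x y) \<and> (\<lambda>y. \<Sum>x\<in>X. f x y) holomorphic_on ball z r"
      by (meson ball_subset_cball holomorphic_on_imp_continuous_on holomorphic_on_subset)
  qed
  have "(\<lambda>y. \<Sum>\<^sub>\<infinity>x\<in>I. f x y) holomorphic_on ball z r"
    by (rule holomorphic_uniform_limit[OF ev ul]) auto
  thus ?thesis
    unfolding analytic_at using r by (intro exI[of _ "ball z r"]) auto
qed

lemma field_differentiable_powi:
  fixes g :: "complex \<Rightarrow> complex"
  assumes "g field_differentiable at w" "g w \<noteq> 0"
  shows "(\<lambda>w. g w powi k) field_differentiable at w"
  using assms unfolding field_differentiable_def by (auto intro!: derivative_eq_intros)

text \<open>One majorant for both signs of \<open>k\<close>: the value at \<open>b\<close> bounds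
  the nonnegative powers and the value at \<open>a\<close> the negative ones. Against the Gaussian
  factor of a theta term both parts remain summable.\<close>

lemma powi_le_bounds:
  fixes a b t :: real
  assumes "0 < a" "a \<le> t" "t \<le> b"
  shows "t powi k \<le> a powi k + b powi k"
proof (cases "k \<ge> 0")
  case True
  hence "t powi k \<le> b powi k" using assms by (intro power_int_mono) auto
  thus ?thesis using assms by (simp add: add_increasing)
next
  case False
  hence "t powi k \<le> a powi k" using assms by (intro power_int_antimono) auto
  thus ?thesis using assms by (simp add: add_increasing2)
qed

lemma eventually_powi_bounds:
  fixes g :: "complex \<Rightarrow> complex"
  assumes "isCont g z" "g z \<noteq> 0"
  obtains a b :: real where "0 < a" "0 < b"
    "eventually (\<lambda>w. \<forall>k::int. norm (g w) powi k \<le> a powi k + b powi k) (nhds z)"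
proof -
  let ?a = "norm (g z) / 2" and ?b = "norm (g z) * 2"
  have lim: "((\<lambda>w. norm (g w)) \<longlongrightarrow> norm (g z)) (nhds z)"
    using assms(1) by (simp add: isCont_def tendsto_norm tendsto_at_iff_tendsto_nhds)
  have "eventually (\<lambda>w. ?a < norm (g w)) (nhds z)" "eventually (\<lambda>w. norm (g w) < ?b) (nhds z)"
    by (rule order_tendstoD[OF lim], use assms in simp)+
  hence "eventually (\<lambda>w. \<forall>k::int. norm (g w) powi k \<le> ?a powi k + ?b powi k) (nhds z)"
    by eventually_elim (intro allI powi_le_bounds, use assms in auto)
  thus ?thesis using that[of ?a ?b] assms by auto
qed

lemma analytic_at_jtheta:
  assumes "norm q < 1" "q \<noteq> 0" "x \<noteq> 0"
  shows "(\<lambda>x. jtheta x q) analytic_on {x}"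
proof -
  obtain a b :: real where ab: "0 < a" "0 < b"
    "eventually (\<lambda>w. \<forall>k::int. norm w powi k \<le> a powi k + b powi k) (nhds x)"
    using eventually_powi_bounds[where g = "\<lambda>w. w" and z = x] assms by auto
  have nz: "eventually (\<lambda>w. w \<noteq> 0) (nhds x)"
    using assms by (intro t1_space_nhds) auto
  have "(\<lambda>w. infsum (theta_term q w) UNIV) analytic_on {x}"
  proof (rule analytic_at_infsum)
    have "(\<lambda>k. norm q powi tri k * a powi k + norm q powi tri k * b powi k) summable_on UNIV"
      using assms ab by (intro summable_on_add summable_on_gauss) auto
    thus "(\<lambda>k. norm q powi tri k * (a powi k + b powi k)) summable_on UNIV"
      by (simp add: distrib_left)
    show "eventually (\<lambda>w. \<forall>k\<in>UNIV. norm (theta_term q w k) \<le> norm q powi tri k * (a powi k + b powi k)) (nhds x)"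
      using ab(3) by eventually_elim (auto simp: norm_theta_term intro!: mult_left_mono)
    show "eventually (\<lambda>w. \<forall>i\<in>UNIV. (\<lambda>w. theta_term q w i) field_differentiable at w) (nhds x)"
      using nz unfolding theta_term_def 
      by eventually_elim (auto intro!: derivative_intros field_differentiable_mult field_differentiable_const field_differentiable_powi)
  qed
  moreover have ev: "eventually (\<lambda>w. infsum (theta_term q w) UNIV = jtheta w q) (nhds x)"
    using nz by eventually_elim (use jacobi_triple_product assms in \<open>auto simp: infsumI\<close>)
  ultimately show ?thesis using analytic_at_cong[OF ev refl] by simp
qed

lemma analytic_at_jtheta_compose:
  assumes "norm q < 1" "q \<noteq> 0" "g analytic_on {z}" "g z \<noteq> 0"
  shows "(\<lambda>z. jtheta (g z) q) analytic_on {z}"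
  using analytic_on_compose[of g "{z}" "\<lambda>x. jtheta x q"] analytic_at_jtheta[OF assms(1,2,4)] assms(3)
  by (simp add: o_def)

text \<open>For large \<open>\<bar>m\<bar>\<close> the number \<open>Q powi m * d\<close> has norm
  at most 1/2 or at least 2, for all \<open>d\<close> near \<open>c\<close>. The finitely many other
  \<open>m\<close> are handled by continuity.\<close>

lemma eventually_geometric_away_from_1:
  fixes Q c :: complex
  assumes Q: "norm Q < 1" "Q \<noteq> 0" and c: "c \<noteq> 0" and I: "\<And>m. m \<in> I \<Longrightarrow> Q powi m * c \<noteq> 1"
  obtains \<delta> where "\<delta> > 0" "eventually (\<lambda>d. \<forall>m\<in>I. norm (1 - Q powi m * d) \<ge> \<delta>) (nhds c)"
proof -
  have lim0: "(\<lambda>m. norm Q ^ m) \<longlonglongrightarrow> 0" using Q by (intro LIMSEQ_power_zero) auto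
  have "eventually (\<lambda>m. norm Q ^ m < 1 / (4 * norm c)) sequentially"
    "eventually (\<lambda>m. norm Q ^ m < norm c / 4) sequentially"
    by (rule order_tendstoD(2)[OF lim0], use c in simp)+
  hence "eventually (\<lambda>m. norm Q ^ m < 1 / (4 * norm c) \<and> norm Q ^ m < norm c / 4) sequentially"
    by (rule eventually_conj)
  then obtain M where M: "\<And>m. m \<ge> M \<Longrightarrow> norm Q ^ m < 1 / (4 * norm c) \<and> norm Q ^ m < norm c / 4"
    unfolding eventually_sequentially by blast
  define F where "F = I \<inter> {- int M..int M}"
  have F: "finite F" "F \<subseteq> I" by (auto simp: F_def)
  define \<delta> where "\<delta> = Min (insert (1 / 2) ((\<lambda>m. norm (1 - Q powi m * c) / 2) ` F))"
  have \<delta>: "\<delta> > 0" "\<delta> \<le> 1 / 2" "\<And>m. m \<in> F \<Longrightarrow> \<delta> < norm (1 - Q powi m * c)"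
  proof -
    show "\<delta> > 0" unfolding \<delta>_def using F I by (subst Min_gr_iff) (auto simp: subset_iff)
    show "\<delta> \<le> 1 / 2" unfolding \<delta>_def using F by (intro Min_le) auto
    fix m assume m: "m \<in> F"
    have "\<delta> \<le> norm (1 - Q powi m * c) / 2" unfolding \<delta>_def using F m by (intro Min_le) auto
    also have "\<dots> < norm (1 - Q powi m * c)" using I[of m] F m by (auto simp: subset_iff)
    finally show "\<delta> < norm (1 - Q powi m * c)" .
  qed
  have id: "((\<lambda>d. d) \<longlongrightarrow> c) (nhds c)" by (rule filterlim_ident)
  have 1: "eventually (\<lambda>d. \<forall>m\<in>F. \<delta> < norm (1 - Q powi m * d)) (nhds c)"
  proof (rule eventually_ball_finite[OF F(1)], safe)
    fix m assume m: "m \<in> F"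
    have "((\<lambda>d. norm (1 - Q powi m * d)) \<longlongrightarrow> norm (1 - Q powi m * c)) (nhds c)"
      by (intro tendsto_intros id)
    thus "eventually (\<lambda>d. \<delta> < norm (1 - Q powi m * d)) (nhds c)"
      by (rule order_tendstoD(1)) (rule \<delta>(3)[OF m])
  qed
  have 2: "eventually (\<lambda>d. norm d < 2 * norm c) (nhds c)" "eventually (\<lambda>d. norm d > norm c / 2) (nhds c)"
    by (rule order_tendstoD[OF tendsto_norm[OF id]], use c in simp)+
  have 3: "eventually (\<lambda>d. \<forall>m\<in>I. norm (1 - Q powi m * d) \<ge> \<delta>) (nhds c)"
    using 1 2
  proof eventually_elim
    case (elim d)
    show ?case
    proof
      fix m assume m: "m \<in> I"
      consider "m \<in> F" | "m > int M" | "m < - int M" using m by (force simp: F_def)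
      thus "norm (1 - Q powi m * d) \<ge> \<delta>"
      proof cases
        case 1
        thus ?thesis using elim by (simp add: less_imp_le)
      next
        case 2
        define k where "k = nat m"
        have k: "m = int k" "k \<ge> M" using 2 by (auto simp: k_def)
        have "norm (Q powi m * d) = norm Q ^ k * norm d" by (simp add: k norm_mult norm_power)
        also have "\<dots> \<le> 1 / (4 * norm c) * (2 * norm c)"
          using M[OF k(2)] elim by (intro mult_mono) auto
        also have "\<dots> = 1 / 2" using c by simp
        finally have "norm (Q powi m * d) \<le> 1 / 2" .
        moreover have "1 - norm (Q powi m * d) \<le> norm (1 - Q powi m * d)"
          using norm_triangle_ineq2[of 1 "Q powi m * d"] by simp
        ultimately show ?thesis using \<delta>(2) by linarith
      next
        case 3
        define k where "k = nat (- m)"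
        have k: "m = - int k" "k \<ge> M" using 3 by (auto simp: k_def)
        have "2 \<le> norm d / norm Q ^ k"
          using M[OF k(2)] elim Q by (simp add: field_simps)
        also have "\<dots> = norm (Q powi m * d)" by (simp add: k norm_mult norm_power power_int_minus norm_inverse norm_divide field_simps)
        finally have "2 \<le> norm (Q powi m * d)" .
        moreover have "norm (Q powi m * d) - 1 \<le> norm (1 - Q powi m * d)"
          using norm_triangle_ineq2[of "Q powi m * d" 1] by (simp add: norm_minus_commute)
        ultimately show ?thesis using \<delta>(2) by linarith
      qed
    qed
  qed
  show ?thesis by (rule that[OF \<delta>(1) 3])
qed

text \<open>The summands are those of the numerator of an Appell--Lerch sum.  Restricting the index set
  allows the one summand that has a pole at a given point to be split off.\<close>
lemma
  fixes g c :: "complex \<Rightarrow> complex" and e :: "int \<Rightarrow> int"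
  assumes P: "norm P < 1" "P \<noteq> 0" and Q: "norm Q < 1" "Q \<noteq> 0"
    and g: "g analytic_on {z}" "g z \<noteq> 0" and c: "c analytic_on {z}" "c z \<noteq> 0"
    and I: "\<And>r. r \<in> I \<Longrightarrow> Q powi (e r) * c z \<noteq> 1"
  shows analytic_at_appell: "(\<lambda>w. infsum (\<lambda>r. theta_term P (g w) r / (1 - Q powi (e r) * c w)) I) analytic_on {z}"
    and summable_appell: "(\<lambda>r. theta_term P (g z) r / (1 - Q powi (e r) * c z)) summable_on I"
proof -
  let ?f = "\<lambda>r w. theta_term P (g w) r / (1 - Q powi (e r) * c w)"
  have contg: "isCont g z" and contc: "isCont c z" using g c by (auto simp: analytic_at_imp_isCont)
  obtain a b :: real where ab: "0 < a" "0 < b"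
    "eventually (\<lambda>w. \<forall>k::int. norm (g w) powi k \<le> a powi k + b powi k) (nhds z)"
    using eventually_powi_bounds[OF contg g(2)] by auto
  obtain \<delta> where \<delta>: "\<delta> > 0" "eventually (\<lambda>d. \<forall>m\<in>e ` I. norm (1 - Q powi m * d) \<ge> \<delta>) (nhds (c z))"
  proof (rule eventually_geometric_away_from_1[OF Q c(2), of "e ` I"])
    show "Q powi m * c z \<noteq> 1" if "m \<in> e ` I" for m using that I by auto
  qed
  have "(c \<longlongrightarrow> c z) (nhds z)" using contc by (simp add: isCont_def tendsto_at_iff_tendsto_nhds)
  hence \<delta>': "eventually (\<lambda>w. \<forall>m\<in>e ` I. norm (1 - Q powi m * c w) \<ge> \<delta>) (nhds z)"
    by (rule eventually_compose_filterlim[OF \<delta>(2)])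
  define M where "M = (\<lambda>k. norm P powi tri k * (a powi k + b powi k) / \<delta>)"
  have "(\<lambda>k. norm P powi tri k * a powi k + norm P powi tri k * b powi k) summable_on UNIV"
    using P ab by (intro summable_on_add summable_on_gauss) auto
  hence "(\<lambda>k. norm P powi tri k * (a powi k + b powi k)) summable_on UNIV"
    by (simp add: distrib_left)
  hence "(\<lambda>k. norm P powi tri k * (a powi k + b powi k)) summable_on I"
    by (rule summable_on_subset_banach) simp
  hence M: "M summable_on I" unfolding M_def divide_inverse by (rule summable_on_cmult_left)
  have bd: "eventually (\<lambda>w. \<forall>r\<in>I. norm (?f r w) \<le> M r) (nhds z)"
    using ab(3) \<delta>'
  proof eventually_elim
    case (elim w)
    show ?case
    proof
      fix r assume r: "r \<in> I"
      show "norm (?f r w) \<le> M r"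
        unfolding norm_divide norm_theta_term M_def
        by (intro frac_le mult_left_mono mult_nonneg_nonneg add_nonneg_nonneg) (use elim r ab \<delta> in auto)
    qed
  qed
  show "(\<lambda>r. ?f r z) summable_on I"
  proof (rule abs_summable_summable, rule Infinite_Sum.abs_summable_on_comparison_test'[OF M])
    show "norm (?f r z) \<le> M r" if "r \<in> I" for r using eventually_nhds_x_imp_x[OF bd] that by blast
  qed
  obtain A where A: "open A" "z \<in> A" "g holomorphic_on A" using g by (auto simp: analytic_at)
  obtain B where B: "open B" "z \<in> B" "c holomorphic_on B" using c by (auto simp: analytic_at)
  have "(g \<longlongrightarrow> g z) (nhds z)" using contg by (simp add: isCont_def tendsto_at_iff_tendsto_nhds)
  hence gnz: "eventually (\<lambda>w. g w \<noteq> 0) (nhds z)" using g(2) by (rule tendsto_imp_eventually_ne)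
  have df: "eventually (\<lambda>w. \<forall>r\<in>I. ?f r field_differentiable (at w)) (nhds z)"
    using \<delta>' gnz eventually_nhds_in_open[OF A(1,2)] eventually_nhds_in_open[OF B(1,2)]
  proof eventually_elim
    case (elim w)
    have "g field_differentiable at w" "c field_differentiable at w"
      using A B elim holomorphic_on_imp_differentiable_at by blast+
    moreover have "1 - Q powi (e r) * c w \<noteq> 0" if "r \<in> I" for r
      using elim(1) that \<delta>(1) by force
    ultimately show ?case unfolding theta_term_def using elim
      by (auto intro!: field_differentiable_divide field_differentiable_mult field_differentiable_const
          field_differentiable_powi field_differentiable_diff)
  qed
  show "(\<lambda>w. infsum (\<lambda>r. ?f r w) I) analytic_on {z}"
    by (rule analytic_at_infsum[OF M bd df])
qed


section \<open>Monomial bookkeeping\<close>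

definition monomial :: "complex \<Rightarrow> complex \<Rightarrow> complex \<Rightarrow> int \<Rightarrow> int \<Rightarrow> int \<Rightarrow> int \<Rightarrow> complex" where
  "monomial x y q s a b e = (-1) powi s * x powi a * y powi b * q powi e"

text \<open>With \<open>m\<close> a variable, the following rules rewrite a product of integer powers to a single
  term \<open>m s a b e\<close>, so that identities between such products become identities between integers.\<close>
lemma monomial_rules:
  assumes nz: "x \<noteq> 0" "y \<noteq> 0" "q \<noteq> 0" and m: "m = monomial x y q"
  shows "x = m 0 1 0 0" "y = m 0 0 1 0" "q = m 0 0 0 1" "1 = m 0 0 0 0"
    "m s a b e * m s' a' b' e' = m (s + s') (a + a') (b + b') (e + e')"
    "m s a b e / m s' a' b' e' = m (s - s') (a - a') (b - b') (e - e')"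
    "m s a b e powi k = m (k * s) (k * a) (k * b) (k * e)"
    "m s a b e ^ j = m (int j * s) (int j * a) (int j * b) (int j * e)"
    "- m s a b e = m (s + 1) a b e"
proof -
  show "x = m 0 1 0 0" "y = m 0 0 1 0" "q = m 0 0 0 1" "1 = m 0 0 0 0" "- m s a b e = m (s + 1) a b e"
    by (simp_all add: m monomial_def power_int_add)
  show "m s a b e * m s' a' b' e' = m (s + s') (a + a') (b + b') (e + e')"
    "m s a b e / m s' a' b' e' = m (s - s') (a - a') (b - b') (e - e')"
    using nz by (simp_all add: m monomial_def power_int_add power_int_diff)
  show *: "m s a b e powi k = m (k * s) (k * a) (k * b) (k * e)" for k
    using nz by (simp add: m monomial_def power_int_mult_distrib mult.commute[of k] power_int_mult)
  show "m s a b e ^ j = m (int j * s) (int j * a) (int j * b) (int j * e)"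
    using *[of "int j"] by simp
qed

lemma monomial_eqI:
  assumes "m = monomial x y q" "even (s - s')" "a = a'" "b = b'" "e = e'"
  shows "m s a b e = m s' a' b' e'"
proof -
  have "(-1 :: complex) powi s = (-1) powi s'"
    using assms(2) by (auto simp: power_int_minus_left)
  thus ?thesis using assms by (simp add: monomial_def)
qed

lemma tri_add: "tri (a + b) = tri a + tri b + a * b"
proof -
  have "2 * tri (a + b) = 2 * (tri a + tri b + a * b)"
    unfolding distrib_left two_tri by (simp add: algebra_simps)
  thus ?thesis by simp
qed

lemma tri_odd: "tri (2 * h + 1) = h * (2 * h + 1)"
  unfolding tri_def by (simp add: mult.commute)

lemma tri_4 [simp]: "tri 4 = 6"
  by (simp add: tri_def)

section \<open>Functional equations\<close>

text \<open>\<open>x\<close> is fixed and \<open>y\<close> remains a variable. The parameter is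
  \<open>h\<close> and not the odd number \<open>n = 2 * h + 1\<close>, so that exponents with
  halves such as \<open>tri n = h * n\<close> become polynomials.\<close>

locale hecke_sums =
  fixes q x :: complex and h :: int
  assumes q: "norm q < 1" "q \<noteq> 0" and x: "x \<noteq> 0" and h: "h \<ge> 0"
begin

definition n :: int where "n = 2 * h + 1"

definition Q :: complex where "Q = q powi (8 * n + 16)"

definition P :: complex where "P = Q powi n"

definition X :: complex where "X = - (q powi (2 * n + 8) * x ^ 4)"

definition Y :: "complex \<Rightarrow> complex" where "Y y = - (q powi (2 * n + 8) * y ^ 4)"

definition w :: "complex \<Rightarrow> complex" where "w y = y powi n / x powi n"

text \<open>\<open>U t\<close> and \<open>V t\<close> are the sums of row \<open>t\<close> and of column \<open>t\<close> of the terms of the double sum \<open>f\<close>,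
  taken over all integers.\<close>
definition U :: "int \<Rightarrow> complex \<Rightarrow> complex" where
  "U t y = (- x) powi t * q powi (n * tri t) * jtheta (q powi ((n + 4) * t) * y) (q powi n)"

definition V :: "int \<Rightarrow> complex \<Rightarrow> complex" where
  "V t y = (- y) powi t * q powi (n * tri t) * jtheta (q powi ((n + 4) * t) * x) (q powi n)"

definition cterm :: "complex \<Rightarrow> int \<Rightarrow> int \<Rightarrow> complex" where
  "cterm y r s = (-1) powi (r + s) * x powi r * y powi s * q powi (n * tri r + (n + 4) * r * s + n * tri s)"

text \<open>\<open>S\<close> and \<open>R\<close> are the Appell--Lerch sums of the second and of the first half of \<open>g\<close>, without
  the factors \<open>1/j(w;P)\<close> and \<open>1/j(1/w;P)\<close>.\<close>
definition S :: "int \<Rightarrow> complex \<Rightarrow> complex" where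
  "S t y = (\<Sum>\<^sub>\<infinity>r. theta_term P (w y) r / (1 - Q powi (n * r - t - h) * (1 / Y y)))"

definition R :: "int \<Rightarrow> complex \<Rightarrow> complex" where
  "R t y = (\<Sum>\<^sub>\<infinity>r. theta_term P (1 / w y) r / (1 - Q powi (n * r - t - h) * (1 / X)))"

lemma n_pos: "n > 0"
  using h by (simp add: n_def)

lemma norm_powi_less_1: "k > 0 \<Longrightarrow> norm (q powi k) < 1"
  using q by (simp add: norm_power_int power_int_def norm_power power_less_one_iff)

lemma bases: "norm (q powi n) < 1" "q powi n \<noteq> 0" "norm Q < 1" "Q \<noteq> 0" "norm P < 1" "P \<noteq> 0"
proof -
  have "P = q powi ((8 * n + 16) * n)" unfolding P_def Q_def by (simp add: power_int_mult)
  thus "norm (q powi n) < 1" "q powi n \<noteq> 0" "norm Q < 1" "Q \<noteq> 0" "norm P < 1" "P \<noteq> 0"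
    using n_pos q norm_powi_less_1 by (auto simp: Q_def)
qed

lemma X_nz: "X \<noteq> 0" and Y_nz: "y \<noteq> 0 \<Longrightarrow> Y y \<noteq> 0" and w_nz: "y \<noteq> 0 \<Longrightarrow> w y \<noteq> 0"
  using q x by (auto simp: X_def Y_def w_def)

lemma cterm_row:
  assumes "y \<noteq> 0"
  shows "cterm y t s = (- x) powi t * q powi (n * tri t) * theta_term (q powi n) (q powi ((n + 4) * t) * y) s"
    and "cterm y s t = (- y) powi t * q powi (n * tri t) * theta_term (q powi n) (q powi ((n + 4) * t) * x) s"
proof -
  define m where "m = monomial x y q"
  note m = monomial_rules[OF x assms q(2) m_def] and eq = monomial_eqI[OF m_def]
  show "cterm y t s = (- x) powi t * q powi (n * tri t) * theta_term (q powi n) (q powi ((n + 4) * t) * y) s"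
    unfolding cterm_def theta_term_def by (simp only: m, rule eq) (simp_all add: algebra_simps)
  show "cterm y s t = (- y) powi t * q powi (n * tri t) * theta_term (q powi n) (q powi ((n + 4) * t) * x) s"
    unfolding cterm_def theta_term_def by (simp only: m, rule eq) (simp_all add: algebra_simps)
qed

lemma has_sum_cterm:
  assumes "y \<noteq> 0"
  shows "((\<lambda>s. cterm y t s) has_sum U t y) UNIV" and "((\<lambda>r. cterm y r t) has_sum V t y) UNIV"
proof -
  show "((\<lambda>s. cterm y t s) has_sum U t y) UNIV"
    unfolding cterm_row(1)[OF assms] U_def
    by (intro has_sum_cmult_right jacobi_triple_product; use assms q x bases in simp)
  show "((\<lambda>r. cterm y r t) has_sum V t y) UNIV"
    unfolding cterm_row(2)[OF assms] V_def
    by (intro has_sum_cmult_right jacobi_triple_product; use assms q x bases in simp)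
qed

lemma tri_n: "tri n = h * n" "tri (n + 4) = h * n + 4 * n + 6" "tri (- n) = h * n + n"
  unfolding tri_add tri_uminus by (simp_all add: n_def tri_odd)

text \<open>Raising \<open>t\<close> by \<open>n\<close> moves the theta argument by the power
  \<open>n + 4\<close> of the base \<open>q powi n\<close>, so the row reproduces itself up to a
  monomial.\<close>

lemma U_shift:
  assumes y: "y \<noteq> 0"
  shows "U (t + n) y * (- (w y * Y y * Q powi (t + h))) = U t y"
proof -
  define m where "m = monomial x y q"
  note m = monomial_rules[OF x y q(2) m_def] and eq = monomial_eqI[OF m_def]
  define z where "z = q powi ((n + 4) * t) * y"
  have z: "z \<noteq> 0" using q y by (simp add: z_def)
  have "q powi ((n + 4) * (t + n)) * y = (q powi n) powi (n + 4) * z"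
    unfolding z_def by (simp only: m, rule eq) (simp_all add: algebra_simps)
  hence J: "jtheta (q powi ((n + 4) * (t + n)) * y) (q powi n) =
      (-1) powi (n + 4) * (q powi n) powi (- tri (n + 4)) * z powi (- (n + 4)) * jtheta z (q powi n)"
    using jtheta_shift[OF bases(1,2) z] by simp
  have mon: "(- x) powi (t + n) * q powi (n * tri (t + n)) * ((-1) powi (n + 4) * (q powi n) powi (- tri (n + 4)) * z powi (- (n + 4)))
      * (- (w y * Y y * Q powi (t + h))) = (- x) powi t * q powi (n * tri t)"
    unfolding z_def w_def Y_def Q_def tri_add[of t n] tri_n
    by (simp only: m, rule eq) (simp_all add: n_def algebra_simps)
  show ?thesis
    unfolding U_def J z_def[symmetric] mon[symmetric] by (simp only: mult_ac)
qed

text \<open>Since \<open>(n + 4)^2 = (8n + 16) + n^2\<close>, raising \<open>t\<close> by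
  \<open>n + 4\<close> multiplies the theta argument by \<open>Q\<close> and by the power
  \<open>n\<close> of the base \<open>q powi n\<close>.\<close>

lemma U_mult_Q:
  assumes y: "y \<noteq> 0"
  shows "U t (Q * y) = - (w y * (Q powi (h + 1) / X)) * U (t + 4 + n) y"
proof -
  define m where "m = monomial x y q"
  note m = monomial_rules[OF x y q(2) m_def] and eq = monomial_eqI[OF m_def]
  define z where "z = q powi ((n + 4) * t) * (Q * y)"
  have z: "z \<noteq> 0" using q y by (simp add: z_def Q_def)
  have "q powi ((n + 4) * (t + 4 + n)) * y = (q powi n) powi n * z"
    unfolding z_def Q_def by (simp only: m, rule eq) (simp_all add: algebra_simps)
  hence J: "jtheta (q powi ((n + 4) * (t + 4 + n)) * y) (q powi n) =
      (-1) powi n * (q powi n) powi (- tri n) * z powi (- n) * jtheta z (q powi n)"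
    using jtheta_shift[OF bases(1,2) z] by simp
  have mon: "(- x) powi t * q powi (n * tri t) = 
     - (w y * (Q powi (h + 1) / X)) * ((- x) powi (t + 4 + n) * q powi (n * tri (t + 4 + n)) * 
      ((-1) powi n * (q powi n) powi (- tri n) * z powi (- n)))"
    unfolding z_def w_def X_def Q_def tri_add[of "t + 4" n] tri_add[of t 4] tri_n
    by (simp only: m, rule eq) (simp_all add: n_def algebra_simps)
  show ?thesis
    unfolding U_def J z_def[symmetric] mon by (simp only: mult_ac)
qed

lemma V_shift:
  assumes y: "y \<noteq> 0"
  shows "V (t - n) y * (Q powi (h + 1) / X) = - (Q powi t * V t y / w y)"
proof -
  define m where "m = monomial x y q"
  note m = monomial_rules[OF x y q(2) m_def] and eq = monomial_eqI[OF m_def]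
  define z where "z = q powi ((n + 4) * (t - n)) * x"
  have z: "z \<noteq> 0" using q x by (simp add: z_def)
  have "q powi ((n + 4) * t) * x = (q powi n) powi (n + 4) * z"
    unfolding z_def by (simp only: m, rule eq) (simp_all add: algebra_simps)
  hence J: "jtheta (q powi ((n + 4) * t) * x) (q powi n) =
      (-1) powi (n + 4) * (q powi n) powi (- tri (n + 4)) * z powi (- (n + 4)) * jtheta z (q powi n)"
    using jtheta_shift[OF bases(1,2) z] by simp
  have mon: "(- y) powi (t - n) * q powi (n * tri (t - n)) * (Q powi (h + 1) / X) = 
     - (Q powi t * ((- y) powi t * q powi (n * tri t) * 
      ((-1) powi (n + 4) * (q powi n) powi (- tri (n + 4)) * z powi (- (n + 4)))) / w y)"
    unfolding z_def w_def X_def Q_def diff_conv_add_uminus[of t n] tri_add[of t "- n"] tri_n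
    by (simp only: m, rule eq) (simp_all add: n_def algebra_simps)
  have "V (t - n) y * (Q powi (h + 1) / X) = 
    ((- y) powi (t - n) * q powi (n * tri (t - n)) * (Q powi (h + 1) / X)) * jtheta z (q powi n)"
    unfolding V_def z_def by (simp only: mult_ac)
  also have "\<dots> = - (Q powi t * V t y / w y)"
    unfolding mon V_def J by simp
  finally show ?thesis .
qed

lemma V_mult_Q: "V t (Q * y) = Q powi t * V t y"
proof -
  have "(- (Q * y)) powi t = Q powi t * (- y) powi t"
    by (simp flip: power_int_mult_distrib)
  thus ?thesis unfolding V_def by simp
qed

lemma w_mult_Q: "w (Q * y) = P * w y" and Y_mult_Q: "Y (Q * y) = Q ^ 4 * Y y"
  by (simp_all add: w_def Y_def P_def power_int_mult_distrib power_mult_distrib)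

lemma P_powi: "P powi r = Q powi (n * r)"
  by (simp add: P_def power_int_mult)

lemma theta_term_mult: "theta_term P (P powi j * z) r = P powi (j * r) * theta_term P z r"
  unfolding theta_term_def by (simp add: power_int_mult_distrib power_int_mult)

lemma theta_term_Suc: "z \<noteq> 0 \<Longrightarrow> theta_term P z (r + 1) = - (z * P powi r * theta_term P z r)"
  unfolding theta_term_def using bases by (simp add: power_int_add tri_Suc)

text \<open>The exponents \<open>n * r - t - h\<close> take every integer value, so these are the
  nonzero \<open>y\<close> at which no summand of any \<open>S t\<close> is singular.\<close>

definition regular :: "complex \<Rightarrow> bool" where
  "regular y \<longleftrightarrow> y \<noteq> 0 \<and> (\<forall>k::int. Q powi k * (1 / Y y) \<noteq> 1)"

lemma summable_S:
  assumes "y \<noteq> 0" "\<And>r. r \<in> I \<Longrightarrow> Q powi (n * r - t - h) * (1 / Y y) \<noteq> 1"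
  shows "(\<lambda>r. theta_term P (w y) r / (1 - Q powi (n * r - t - h) * (1 / Y y))) summable_on I"
  by (rule summable_appell[OF bases(5,6,3,4), of "\<lambda>_. w y" y "\<lambda>_. 1 / Y y" I "\<lambda>r. n * r - t - h"])
     (use assms w_nz Y_nz in auto)

lemma summable_R:
  assumes "y \<noteq> 0" "\<And>k::int. Q powi k * (1 / X) \<noteq> 1"
  shows "(\<lambda>r. theta_term P (1 / w y) r / (1 - Q powi (n * r - t - h) * (1 / X))) summable_on UNIV"
  by (rule summable_appell[OF bases(5,6,3,4), of "\<lambda>_. 1 / w y" y "\<lambda>_. 1 / X" UNIV "\<lambda>r. n * r - t - h"])
     (use assms w_nz X_nz in auto)

lemma S_shift:
  assumes y: "y \<noteq> 0"
  shows "S (t + n) y = - (w y * (\<Sum>\<^sub>\<infinity>r. P powi r * theta_term P (w y) r / (1 - Q powi (n * r - t - h) * (1 / Y y))))"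
proof -
  have "S (t + n) y = (\<Sum>\<^sub>\<infinity>r. theta_term P (w y) (r + 1) / (1 - Q powi (n * (r + 1) - (t + n) - h) * (1 / Y y)))"
    unfolding S_def
    by (rule infsum_reindex_bij_betw[symmetric], rule bij_betwI[of _ _ _ "\<lambda>r. r - 1"]) auto
  also have "\<dots> = (\<Sum>\<^sub>\<infinity>r. - w y * (P powi r * theta_term P (w y) r / (1 - Q powi (n * r - t - h) * (1 / Y y))))"
  proof (rule infsum_cong)
    fix r
    have e: "n * (r + 1) - (t + n) - h = n * r - t - h" by (simp add: algebra_simps)
    show "theta_term P (w y) (r + 1) / (1 - Q powi (n * (r + 1) - (t + n) - h) * (1 / Y y)) =
      - w y * (P powi r * theta_term P (w y) r / (1 - Q powi (n * r - t - h) * (1 / Y y)))"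
      unfolding theta_term_Suc[OF w_nz[OF y]] e by simp
  qed
  finally show ?thesis unfolding infsum_cmult_right' by simp
qed

text \<open>With \<open>\<kappa>\<close> the term subtracted in the denominator,
  \<open>P powi r\<close> is \<open>\<kappa>\<close> times a factor free of \<open>r\<close>, and
  \<open>\<kappa> / (1 - \<kappa>) = 1 / (1 - \<kappa>) - 1\<close>. The final 1 contributes a
  complete theta series.\<close>

lemma S_shift_n:
  assumes "regular y"
  shows "S (t + n) y = - (w y * Y y * Q powi (t + h)) * (S t y - jtheta (w y) P)"
proof -
  have y: "y \<noteq> 0" and nz: "1 - Q powi k * (1 / Y y) \<noteq> 0" for k
    using assms by (auto simp: regular_def)
  have e: "P powi r * theta_term P (w y) r / (1 - Q powi (n * r - t - h) * (1 / Y y)) =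
    Y y * Q powi (t + h) * (theta_term P (w y) r / (1 - Q powi (n * r - t - h) * (1 / Y y)) - theta_term P (w y) r)" for r
  proof -
    define \<kappa> where "\<kappa> = Q powi (n * r - t - h) * (1 / Y y)"
    have "Q powi (n * r - t - h) = Q powi (n * r) / Q powi (t + h)"
      using power_int_diff[of Q "n * r" "t + h"] bases by (simp add: algebra_simps)
    hence "P powi r = Y y * Q powi (t + h) * \<kappa>"
      unfolding P_powi \<kappa>_def using bases Y_nz[OF y] by simp
    moreover have "1 - \<kappa> \<noteq> 0" using nz unfolding \<kappa>_def by blast
    ultimately show ?thesis unfolding \<kappa>_def[symmetric] by (simp add: field_simps)
  qed
  have "((\<lambda>r. theta_term P (w y) r / (1 - Q powi (n * r - t - h) * (1 / Y y))) has_sum S t y) UNIV"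
    unfolding S_def using summable_S[OF y, of UNIV t] assms by (intro has_sum_infsum) (auto simp: regular_def)
  hence "((\<lambda>r. theta_term P (w y) r / (1 - Q powi (n * r - t - h) * (1 / Y y)) + - theta_term P (w y) r)
     has_sum (S t y + - jtheta (w y) P)) UNIV"
    using jacobi_triple_product[OF bases(5,6) w_nz[OF y]]
    by (intro has_sum_add) (simp_all add: has_sum_uminus)
  hence "(\<Sum>\<^sub>\<infinity>r. P powi r * theta_term P (w y) r / (1 - Q powi (n * r - t - h) * (1 / Y y))) =
    Y y * Q powi (t + h) * (S t y - jtheta (w y) P)"
    unfolding e infsum_cmult_right' by (simp add: infsumI)
  thus ?thesis unfolding S_shift[OF y] by simp
qed

text \<open>\<open>Y\<close> acquires \<open>Q ^ 4\<close>, which \<open>t\<close> absorbs as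
  \<open>t + 4\<close>; the factor \<open>P powi r\<close> acquired from \<open>w\<close> is a shift
  of \<open>t\<close> by \<open>n\<close>. The equality is termwise and so holds at poles too, where
  the singular summands are 0 on both sides.\<close>

lemma S_mult_Q:
  assumes y: "y \<noteq> 0"
  shows "S t (Q * y) = - S (t + 4 + n) y / w y"
proof -
  have "S t (Q * y) = (\<Sum>\<^sub>\<infinity>r. P powi r * theta_term P (w y) r / (1 - Q powi (n * r - (t + 4) - h) * (1 / Y y)))"
    unfolding S_def
  proof (rule infsum_cong)
    fix r
    have "Q powi (n * r - t - h) * (1 / Y (Q * y)) = Q powi (n * r - (t + 4) - h) * (1 / Y y)"
      unfolding Y_mult_Q using bases power_int_diff[of Q "n * r - t - h" 4] by (simp add: algebra_simps)
    thus "theta_term P (w (Q * y)) r / (1 - Q powi (n * r - t - h) * (1 / Y (Q * y))) =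
      P powi r * theta_term P (w y) r / (1 - Q powi (n * r - (t + 4) - h) * (1 / Y y))"
      using theta_term_mult[of 1 "w y" r] by (simp add: w_mult_Q)
  qed
  thus ?thesis using S_shift[OF y, of "t + 4"] w_nz[OF y] by simp
qed

section \<open>The Appell-Lerch parts under multiplication of \<open>y\<close> by
  \<open>Q\<close>\<close>

definition T :: "int \<Rightarrow> complex \<Rightarrow> complex" where "T t y = U t y * S t y"

text \<open>By \<open>hecke_g_eq\<close>, \<open>jtheta (w y) P\<close> times \<open>g\<close> is
  \<open>B y - w y * A y\<close>.\<close>

definition B :: "complex \<Rightarrow> complex" where "B y = (\<Sum>t\<in>{0..n - 1}. T t y)"

definition A :: "complex \<Rightarrow> complex" where "A y = (\<Sum>t\<in>{0..n - 1}. V t y * R t y)"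

text \<open>The monomials in \<open>U_shift\<close> and \<open>S_shift_n\<close> cancel, so only the
  theta series is left as a change.\<close>

lemma T_shift_n:
  assumes "regular y"
  shows "T (t + n) y = T t y - U t y * jtheta (w y) P"
proof -
  have y: "y \<noteq> 0" using assms by (simp add: regular_def)
  show ?thesis
    unfolding T_def S_shift_n[OF assms] U_shift[OF y, of t, symmetric] by (simp add: algebra_simps)
qed

lemma T_mult_Q:
  assumes y: "y \<noteq> 0"
  shows "T t (Q * y) = Q powi (h + 1) / X * T (t + 4 + n) y"
  unfolding T_def S_mult_Q[OF y] U_mult_Q[OF y] using w_nz[OF y] by simp

text \<open>\<open>B (Q * y)\<close> amounts to the sum of \<open>T\<close> over
  \<open>n + 4..2 * n + 3\<close>. The interval \<open>0..2 * n + 3\<close> is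
  \<open>0..n + 3\<close> followed by this one, and also \<open>0..n - 1\<close> followed by
  \<open>0..n + 3\<close> shifted by \<open>n\<close>. Comparing the two costs one row for each
  \<open>t\<close> in \<open>0..n + 3\<close>.\<close>

lemma B_mult_Q:
  assumes "regular y"
  shows "B (Q * y) = Q powi (h + 1) / X * (B y - jtheta (w y) P * (\<Sum>t\<in>{0..n + 3}. U t y))"
proof -
  have y: "y \<noteq> 0" using assms by (simp add: regular_def)
  have shift: "(\<Sum>t\<in>{a..b}. T (t + c) y) = (\<Sum>t\<in>{a + c..b + c}. T t y)" for a b c :: int
    by (rule sum.reindex_bij_witness[of _ "\<lambda>t. t - c" "\<lambda>t. t + c"]) auto
  have split: "(\<Sum>t\<in>{0..b}. T t y) = (\<Sum>t\<in>{0..a - 1}. T t y) + (\<Sum>t\<in>{a..b}. T t y)" if "0 \<le> a" "a \<le> b + 1" for a b :: int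
    by (subst sum.union_disjoint[symmetric]) (use that in \<open>auto intro!: sum.cong\<close>)
  have "(\<Sum>t\<in>{0..n + 3}. T (t + n) y) = (\<Sum>t\<in>{0..n + 3}. T t y) - jtheta (w y) P * (\<Sum>t\<in>{0..n + 3}. U t y)"
    unfolding T_shift_n[OF assms] sum_subtractf by (simp add: sum_distrib_left mult.commute)
  moreover have "(\<Sum>t\<in>{0..n + 3}. T (t + n) y) = (\<Sum>t\<in>{n..2 * n + 3}. T t y)"
    unfolding shift by (rule sum.cong) auto
  moreover have "(\<Sum>t\<in>{0..n - 1}. T (t + (4 + n)) y) = (\<Sum>t\<in>{n + 4..2 * n + 3}. T t y)"
    unfolding shift by (rule sum.cong) auto
  ultimately have "(\<Sum>t\<in>{0..n - 1}. T (t + (4 + n)) y) = B y - jtheta (w y) P * (\<Sum>t\<in>{0..n + 3}. U t y)"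
  proof -
    assume a: "(\<Sum>t\<in>{0..n + 3}. T (t + n) y) = (\<Sum>t\<in>{0..n + 3}. T t y) - jtheta (w y) P * (\<Sum>t\<in>{0..n + 3}. U t y)"
      "(\<Sum>t\<in>{0..n + 3}. T (t + n) y) = (\<Sum>t\<in>{n..2 * n + 3}. T t y)"
      "(\<Sum>t\<in>{0..n - 1}. T (t + (4 + n)) y) = (\<Sum>t\<in>{n + 4..2 * n + 3}. T t y)"
    have "n + 4 - 1 = n + 3" by simp
    hence "(\<Sum>t\<in>{0..2 * n + 3}. T t y) = (\<Sum>t\<in>{0..n + 3}. T t y) + (\<Sum>t\<in>{n + 4..2 * n + 3}. T t y)"
      using split[of "n + 4" "2 * n + 3"] n_pos by (simp add: add.commute[of 3 n])
    moreover have "(\<Sum>t\<in>{0..2 * n + 3}. T t y) = B y + (\<Sum>t\<in>{n..2 * n + 3}. T t y)"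
      using split[of n "2 * n + 3"] n_pos by (simp add: B_def)
    moreover have "v = b - c" if "s = p + r" "s = b + t" "z = p - c" "z = t" "v = r" for s p r b t z c v :: complex
    proof -
      have "r = s - p" using that(1) by simp
      thus ?thesis unfolding that(5) using that(2-4) by simp
    qed
    ultimately show ?thesis using a by blast
  qed
  moreover have "B (Q * y) = Q powi (h + 1) / X * (\<Sum>t\<in>{0..n - 1}. T (t + (4 + n)) y)"
    unfolding B_def T_mult_Q[OF y] sum_distrib_left by (simp add: add.assoc)
  ultimately show ?thesis by simp
qed

text \<open>The denominators are free of \<open>y\<close>, and the numerators acquire
  \<open>P powi (- r)\<close>. Writing
  \<open>1 / (1 - \<kappa>) = 1 + \<kappa> / (1 - \<kappa>)\<close>, the 1 gives a theta series, and
  the rest a multiple of \<open>R t y\<close> because \<open>\<kappa> * P powi (- r)\<close> does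
  not depend on \<open>r\<close>.\<close>

lemma R_mult_Q:
  assumes y: "y \<noteq> 0" and X: "\<And>k::int. Q powi k * (1 / X) \<noteq> 1"
  shows "Q powi t * R t (Q * y) = Q powi (- h) / X * R t y + Q powi t * jtheta (w y) P / (P * (w y)\<^sup>2)"
proof -
  have e: "theta_term P (1 / w (Q * y)) r / (1 - Q powi (n * r - t - h) * (1 / X)) = 
     Q powi (- h - t) / X * (theta_term P (1 / w y) r / (1 - Q powi (n * r - t - h) * (1 / X))) + theta_term P (1 / w (Q * y)) r" for r
  proof -
    define \<kappa> where "\<kappa> = Q powi (n * r - t - h) * (1 / X)"
    have "1 / w (Q * y) = P powi (-1) * (1 / w y)"
      unfolding w_mult_Q by (simp add: power_int_minus field_simps)
    hence 1: "theta_term P (1 / w (Q * y)) r = P powi (- r) * theta_term P (1 / w y) r"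
      using theta_term_mult[of "-1" "1 / w y" r] by simp
    have "Q powi (n * r - t - h) = Q powi (n * r) * Q powi (- h - t)"
      using power_int_add[of Q "n * r" "- h - t"] bases by (simp add: algebra_simps)
    hence 2: "Q powi (- h - t) / X = \<kappa> * P powi (- r)"
      unfolding P_powi \<kappa>_def using bases by (simp add: power_int_minus)
    have "1 - \<kappa> \<noteq> 0" using X unfolding \<kappa>_def by simp
    thus ?thesis unfolding 1 2 \<kappa>_def[symmetric] by (simp add: field_simps)
  qed
  have "((\<lambda>r. theta_term P (1 / w y) r / (1 - Q powi (n * r - t - h) * (1 / X))) has_sum R t y) UNIV"
    unfolding R_def by (intro has_sum_infsum summable_R y X)
  hence "((\<lambda>r. theta_term P (1 / w (Q * y)) r / (1 - Q powi (n * r - t - h) * (1 / X))) has_sum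
     (Q powi (- h - t) / X * R t y + jtheta (1 / w (Q * y)) P)) UNIV"
    unfolding e using bases y w_nz[of "Q * y"]
    by (intro has_sum_add has_sum_cmult_right jacobi_triple_product) auto
  hence "R t (Q * y) = Q powi (- h - t) / X * R t y + jtheta (1 / w (Q * y)) P"
    unfolding R_def by (rule infsumI)
  moreover have "jtheta (1 / w (Q * y)) P = jtheta (w y) P / (P * (w y)\<^sup>2)"
    using jtheta_inverse[OF bases(5,6), of "w (Q * y)"] jtheta_mult_base[OF bases(5,6) w_nz[OF y]] 
      w_nz[of "Q * y"] bases y by (simp add: w_mult_Q power2_eq_square)
  moreover have "Q powi t * Q powi (- h - t) = Q powi (- h)"
    using power_int_add[of Q t "- h - t"] bases by simp
  ultimately show ?thesis by (simp add: distrib_left mult.assoc[symmetric])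
qed

text \<open>The theta series left by \<open>R_mult_Q\<close> come with the factors
  \<open>Q powi t * V t y\<close>; by \<open>V_shift\<close> these are the columns
  \<open>t - n\<close>, up to a common factor.\<close>

lemma A_mult_Q:
  assumes y: "y \<noteq> 0" and X: "\<And>k::int. Q powi k * (1 / X) \<noteq> 1"
  shows "w (Q * y) * A (Q * y) = Q powi (h + 1) / X * (w y * A y - jtheta (w y) P * (\<Sum>t\<in>{- n..-1}. V t y))"
proof -
  have "(\<Sum>t\<in>{- n..-1}. V t y) = (\<Sum>t\<in>{0..n - 1}. V (t - n) y)"
    by (rule sum.reindex_bij_witness[of _ "\<lambda>t. t - n" "\<lambda>t. t + n"]) auto
  hence V: "(\<Sum>t\<in>{- n..-1}. V t y) * (Q powi (h + 1) / X) = - (\<Sum>t\<in>{0..n - 1}. Q powi t * V t y) / w y"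
    by (simp add: sum_distrib_right V_shift[OF y] sum_negf sum_divide_distrib del: times_divide_eq_right)
  have "A (Q * y) = (\<Sum>t\<in>{0..n - 1}. V t y * (Q powi t * R t (Q * y)))"
    unfolding A_def V_mult_Q by (simp add: mult_ac)
  also have "\<dots> = Q powi (- h) / X * A y + jtheta (w y) P / (P * (w y)\<^sup>2) * (\<Sum>t\<in>{0..n - 1}. Q powi t * V t y)"
    unfolding R_mult_Q[OF y X] A_def
    by (simp add: sum.distrib distrib_left sum_distrib_left sum_divide_distrib mult_ac)
  finally have A: "A (Q * y) = \<dots>" .
  have "P * Q powi (- h) = Q powi (h + 1)"
    unfolding P_def using bases power_int_add[of Q n "- h"] by (simp add: n_def)
  hence "w (Q * y) * A (Q * y) = Q powi (h + 1) / X * (w y * A y) + jtheta (w y) P * ((\<Sum>t\<in>{0..n - 1}. Q powi t * V t y) / w y)"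
    unfolding A w_mult_Q using w_nz[OF y] bases by (simp add: distrib_left power2_eq_square)
  also have "(\<Sum>t\<in>{0..n - 1}. Q powi t * V t y) / w y = - ((\<Sum>t\<in>{- n..-1}. V t y) * (Q powi (h + 1) / X))"
    unfolding V by simp
  finally show ?thesis by (simp add: algebra_simps)
qed

end


section \<open>The double sum\<close>

context hecke_sums
begin

definition f :: "complex \<Rightarrow> complex" where "f y = hecke_f n (n + 4) n x y q"

text \<open>This is \<open>(sg r + sg s) / 2\<close>, a weight on the whole lattice on which
  translations of the two coordinates act separately.\<close>

definition sgw :: "int \<Rightarrow> int \<Rightarrow> complex" where
  "sgw r s = (if sg r = sg s then of_int (sg r) else 0)"

text \<open>Where the weight is nonzero, \<open>r * s \<ge> 0\<close>; the mixed factor then has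
  norm at most 1, and two independent theta terms remain.\<close>

lemma norm_sgw_cterm_le:
  assumes y: "y \<noteq> 0"
  shows "norm (sgw r s * cterm y r s) \<le> norm (theta_term (q powi n) x r) * norm (theta_term (q powi n) y s)"
proof (cases "sg r = sg s")
  case False
  thus ?thesis by (simp add: sgw_def)
next
  case True
  have "r * s \<ge> 0" using True by (auto simp: sg_def split: if_splits intro: mult_nonpos_nonpos)
  hence rs: "(n + 4) * r * s \<ge> 0" using n_pos by (simp add: mult.assoc)
  have "norm (sgw r s * cterm y r s) = norm q powi ((n + 4) * r * s) *
      (norm (theta_term (q powi n) x r) * norm (theta_term (q powi n) y s))"
    unfolding cterm_def norm_theta_term using q True
    by (auto simp: sgw_def sg_def norm_mult norm_power norm_power_int power_int_add power_int_mult)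
  also have "\<dots> \<le> 1 * (norm (theta_term (q powi n) x r) * norm (theta_term (q powi n) y s))"
    using rs q by (intro mult_right_mono) (auto intro!: power_int_le_one)
  finally show ?thesis by simp
qed

lemma has_sum_f:
  assumes y: "y \<noteq> 0"
  shows "((\<lambda>(r, s). sgw r s * cterm y r s) has_sum f y) UNIV"
proof -
  let ?g = "\<lambda>(r, s). sgw r s * cterm y r s"
  have "(\<lambda>(r, s). norm (theta_term (q powi n) x r) * norm (theta_term (q powi n) y s)) summable_on UNIV \<times> UNIV"
    by (rule summable_on_product) (use summable_norm_theta_term[OF bases(1,2)] x y in auto)
  hence "(\<lambda>(r, s). norm (theta_term (q powi n) x r) * norm (theta_term (q powi n) y s)) summable_on UNIV"
    by simp
  hence "(\<lambda>p. norm (?g p)) summable_on UNIV"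
    by (rule Infinite_Sum.abs_summable_on_comparison_test') (use norm_sgw_cterm_le[OF y] in auto)
  hence "?g summable_on UNIV" by (rule abs_summable_summable)
  moreover have "infsum ?g UNIV = f y"
    unfolding f_def hecke_f_def
    by (rule infsum_cong_neutral) (auto simp: sgw_def cterm_def mult_ac)
  ultimately show ?thesis by (simp add: has_sum_iff)
qed

lemma cterm_add:
  assumes y: "y \<noteq> 0"
  shows "cterm y (r + (n + 4)) (s + - n) = cterm y (n + 4) (- n) * cterm (Q * y) r s"
proof -
  define m where "m = monomial x y q"
  note m = monomial_rules[OF x y q(2) m_def] and eq = monomial_eqI[OF m_def]
  show ?thesis
    unfolding cterm_def Q_def tri_add[of r "n + 4"] tri_add[of s "- n"]
    by (simp only: m, rule eq) (simp_all add: algebra_simps)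
qed

lemma has_sum_strip:
  assumes y: "y \<noteq> 0"
  shows "((\<lambda>(r, s). (if r \<in> {a..b} then 1 else 0) * cterm y r s) has_sum (\<Sum>t\<in>{a..b}. U t y)) UNIV"
    and "((\<lambda>(r, s). (if s \<in> {a..b} then 1 else 0) * cterm y r s) has_sum (\<Sum>t\<in>{a..b}. V t y)) UNIV"
proof -
  let ?g = "\<lambda>(r, s). cterm y r s"
  have u: "(\<Union>t\<in>{a..b}. range (Pair t)) = {a..b} \<times> UNIV" "(\<Union>t\<in>{a..b}. range (\<lambda>r. (r, t))) = UNIV \<times> {a..b}"
    by auto
  have "(?g has_sum (\<Sum>t\<in>{a..b}. U t y)) (\<Union>t\<in>{a..b}. range (Pair t))"
  proof (rule sum_has_sum)
    show "(?g has_sum U t y) (range (Pair t))" for t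
      by (subst has_sum_reindex) (use has_sum_cterm(1)[OF y] in \<open>auto simp: inj_on_def o_def\<close>)
  qed auto
  thus "((\<lambda>(r, s). (if r \<in> {a..b} then 1 else 0) * cterm y r s) has_sum (\<Sum>t\<in>{a..b}. U t y)) UNIV"
    unfolding u by (subst has_sum_cong_neutral[where T = "{a..b} \<times> UNIV" and g = ?g]) (auto split: if_splits)
  have "(?g has_sum (\<Sum>t\<in>{a..b}. V t y)) (\<Union>t\<in>{a..b}. range (\<lambda>r. (r, t)))"
  proof (rule sum_has_sum)
    show "(?g has_sum V t y) (range (\<lambda>r. (r, t)))" for t
      by (subst has_sum_reindex) (use has_sum_cterm(2)[OF y] in \<open>auto simp: inj_on_def o_def\<close>)
  qed auto
  thus "((\<lambda>(r, s). (if s \<in> {a..b} then 1 else 0) * cterm y r s) has_sum (\<Sum>t\<in>{a..b}. V t y)) UNIV"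
    unfolding u by (subst has_sum_cong_neutral[where T = "UNIV \<times> {a..b}" and g = ?g]) (auto split: if_splits)
qed

lemma f_mult_Q:
  assumes y: "y \<noteq> 0"
  shows "f y = cterm y (n + 4) (- n) * f (Q * y) + (\<Sum>t\<in>{0..n + 3}. U t y) - (\<Sum>t\<in>{-n..-1}. V t y)"
proof -
  let ?l = "n + 4" and ?k = "- n"
  have "((\<lambda>p. cterm y ?l ?k * (case p of (r, s) \<Rightarrow> sgw r s * cterm (Q * y) r s)) has_sum cterm y ?l ?k * f (Q * y)) UNIV"
    by (intro has_sum_cmult_right has_sum_f) (use y bases in simp)
  also have "(\<lambda>p. cterm y ?l ?k * (case p of (r, s) \<Rightarrow> sgw r s * cterm (Q * y) r s)) =
     (\<lambda>p. (\<lambda>(r, s). sgw (r - ?l) (s - ?k) * cterm y r s) ((\<lambda>(r, s). (r + ?l, s + ?k)) p))"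
    by (auto simp: fun_eq_iff cterm_add[OF y, simplified])
  finally have 1: "((\<lambda>(r, s). sgw (r - ?l) (s - ?k) * cterm y r s) has_sum cterm y ?l ?k * f (Q * y)) UNIV"
    by (subst (asm) has_sum_reindex_bij_betw[of "\<lambda>(r, s). (r + ?l, s + ?k)" UNIV UNIV])
       (auto intro!: bij_betwI[of _ _ _ "\<lambda>(r, s). (r - ?l, s - ?k)"])
  have "((\<lambda>p. (case p of (r, s) \<Rightarrow> sgw (r - ?l) (s - ?k) * cterm y r s) +
      (case p of (r, s) \<Rightarrow> (if r \<in> {0..n + 3} then 1 else 0) * cterm y r s) +
      (case p of (r, s) \<Rightarrow> - ((if s \<in> {-n..-1} then 1 else 0) * cterm y r s))) has_sum
      (cterm y ?l ?k * f (Q * y) + (\<Sum>t\<in>{0..n + 3}. U t y) + - (\<Sum>t\<in>{-n..-1}. V t y))) UNIV"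
    using has_sum_strip(2)[OF y, of "- n" "- 1", THEN has_sum_uminusI]
    by (intro has_sum_add 1 has_sum_strip y) (simp add: case_prod_unfold)
  also have "(\<lambda>p. (case p of (r, s) \<Rightarrow> sgw (r - ?l) (s - ?k) * cterm y r s) +
      (case p of (r, s) \<Rightarrow> (if r \<in> {0..n + 3} then 1 else 0) * cterm y r s) +
      (case p of (r, s) \<Rightarrow> - ((if s \<in> {-n..-1} then 1 else 0) * cterm y r s))) = (\<lambda>(r, s). sgw r s * cterm y r s)"
  proof (rule ext, clarify)
    fix r s
    \<comment> \<open>Replacing \<open>r\<close> by \<open>r - (n + 4)\<close> lowers the mean of
      the signs by 1 exactly for \<open>r\<close> in \<open>0..n + 3\<close>; replacing
      \<open>s\<close> by \<open>s + n\<close> raises it by 1 exactly for \<open>s\<close> in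
      \<open>-n..-1\<close>.\<close>
    have e: "sgw (r - ?l) (s - ?k) + (if r \<in> {0..n + 3} then 1 else 0) - (if s \<in> {-n..-1} then 1 else 0) = sgw r s"
      using n_pos by (auto simp: sgw_def sg_def)
    show "sgw (r - ?l) (s - ?k) * cterm y r s + (if r \<in> {0..n + 3} then 1 else 0) * cterm y r s +
        - ((if s \<in> {-n..-1} then 1 else 0) * cterm y r s) = sgw r s * cterm y r s"
      unfolding e[symmetric] by (simp only: left_diff_distrib distrib_right add_uminus_conv_diff)
  qed
  finally show ?thesis using has_sum_f[OF y] has_sum_unique by fastforce
qed

lemma analytic_f:
  assumes y: "y \<noteq> 0"
  shows "f analytic_on {y}"
proof -
  obtain a b :: real where ab: "0 < a" "0 < b"
    "eventually (\<lambda>w. \<forall>k::int. norm w powi k \<le> a powi k + b powi k) (nhds y)"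
    using eventually_powi_bounds[where g = "\<lambda>w. w" and z = y] y by auto
  have nz: "eventually (\<lambda>w. w \<noteq> 0) (nhds y)"
    using y by (intro t1_space_nhds) auto
  let ?p = "norm (q powi n)"
  define M where "M = (\<lambda>(r, s). norm (theta_term (q powi n) x r) * (?p powi tri s * (a powi s + b powi s)))"
  have "(\<lambda>w. infsum (\<lambda>p. (case p of (r, s) \<Rightarrow> sgw r s * cterm w r s)) UNIV) analytic_on {y}"
  proof (rule analytic_at_infsum)
    have "(\<lambda>k. ?p powi tri k * a powi k + ?p powi tri k * b powi k) summable_on UNIV"
      using bases ab by (intro summable_on_add summable_on_gauss) auto
    hence "(\<lambda>k. ?p powi tri k * (a powi k + b powi k)) summable_on UNIV"
      by (simp add: distrib_left)
    hence "M summable_on UNIV \<times> UNIV"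
      unfolding M_def using summable_norm_theta_term[OF bases(1,2) x] ab
      by (intro summable_on_product) auto
    thus "M summable_on UNIV" by simp
    show "eventually (\<lambda>w. \<forall>p\<in>UNIV. norm (case p of (r, s) \<Rightarrow> sgw r s * cterm w r s) \<le> M p) (nhds y)"
      using ab(3) nz
    proof eventually_elim
      case (elim w)
      show ?case
      proof (clarify, goal_cases)
        case (1 r s)
        have "norm (sgw r s * cterm w r s) \<le> norm (theta_term (q powi n) x r) * norm (theta_term (q powi n) w s)"
          by (rule norm_sgw_cterm_le) (use elim in simp)
        also have "\<dots> \<le> M (r, s)"
          unfolding M_def using elim ab by (auto simp: norm_theta_term intro!: mult_left_mono)
        finally show ?case .
      qed
    qed
    show "eventually (\<lambda>w. \<forall>p\<in>UNIV. (\<lambda>w. case p of (r, s) \<Rightarrow> sgw r s * cterm w r s) field_differentiable at w) (nhds y)"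
      using nz unfolding cterm_def
      by eventually_elim (auto intro!: field_differentiable_mult field_differentiable_const field_differentiable_powi)
  qed
  moreover have ev: "eventually (\<lambda>w. infsum (\<lambda>p. (case p of (r, s) \<Rightarrow> sgw r s * cterm w r s)) UNIV = f w) (nhds y)"
    using nz by eventually_elim (use has_sum_f in \<open>auto simp: infsumI\<close>)
  ultimately show ?thesis using analytic_at_cong[OF ev refl] by simp
qed

definition E0 :: "complex \<Rightarrow> complex" where
  "E0 y = jtheta (w y) P * f y + w y * A y - B y"

text \<open>The rows and columns left by \<open>f_mult_Q\<close> are those left by
  \<open>B_mult_Q\<close> and \<open>A_mult_Q\<close>. The fact \<open>k\<close> shows that
  \<open>jtheta (w y) P * f y\<close> has the same multiplier as the other two parts.\<close>

lemma E0_mult_Q: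
  assumes "regular y" and X: "\<And>k::int. Q powi k * (1 / X) \<noteq> 1"
  shows "E0 (Q * y) = Q powi (h + 1) / X * E0 y"
proof -
  have y: "y \<noteq> 0" using assms by (simp add: regular_def)
  let ?\<kappa> = "cterm y (n + 4) (- n)" and ?C = "Q powi (h + 1) / X" and ?j = "jtheta (w y) P"
  define m where "m = monomial x y q"
  note m = monomial_rules[OF x y q(2) m_def] and eq = monomial_eqI[OF m_def]
  have k: "?C * ?\<kappa> = - (1 / w y)"
    unfolding cterm_def Q_def X_def w_def tri_n
    by (simp only: m, rule eq) (simp_all add: n_def algebra_simps)
  have "jtheta (w (Q * y)) P = - ?j / w y"
    unfolding w_mult_Q by (rule jtheta_mult_base) (use bases w_nz y in auto)
  also have "\<dots> = ?j * (?C * ?\<kappa>)" unfolding k by simp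
  finally have "jtheta (w (Q * y)) P * f (Q * y) = ?C * (?j * (?\<kappa> * f (Q * y)))" by simp
  moreover have "?\<kappa> * f (Q * y) = f y - (\<Sum>t\<in>{0..n + 3}. U t y) + (\<Sum>t\<in>{-n..-1}. V t y)"
    unfolding f_mult_Q[OF y] by simp
  ultimately have "E0 (Q * y) = ?C * (?j * (f y - (\<Sum>t\<in>{0..n + 3}. U t y) + (\<Sum>t\<in>{-n..-1}. V t y)))
     + ?C * (w y * A y - ?j * (\<Sum>t\<in>{-n..-1}. V t y)) - ?C * (B y - ?j * (\<Sum>t\<in>{0..n + 3}. U t y))"
    unfolding E0_def B_mult_Q[OF assms(1)] A_mult_Q[OF y X] by (simp only:)
  also have "\<dots> = ?C * E0 y"
    unfolding E0_def by (simp only: algebra_simps)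
  finally show ?thesis .
qed

end


section \<open>Cancellation of the poles\<close>

text \<open>The cofactor in \<open>jtheta_factor\<close> consists of single infinite products, so
  analyticity has to come from the product and not from the theta series.\<close>

lemma qpoch_inf_holomorphic:
  assumes "norm q < 1"
  shows "(\<lambda>x. qpoch_inf x q) holomorphic_on UNIV"
proof (rule holomorphic_uniform_sequence[where f = "\<lambda>N x. \<Prod>i<N. 1 - x * q ^ i"])
  show "(\<lambda>x. \<Prod>i<N. 1 - x * q ^ i) holomorphic_on UNIV" for N
    by (intro holomorphic_intros)
  fix z :: complex
  have "uniformly_convergent_on (cball z 1) (\<lambda>N x. \<Sum>i<N. norm (1 - x * q ^ i - 1))"
  proof (rule Weierstrass_m_test')
    show "summable (\<lambda>i. (norm z + 1) * norm q ^ i)"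
      using assms by (intro summable_mult summable_geometric) auto
    fix i and x assume "x \<in> cball z 1"
    hence "norm (x - z) \<le> 1" by (simp add: dist_norm norm_minus_commute)
    hence "norm x \<le> norm z + 1"
      using norm_triangle_ineq2[of x z] by linarith
    thus "norm (norm (1 - x * q ^ i - 1)) \<le> (norm z + 1) * norm q ^ i"
      by (simp add: norm_mult norm_power mult_right_mono)
  qed
  hence "uniformly_convergent_on (cball z 1) (\<lambda>N x. \<Prod>i<N. 1 - x * q ^ i)"
    by (intro uniformly_convergent_on_prod') (auto intro!: continuous_intros)
  hence "uniform_limit (cball z 1) (\<lambda>N x. \<Prod>i<N. 1 - x * q ^ i) (\<lambda>x. lim (\<lambda>N. \<Prod>i<N. 1 - x * q ^ i)) sequentially"
    by (simp add: uniformly_convergent_uniform_limit_iff)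
  moreover have "lim (\<lambda>N. \<Prod>i<N. 1 - x * q ^ i) = qpoch_inf x q" for x
    using qpoch_inf_LIMSEQ[OF assms] by (rule limI)
  ultimately have "uniform_limit (cball z 1) (\<lambda>N x. \<Prod>i<N. 1 - x * q ^ i) (\<lambda>x. qpoch_inf x q) sequentially"
    by simp
  thus "\<exists>d>0. cball z d \<subseteq> UNIV \<and> uniform_limit (cball z d) (\<lambda>N x. \<Prod>i<N. 1 - x * q ^ i) (\<lambda>x. qpoch_inf x q) sequentially"
    by (intro exI[of _ 1]) auto
qed auto

lemma analytic_at_qpoch_inf:
  assumes "norm q < 1" "g analytic_on {z}"
  shows "(\<lambda>z. qpoch_inf (g z) q) analytic_on {z}"
proof -
  have "(\<lambda>x. qpoch_inf x q) analytic_on {g z}"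
    unfolding analytic_at using qpoch_inf_holomorphic[OF assms(1)] by (intro exI[of _ UNIV]) auto
  thus ?thesis using analytic_on_compose[of g "{z}" "\<lambda>x. qpoch_inf x q"] assms(2) by (simp add: o_def)
qed

text \<open>This isolates the simple zero at \<open>q powi k\<close>. The cofactor is analytic there
  and takes the value
  \<open>(-1) powi (k + 1) * q powi (- tri k) * qpoch_inf q q ^ 3\<close>.\<close>

lemma jtheta_factor:
  assumes "norm q < 1" "q \<noteq> 0" "z \<noteq> 0"
  shows "jtheta z q = (1 - q powi k * (1 / z)) * ((-1) powi (k + 1) * q powi (- tri k) * (z / q powi k) powi (1 - k) *
     (qpoch_inf (q * (z / q powi k)) q * qpoch_inf (q / (z / q powi k)) q * qpoch_inf q q))"
proof -
  define u where "u = z / q powi k"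
  have u: "u \<noteq> 0" "z = q powi k * u" "q powi k * (1 / z) = 1 / u" using assms by (auto simp: u_def)
  have "jtheta u q = - (u * jtheta (1 / u) q)"
    using jtheta_inverse[OF assms(1,2) u(1)] u(1) by simp
  also have "jtheta (1 / u) q = (1 - 1 / u) * qpoch_inf (q / u) q * qpoch_inf (q * u) q * qpoch_inf q q"
    unfolding jtheta_def using qpoch_inf_unfold[OF assms(1), of "1 / u"] by (simp add: mult.commute)
  finally have "jtheta z q = (-1) powi k * q powi (- tri k) * u powi (- k) *
     - (u * ((1 - 1 / u) * qpoch_inf (q / u) q * qpoch_inf (q * u) q * qpoch_inf q q))"
    using jtheta_shift[OF assms(1,2) u(1), of k] u(2) by simp
  moreover have "u powi (1 - k) = u * u powi (- k)" "(-1 :: complex) powi (k + 1) = - ((-1) powi k)"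
    using u(1) power_int_add[of u 1 "- k"] by (simp_all add: power_int_add)
  ultimately show ?thesis unfolding u_def[symmetric] u(3) by (simp add: mult_ac)
qed

lemma removable_quotient:
  assumes N: "N analytic_on {z}" "N z = 0" and D: "D analytic_on {z}" "D z = 0" "deriv D z \<noteq> 0"
  shows "\<exists>g. g analytic_on {z} \<and> eventually (\<lambda>w. N w / D w = g w) (at z)"
proof -
  have iso: "isolated_singularity_at (\<lambda>w. N w / D w) z"
    by (intro isolated_singularity_at_divide isolated_singularity_at_analytic not_essential_analytic N D)
  have "(N has_field_derivative deriv N z) (at z)" "(D has_field_derivative deriv D z) (at z)"
    using N(1) D(1) analytic_derivI by blast+
  hence "((\<lambda>w. (N w - N z) / (w - z)) \<longlongrightarrow> deriv N z) (at z)" "((\<lambda>w. (D w - D z) / (w - z)) \<longlongrightarrow> deriv D z) (at z)"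
    by (simp_all add: has_field_derivative_iff)
  hence "((\<lambda>w. ((N w - N z) / (w - z)) / ((D w - D z) / (w - z))) \<longlongrightarrow> deriv N z / deriv D z) (at z)"
    using D(3) by (rule tendsto_divide)
  moreover have "eventually (\<lambda>w. ((N w - N z) / (w - z)) / ((D w - D z) / (w - z)) = N w / D w) (at z)"
    using eventually_neq_at_within[of z] by eventually_elim (auto simp: N D)
  ultimately have "(\<lambda>w. N w / D w) \<midarrow>z\<rightarrow> deriv N z / deriv D z"
    by (rule Lim_transform_eventually)
  from remove_sings_analytic_at[OF iso this] eventually_remove_sings_eq_at[OF iso]
  show ?thesis by (intro exI[of _ "remove_sings (\<lambda>w. N w / D w)"]) (auto elim: eventually_mono)
qed

lemma minus_one_powi_uminus: "(-1 :: complex) powi (- k) = (-1) powi k"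
  by (auto simp: power_int_minus_left)

lemma W_shift_both_powi:
  assumes "norm \<rho> < 1" "\<rho> \<noteq> 0" "x \<noteq> 0" "y \<noteq> 0" and W: "W = W1 \<rho> \<or> W = W2 \<rho>"
  shows "W (\<rho> powi k * x) (\<rho> powi k * y) = W x y * (\<rho> powi (- 2 * k - 10 * tri k) * (x * y) powi (- 5 * k))"
proof -
  have sh: "W (\<rho> * x) (\<rho> * y) = W x y / (\<rho>\<^sup>2 * (x * y) ^ 5)" if "x \<noteq> 0" "y \<noteq> 0" for x y
    using W W_shift_both[OF assms(1,2) that] by auto
  define F where "F = (\<lambda>k. W (\<rho> powi k * x) (\<rho> powi k * y) = W x y * (\<rho> powi (- 2 * k - 10 * tri k) * (x * y) powi (- 5 * k)))"
  have step: "F k \<longleftrightarrow> F (k + 1)" for k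
  proof -
    let ?d = "\<rho>\<^sup>2 * ((\<rho> powi k * x) * (\<rho> powi k * y)) ^ 5"
    have d: "?d \<noteq> 0" using assms by simp
    have "W (\<rho> powi (k + 1) * x) (\<rho> powi (k + 1) * y) = W (\<rho> powi k * x) (\<rho> powi k * y) / ?d"
      using sh[of "\<rho> powi k * x" "\<rho> powi k * y"] assms by (simp add: power_int_add mult_ac)
    moreover have "\<rho> powi (- 2 * (k + 1) - 10 * tri (k + 1)) * (x * y) powi (- 5 * (k + 1)) =
       \<rho> powi (- 2 * k - 10 * tri k) * (x * y) powi (- 5 * k) / ?d"
    proof -
      define m where "m = monomial x y \<rho>"
      note m = monomial_rules[OF assms(3,4,2) m_def] and eq = monomial_eqI[OF m_def]
      show ?thesis unfolding tri_Suc by (simp only: m, rule eq) (simp_all add: algebra_simps)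
    qed
    ultimately show ?thesis unfolding F_def using d by simp
  qed
  have "F k"
  proof (induction k rule: int_induct[of _ 0])
    case base
    show ?case by (simp add: F_def)
  next
    case (step1 i)
    thus ?case using step by blast
  next
    case (step2 i)
    thus ?case using step[of "i - 1"] by simp
  qed
  thus ?thesis by (simp add: F_def)
qed

section \<open>The theta quotient as a function of \<open>y\<close>\<close>

context hecke_sums
begin

definition \<rho> :: complex where "\<rho> = q powi (2 * n + 4)"

text \<open>\<open>n + 4\<close> is odd, so \<open>q\<close> to the power \<open>(n + 4) / 2\<close>
  requires the choice of a root; only \<open>sq\<^sup>2\<close> and \<open>sq \<noteq> 0\<close>
  matter later.\<close>

definition sq :: complex where "sq = csqrt (q powi (n + 4))"

text \<open>By \<open>Theta4_eq\<close>, \<open>M y / jtheta (Y y) Q\<close> is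
  \<open>jtheta (w y) P * Theta4 n x y q\<close>. In \<open>q\<^sup>2 / sq\<close> one
  \<open>q\<close> stands in front of \<open>S2\<close> in \<open>Theta4\<close>, the rest is the
  factor from \<open>S1_S2_eq\<close>.\<close>

definition M :: "complex \<Rightarrow> complex" where
  "M y = q powi (- (n\<^sup>2 + n - 3)) * x powi (1 - h) * y powi (h + 1) / jtheta X Q *
     (J2 (4 * n) (16 * n) q * W1 \<rho> (sq * x) (sq * y) - q\<^sup>2 / sq * J2 (8 * n) (16 * n) q * W2 \<rho> (sq * x) (sq * y))"

definition E :: "complex \<Rightarrow> complex" where "E y = E0 y + M y / jtheta (Y y) Q"

lemma rho: "norm \<rho> < 1" "\<rho> \<noteq> 0" "\<rho> ^ 4 = Q"
proof -
  show "norm \<rho> < 1" unfolding \<rho>_def using n_pos by (intro norm_powi_less_1) simp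
  show "\<rho> \<noteq> 0" using q by (simp add: \<rho>_def)
  show "\<rho> ^ 4 = Q" unfolding \<rho>_def Q_def using power_int_mult[of q "2 * n + 4" 4] by simp
qed

lemma sq: "sq\<^sup>2 = q powi (n + 4)" "sq \<noteq> 0"
  using q by (simp_all add: sq_def)

lemma sq4: "sq ^ 4 = q powi (2 * n + 8)"
proof -
  have "sq ^ 4 = (sq\<^sup>2)\<^sup>2" by simp
  also have "\<dots> = q powi (2 * n + 8)"
    unfolding sq using power_int_mult[of q "n + 4" 2] by (simp add: mult.commute)
  finally show ?thesis .
qed

lemma sq_X: "- ((sq * x) ^ 4) = X" and sq_Y: "- ((sq * y) ^ 4) = Y y"
  by (simp_all add: power_mult_distrib sq4 X_def Y_def)

text \<open>\<open>?K\<close> is \<open>- X\<close> times the monomial by which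
  \<open>jtheta (Y y) Q\<close> is divided, so the theta functions contribute just
  \<open>1 / X\<close>; the power of \<open>y\<close> in \<open>M\<close> contributes
  \<open>Q powi (h + 1)\<close>.\<close>

lemma M_mult_Q:
  assumes y: "y \<noteq> 0"
  shows "M (Q * y) / jtheta (Y (Q * y)) Q = Q powi (h + 1) / X * (M y / jtheta (Y y) Q)"
proof -
  let ?K = "(sq * x) ^ 4 * (sq * y) ^ 16 * \<rho> ^ 24"
  have e: "sq * (Q * y) = \<rho> ^ 4 * (sq * y)" by (simp add: rho(3))
  have W: "W1 \<rho> (sq * x) (sq * (Q * y)) = - W1 \<rho> (sq * x) (sq * y) / ?K"
    "W2 \<rho> (sq * x) (sq * (Q * y)) = - W2 \<rho> (sq * x) (sq * y) / ?K"
    unfolding e by (rule W_shift_snd[OF rho(1,2)]; use sq(2) x y in simp)+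
  have mM: "M (Q * y) = Q powi (h + 1) * (- 1 / ?K) * M y"
  proof -
    have "a * b * (c * d) / j * (e * (- w1 / K) - g * (- w2 / K)) = c * (- 1 / K) * (a * b * d / j * (e * w1 - g * w2))"
      for a b c d e g j K w1 w2 :: complex by (simp add: divide_inverse algebra_simps)
    thus ?thesis unfolding M_def W power_int_mult_distrib .
  qed
  have mj: "jtheta (Y (Q * y)) Q = jtheta (Y y) Q / (Q ^ 6 * Y y ^ 4)"
    unfolding Y_mult_Q using jtheta_shift[OF bases(3,4) Y_nz[OF y], of 4]
    by (simp add: power_int_minus field_simps)
  have mK: "?K = - X * (Q ^ 6 * Y y ^ 4)"
  proof -
    have 1: "?K = (sq * x) ^ 4 * ((sq * y) ^ 4) ^ 4 * (\<rho> ^ 4) ^ 6" by (simp flip: power_mult)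
    have 2: "(sq * x) ^ 4 = - X" "(sq * y) ^ 4 = - Y y" using sq_X sq_Y[of y] by (metis minus_minus)+
    have "(sq * x) ^ 4 * ((sq * y) ^ 4) ^ 4 * (\<rho> ^ 4) ^ 6 = - X * (Q ^ 6 * Y y ^ 4)"
      unfolding 2 rho(3) by simp
    thus ?thesis unfolding 1 .
  qed
  show ?thesis
    unfolding mM mj mK using bases(4) Y_nz[OF y] X_nz by simp
qed

text \<open>The factor in front of \<open>U (- h - k) y\<close> is the cofactor of
  \<open>jtheta_factor\<close> at the zero, and \<open>U (- h - k) y\<close> is the numerator that
  \<open>beta_at_pole\<close> finds in the singular summand. This is what makes the singular parts
  cancel.\<close>

lemma M_at_pole:
  assumes y: "y \<noteq> 0" and Y: "Y y = Q powi k" and X: "jtheta X Q \<noteq> 0"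
  shows "M y = (-1) powi (k + 1) * Q powi (- tri k) * qpoch_inf Q Q ^ 3 * U (- h - k) y"
proof -
  define m where "m = monomial x y q"
  note m = monomial_rules[OF x y q(2) m_def] and eq = monomial_eqI[OF m_def]
  \<comment> \<open>Scaling by \<open>\<rho> powi (- k)\<close> turns the pole condition into
    \<open>y' ^ 4 = -1\<close>, where \<open>W_at_eighth_root\<close> applies.\<close>
  define x' y' where "x' = \<rho> powi (- k) * (sq * x)" and "y' = \<rho> powi (- k) * (sq * y)"
  have x'0: "x' \<noteq> 0" and y'0: "y' \<noteq> 0" using rho sq x y by (auto simp: x'_def y'_def)
  have r4: "(\<rho> powi (- k)) ^ 4 = Q powi (- k)"
    using power_power_int[of \<rho> 4 "- k"] by (simp add: rho(3))
  have y'4: "y' ^ 4 = -1"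
  proof -
    have "(sq * y) ^ 4 = - (Q powi k)" using sq_Y[of y] Y by (metis minus_minus)
    moreover have "y' ^ 4 = (\<rho> powi (- k)) ^ 4 * (sq * y) ^ 4" unfolding y'_def by (rule power_mult_distrib)
    ultimately show ?thesis unfolding r4 using bases(4) by (simp add: power_int_minus)
  qed
  have x'4: "- (x' ^ 4) = Q powi (- k) * X"
  proof -
    have "x' ^ 4 = (\<rho> powi (- k)) ^ 4 * (sq * x) ^ 4" unfolding x'_def by (rule power_mult_distrib)
    thus ?thesis unfolding r4 sq_X[symmetric] by simp
  qed
  define v where "v = y'\<^sup>2"
  have vv: "v\<^sup>2 = -1" using y'4 by (simp add: v_def flip: power_mult)
  define J where "J = qpoch_inf Q Q ^ 3"
  define G where "G = (-1) powi k * Q powi (- tri (- k)) * X powi k * (\<rho> powi (- 2 * k - 10 * tri k) * (x' * y') powi (- 5 * k))"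
  have sx: "sq * x = \<rho> powi k * x'" "sq * y = \<rho> powi k * y'"
    using rho by (simp_all add: x'_def y'_def power_int_minus)
  have jX: "jtheta (Q powi (- k) * X) Q = (-1) powi k * Q powi (- tri (- k)) * X powi k * jtheta X Q"
    using jtheta_shift[OF bases(3,4) X_nz, of "- k"] unfolding minus_one_powi_uminus by simp
  have yx: "y' / x' = y / x" using rho sq by (simp add: x'_def y'_def)
  have W1: "W1 \<rho> (sq * x) (sq * y) = - ((1 + v) * (y / x) * J * G * jtheta X Q)"
    unfolding sx W_shift_both_powi[OF rho(1,2) x'0 y'0 disjI1[OF refl]]
      W_at_eighth_root(1)[OF rho(1,2) x'0 y'4] x'4 rho(3) jX yx
    unfolding G_def J_def v_def by (simp only: mult_minus_left mult_minus_right mult_ac)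
  have W2: "W2 \<rho> (sq * x) (sq * y) = - (y' * (y / x) * J * G * jtheta X Q)"
    unfolding sx W_shift_both_powi[OF rho(1,2) x'0 y'0 disjI2[OF refl]]
      W_at_eighth_root(2)[OF rho(1,2) x'0 y'4] x'4 rho(3) jX yx
    unfolding G_def J_def by (simp only: mult_minus_left mult_minus_right mult_ac)
  define a where "a = q\<^sup>2 * \<rho> powi (- k) * y"
  have ay: "q\<^sup>2 / sq * y' = a" using sq by (simp add: a_def y'_def)
  \<comment> \<open>The theta argument of \<open>U (- h - k) y\<close>, reduced by a power of its
    base \<open>q powi n\<close> so that \<open>c'\<^sup>2 = v * q powi n\<close> and
    \<open>jtheta_eighth_root\<close> applies.\<close>
  define c' where "c' = q powi (n + 2) * \<rho> powi (- k) * y"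
  have c'0: "c' \<noteq> 0" using q rho y by (simp add: c'_def)
  have v_mon: "v = q powi (n + 4) * (\<rho> powi (- k) * y)\<^sup>2"
    unfolding v_def y'_def using sq(1) by (simp add: power_mult_distrib)
  have c'2: "c'\<^sup>2 = v * q powi n" and ac: "a * c' = v"
    unfolding v_mon c'_def a_def \<rho>_def by (simp only: m, rule eq, simp_all add: algebra_simps)+
  \<comment> \<open>Now \<open>a\<close> can be taken out of both the \<open>W1\<close> and the
    \<open>W2\<close> contribution, and what remains are the even and odd parts of
    \<open>jtheta c' (q powi n)\<close>.\<close>
  have v1: "1 + v = a * (c' * (1 - v))"
    using vv unfolding mult.assoc[symmetric] ac by (simp add: algebra_simps power2_eq_square)
  have J8: "J2 (8 * n) (16 * n) q = jtheta ((q powi n) ^ 8) ((q powi n) ^ 16)"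
    and J4: "J2 (4 * n) (16 * n) q = jtheta ((q powi n) ^ 4) ((q powi n) ^ 16)"
    unfolding J2_def by (simp_all add: power_int_mult mult.commute[of _ n])
  have jc: "jtheta c' (q powi n) = J2 (8 * n) (16 * n) q - c' * (1 - v) * J2 (4 * n) (16 * n) q"
    unfolding J8 J4 by (rule jtheta_eighth_root[OF bases(1,2) vv c'2])
  have "q powi ((n + 4) * (- h - k)) * y = (q powi n) powi (k - h - 3) * c'"
    unfolding c'_def \<rho>_def by (simp only: m, rule eq) (simp_all add: n_def algebra_simps)
  hence jU: "jtheta (q powi ((n + 4) * (- h - k)) * y) (q powi n) =
    (-1) powi (k - h - 3) * (q powi n) powi (- tri (k - h - 3)) * c' powi (- (k - h - 3)) * jtheta c' (q powi n)"
    using jtheta_shift[OF bases(1,2) c'0] by simp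
  \<comment> \<open>By \<open>y' ^ 4 = -1\<close> only \<open>y' powi (- k)\<close> survives.
    Together with \<open>x' powi (- 5 * k)\<close> it gives \<open>sq\<close> the even exponent
    \<open>- 6 * k\<close>, so that \<open>G\<close> becomes a monomial in \<open>x\<close>,
    \<open>y\<close> and \<open>q\<close>.\<close>
  have G: "G = (-1) powi k * Q powi (- tri (- k)) * X powi k * (\<rho> powi (- 2 * k - 10 * tri k) *
     ((-1) powi k * (\<rho> powi (- k)) powi (- 6 * k) * (q powi (n + 4)) powi (- 3 * k) * x powi (- 5 * k) * y powi (- k)))"
  proof -
    have "y' powi (- 5 * k) = (y' ^ 4) powi (- k) * y' powi (- k)"
    proof -
      have "y' powi (- 5 * k) = y' powi (4 * (- k) + - k)" by simp
      also have "\<dots> = (y' ^ 4) powi (- k) * y' powi (- k)"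
        unfolding power_int_add[OF disjI1[OF y'0]] power_int_mult[of y' 4 "- k"] by simp
      finally show ?thesis .
    qed
    hence "(x' * y') powi (- 5 * k) = (-1) powi (- k) * (x' powi (- 5 * k) * y' powi (- k))"
      unfolding power_int_mult_distrib y'4 by simp
    also note minus_one_powi_uminus
    also have "x' powi (- 5 * k) * y' powi (- k) = (\<rho> powi (- k)) powi (- 6 * k) * (sq\<^sup>2) powi (- 3 * k) * x powi (- 5 * k) * y powi (- k)"
    proof -
      have 1: "sq powi (- 5 * k) * sq powi (- k) = (sq\<^sup>2) powi (- 3 * k)"
        using sq(2) power_int_add[of sq "- 5 * k" "- k"] power_power_int[of sq 2 "- 3 * k"] power_int_mult[of sq "- 3 * k" 2]
        by (simp add: mult.commute)
      have 2: "(\<rho> powi (- k)) powi (- 5 * k) * (\<rho> powi (- k)) powi (- k) = (\<rho> powi (- k)) powi (- 6 * k)"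
        using rho(2) power_int_add[of "\<rho> powi (- k)" "- 5 * k" "- k"] by simp
      have "(r5 * (s5 * x5)) * (r1 * (s1 * y1)) = (r5 * r1) * (s5 * s1) * x5 * y1" for r5 s5 x5 r1 s1 y1 :: complex
        by (simp add: mult_ac)
      thus ?thesis
        unfolding x'_def y'_def power_int_mult_distrib 1[symmetric] 2[symmetric] .
    qed
    finally show ?thesis unfolding G_def sq(1) by (simp only: mult.assoc)
  qed
  have mon: "q powi (- (n\<^sup>2 + n - 3)) * x powi (1 - h) * y powi (h + 1) * (y / x) * G * a =
     (-1) powi (k + 1) * Q powi (- tri k) * ((- x) powi (- h - k) * q powi (n * tri (- h - k)) *
      ((-1) powi (k - h - 3) * (q powi n) powi (- tri (k - h - 3)) * c' powi (- (k - h - 3))))"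
  proof -
    have t1: "tri (- h - k) = tri h + h + tri k + k + h * k"
      using tri_add[of "- h" "- k"] by (simp add: tri_uminus)
    have t2: "tri (k - h - 3) = tri h + h + tri k + 6 + 3 * h - 3 * k - h * k"
    proof -
      have "tri (k + - h + - 3) = tri (k + - h) + tri (- 3) + (k + - h) * (- 3)" by (rule tri_add)
      moreover have "tri (k + - h) = tri k + tri (- h) + k * - h" by (rule tri_add)
      moreover have "tri (- 3) = 6" by (simp add: tri_def)
      ultimately show ?thesis by (simp add: tri_uminus algebra_simps)
    qed
    have t3: "tri (- k) = tri k + k" by (rule tri_uminus)
    \<comment> \<open>The exponents contain both \<open>k * k\<close> and \<open>tri k\<close>;
      expressing the former by the latter makes the two sides comparable.\<close>
    have kk: "k * k = k + 2 * tri k" unfolding two_tri by (simp add: algebra_simps)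
    have kk': "k * (k * z) = (k + 2 * tri k) * z" for z using kk by (simp flip: mult.assoc)
    show ?thesis
      unfolding G a_def c'_def X_def \<rho>_def Q_def t1 t2 t3
    proof (simp only: m, rule eq, goal_cases)
      case 4
      show ?case unfolding n_def by (simp add: algebra_simps power2_eq_square kk kk')
    qed (simp_all add: n_def algebra_simps)
  qed
  have "M y = q powi (- (n\<^sup>2 + n - 3)) * x powi (1 - h) * y powi (h + 1) / jtheta X Q *
     (J2 (4 * n) (16 * n) q * - ((1 + v) * (y / x) * J * G * jtheta X Q) - 
       J2 (8 * n) (16 * n) q * - ((q\<^sup>2 / sq * y') * (y / x) * J * G * jtheta X Q))"
    unfolding M_def W1 W2 by simp
  also have "\<dots> = (q powi (- (n\<^sup>2 + n - 3)) * x powi (1 - h) * y powi (h + 1) * (y / x) * G * a) * J * jtheta c' (q powi n)"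
  proof -
    have "A * B * C / Z * (j4 * - (a * (c * d) * u * J * G * Z) - j8 * - (a * u * J * G * Z)) =
        (A * B * C * u * G * a) * J * (j8 - c * d * j4)" if "Z \<noteq> 0" for A B C Z j4 j8 a c d u J G :: complex
      using that by (simp add: field_simps)
    from this[OF X] show ?thesis unfolding ay v1 jc .
  qed
  also have "\<dots> = (-1) powi (k + 1) * Q powi (- tri k) * qpoch_inf Q Q ^ 3 * U (- h - k) y"
    unfolding mon U_def jU J_def by (simp only: mult_ac)
  finally show ?thesis .
qed

end


section \<open>Analyticity in \<open>y\<close> and removal of the poles\<close>

lemma analytic_at_powi:
  assumes "g analytic_on {z}" "g z \<noteq> 0"
  shows "(\<lambda>z. g z powi k) analytic_on {z :: complex}"
  using assms by (cases "k \<ge> 0") (auto simp: power_int_def intro!: analytic_intros)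

context hecke_sums
begin

lemma analytic_basic:
  assumes y: "y \<noteq> 0"
  shows "w analytic_on {y}" "Y analytic_on {y}" "(\<lambda>y. 1 / Y y) analytic_on {y}" "(\<lambda>y. 1 / w y) analytic_on {y}"
    "U t analytic_on {y}" "V t analytic_on {y}"
proof -
  show w: "w analytic_on {y}" and Y: "Y analytic_on {y}"
    unfolding w_def Y_def using x y by (auto intro!: analytic_intros analytic_at_powi)
  show "(\<lambda>y. 1 / Y y) analytic_on {y}" "(\<lambda>y. 1 / w y) analytic_on {y}"
    using y by (auto intro!: analytic_intros w Y Y_nz w_nz)
  show "U t analytic_on {y}" "V t analytic_on {y}"
    unfolding U_def V_def using y q by (auto intro!: analytic_intros analytic_at_powi analytic_at_jtheta_compose bases)
qed

lemma analytic_S: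
  assumes y: "y \<noteq> 0" and I: "\<And>r. r \<in> I \<Longrightarrow> Q powi (n * r - t - h) * (1 / Y y) \<noteq> 1"
  shows "(\<lambda>y. \<Sum>\<^sub>\<infinity>r\<in>I. theta_term P (w y) r / (1 - Q powi (n * r - t - h) * (1 / Y y))) analytic_on {y}"
  by (rule analytic_at_appell[OF bases(5,6,3,4), where e = "\<lambda>r. n * r - t - h"])
     (use y I analytic_basic Y_nz w_nz in auto)

lemma analytic_T:
  assumes y: "y \<noteq> 0" and I: "\<And>r. Q powi (n * r - t - h) * (1 / Y y) \<noteq> 1"
  shows "T t analytic_on {y}"
proof -
  have "S t analytic_on {y}" unfolding S_def by (rule analytic_S[OF y I])
  thus ?thesis unfolding T_def using analytic_basic(5)[OF y] by (intro analytic_intros)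
qed

lemma analytic_A:
  assumes y: "y \<noteq> 0" and X: "\<And>k::int. Q powi k * (1 / X) \<noteq> 1"
  shows "A analytic_on {y}"
proof -
  have "R t analytic_on {y}" for t
    unfolding R_def
    by (rule analytic_at_appell[OF bases(5,6,3,4), where c = "\<lambda>_. 1 / X" and e = "\<lambda>r. n * r - t - h"])
       (use y X X_nz analytic_basic w_nz in \<open>auto intro!: analytic_intros\<close>)
  thus ?thesis unfolding A_def using analytic_basic(6)[OF y] by (intro analytic_intros)
qed

lemma analytic_W:
  assumes y: "y \<noteq> 0"
  shows "(\<lambda>y. W1 \<rho> (sq * x) (sq * y)) analytic_on {y}" "(\<lambda>y. W2 \<rho> (sq * x) (sq * y)) analytic_on {y}"
proof -
  have n: "norm (\<rho> ^ k) < 1" "\<rho> ^ k \<noteq> 0" if "k > 0" for k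
    using rho that by (auto simp: norm_power power_less_one_iff)
  note nz = qpoch_inf_self_nonzero[OF n(1)]
  note j = analytic_at_jtheta_compose[OF n]
  show "(\<lambda>y. W1 \<rho> (sq * x) (sq * y)) analytic_on {y}"
    unfolding W1_def by (intro analytic_intros j) (use y x sq(2) rho(2) nz in auto)
  show "(\<lambda>y. W2 \<rho> (sq * x) (sq * y)) analytic_on {y}"
    unfolding W2_def by (intro analytic_intros j) (use y x sq(2) rho(2) nz in auto)
qed

lemma analytic_M:
  assumes y: "y \<noteq> 0" and X: "jtheta X Q \<noteq> 0"
  shows "M analytic_on {y}"
  unfolding M_def using y X sq(2) by (auto intro!: analytic_intros analytic_W analytic_at_powi)

lemma regular_iff:
  assumes "y \<noteq> 0"
  shows "regular y \<longleftrightarrow> jtheta (Y y) Q \<noteq> 0"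
proof -
  have "Q powi k * (1 / Y y) \<noteq> 1 \<longleftrightarrow> Y y \<noteq> Q powi k" for k
    using Y_nz[OF assms] by (auto simp: field_simps)
  thus ?thesis
    unfolding regular_def jtheta_eq_0_iff[OF bases(3,4) Y_nz[OF assms]] using assms by simp
qed

lemma X_regular:
  assumes "jtheta X Q \<noteq> 0"
  shows "Q powi k * (1 / X) \<noteq> 1"
proof -
  have "Q powi k * (1 / X) \<noteq> 1 \<longleftrightarrow> X \<noteq> Q powi k"
    using X_nz by (auto simp: field_simps)
  thus ?thesis using assms unfolding jtheta_eq_0_iff[OF bases(3,4) X_nz] by simp
qed

lemma analytic_E_regular:
  assumes "regular y" and X: "jtheta X Q \<noteq> 0"
  shows "E analytic_on {y}"
proof -
  have y: "y \<noteq> 0" using assms by (simp add: regular_def)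
  have "B analytic_on {y}"
    unfolding B_def using assms by (intro analytic_intros analytic_T) (auto simp: regular_def)
  hence "E0 analytic_on {y}"
    unfolding E0_def using analytic_f[OF y] analytic_A[OF y X_regular[OF X]] analytic_basic[OF y] w_nz[OF y]
    by (intro analytic_intros analytic_at_jtheta_compose bases)
  moreover have "(\<lambda>y. jtheta (Y y) Q) analytic_on {y}"
    by (intro analytic_at_jtheta_compose bases analytic_basic Y_nz y)
  ultimately show ?thesis
    unfolding E_def using analytic_M[OF y X] regular_iff[OF y] assms by (intro analytic_intros) auto
qed

text \<open>Denominators belonging to \<open>Q powi k \<noteq> Y y\<close> stay bounded away from 0
  near \<open>y\<close>. The other one can vanish at \<open>v\<close> only if
  \<open>v ^ 4 = y ^ 4\<close>, and near \<open>y\<close> this forces \<open>v = y\<close>.\<close>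

lemma eventually_regular:
  assumes y: "y \<noteq> 0"
  shows "eventually regular (at y)"
proof -
  let ?I = "{k. Q powi k * (1 / Y y) \<noteq> 1}"
  obtain \<delta> where \<delta>: "\<delta> > 0" "eventually (\<lambda>d. \<forall>k\<in>?I. norm (1 - Q powi k * d) \<ge> \<delta>) (nhds (1 / Y y))"
    by (rule eventually_geometric_away_from_1[OF bases(3,4), of "1 / Y y" ?I]) (use Y_nz[OF y] in auto)
  have "((\<lambda>y. 1 / Y y) \<longlongrightarrow> 1 / Y y) (nhds y)"
    using analytic_at_imp_isCont[OF analytic_basic(3)[OF y]] tendsto_at_iff_tendsto_nhds[of "\<lambda>y. 1 / Y y" y]
    by (simp add: isCont_def)
  hence "eventually (\<lambda>v. \<forall>k\<in>?I. norm (1 - Q powi k * (1 / Y v)) \<ge> \<delta>) (nhds y)"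
    by (rule eventually_compose_filterlim[OF \<delta>(2)])
  hence 1: "eventually (\<lambda>v. \<forall>k\<in>?I. norm (1 - Q powi k * (1 / Y v)) \<ge> \<delta>) (at y)"
    by (simp add: eventually_at_filter eventually_mono)
  have id: "((\<lambda>v. v) \<longlongrightarrow> y) (at y)" by (rule tendsto_ident_at)
  have "eventually (\<lambda>v. (v + y) * (v\<^sup>2 + y\<^sup>2) \<noteq> 0) (at y)"
    by (rule tendsto_imp_eventually_ne[where c = "(y + y) * (y\<^sup>2 + y\<^sup>2)"]) (intro tendsto_intros id, use y in simp)
  moreover have "eventually (\<lambda>v. v \<noteq> y) (at y)" by (rule eventually_neq_at_within)
  moreover have "eventually (\<lambda>v. v \<noteq> 0) (at y)" by (rule tendsto_imp_eventually_ne[OF id y])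
  ultimately show ?thesis using 1
  proof eventually_elim
    case (elim v)
    have "v ^ 4 - y ^ 4 = (v - y) * ((v + y) * (v\<^sup>2 + y\<^sup>2))" by (simp add: eval_nat_numeral algebra_simps)
    hence v4: "v ^ 4 \<noteq> y ^ 4" using elim by auto
    show ?case unfolding regular_def
    proof (intro conjI allI)
      fix k
      show "Q powi k * (1 / Y v) \<noteq> 1"
      proof (cases "k \<in> ?I")
        case True
        have "norm (1 - Q powi k * (1 / Y v)) > 0"
          using bspec[OF elim(4) True] \<delta>(1) by linarith
        thus ?thesis by fastforce
      next
        case False
        hence k: "Q powi k = Y y" using Y_nz[OF y] by simp
        show ?thesis
        proof
          assume "Q powi k * (1 / Y v) = 1"
          hence "Y y = Y v" unfolding k using Y_nz[OF elim(3)] by simp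
          thus False using v4 q(2) by (simp add: Y_def)
        qed
      qed
    qed (use elim in simp)
  qed
qed

lemma powi_Q_inj: "Q powi a = Q powi b \<Longrightarrow> a = b"
proof -
  assume "Q powi a = Q powi b"
  hence "norm Q powi a = norm Q powi b" by (metis norm_power_int)
  hence "\<not> a < b" "\<not> b < a"
    using power_int_strict_decreasing[of _ _ "norm Q"] bases by force+
  thus ?thesis by simp
qed

text \<open>Along the pairs with \<open>n * r - t - h = k\<close>, the factor by which
  \<open>U\<close> changes from \<open>t\<close> to \<open>t + n\<close> is undone by that of
  \<open>theta_term\<close> from \<open>r\<close> to \<open>r + 1\<close>, precisely because
  \<open>Y y = Q powi k\<close>. So the product can be read off at \<open>r = 0\<close>.\<close>

lemma beta_at_pole:
  assumes y: "y \<noteq> 0" and k: "Q powi k * (1 / Y y) = 1" and r: "n * r - t - h = k"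
  shows "U t y * theta_term P (w y) r = U (- h - k) y"
proof -
  have Yk: "Y y = Q powi k" using k Y_nz[OF y] by simp
  define F where "F = (\<lambda>r. U (n * r - h - k) y * theta_term P (w y) r = U (- h - k) y)"
  have step: "U (n * (r + 1) - h - k) y * theta_term P (w y) (r + 1) = U (n * r - h - k) y * theta_term P (w y) r" for r
  proof -
    define t where "t = n * r - h - k"
    have t: "n * (r + 1) - h - k = t + n" by (simp add: t_def algebra_simps)
    have "Y y * Q powi (t + h) = P powi r"
      unfolding Yk P_powi t_def using bases power_int_add[of Q k "n * r - h - k + h"] by simp
    hence e: "w y * P powi r = w y * Y y * Q powi (t + h)" by (simp add: mult.assoc)
    have "U (t + n) y * theta_term P (w y) (r + 1) = (U (t + n) y * (- (w y * P powi r))) * theta_term P (w y) r"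
      unfolding theta_term_Suc[OF w_nz[OF y]] by simp
    thus ?thesis unfolding e U_shift[OF y] t by (simp add: t_def)
  qed
  have "F r"
  proof (induction r rule: int_induct[of _ 0])
    case base
    show ?case by (simp add: F_def theta_term_def)
  next
    case (step1 i)
    thus ?case using step[of i] by (simp add: F_def)
  next
    case (step2 i)
    thus ?case using step[of "i - 1"] by (simp add: F_def)
  qed
  moreover have "n * r - h - k = t" using r by simp
  ultimately show ?thesis by (simp add: F_def)
qed

lemma removable_E_pole:
  assumes y: "y \<noteq> 0" and X: "jtheta X Q \<noteq> 0" and k: "Q powi k * (1 / Y y) = 1"
  shows "\<exists>g. g analytic_on {y} \<and> eventually (\<lambda>v. E v = g v) (at y)"
proof -
  have Yk: "Y y = Q powi k" using k Y_nz[OF y] by simp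
  have only: "Q powi m * (1 / Y y) = 1 \<longleftrightarrow> m = k" for m
    using Y_nz[OF y] powi_Q_inj[of m k] by (auto simp: Yk)
  \<comment> \<open>Division of \<open>- (h + k)\<close> by \<open>n\<close> with remainder yields
    the only pair with \<open>t\<close> in \<open>0..n - 1\<close> and
    \<open>n * r - t - h = k\<close>, that is, the only singular summand in
    \<open>B\<close>.\<close>
  define t0 where "t0 = (- (h + k)) mod n"
  define r0 where "r0 = - ((- (h + k)) div n)"
  have t0: "t0 \<in> {0..n - 1}" using n_pos by (simp add: t0_def)
  have r0: "n * r0 - t0 - h = k"
  proof -
    have "n * ((- (h + k)) div n) + (- (h + k)) mod n = - (h + k)" by (rule mult_div_mod_eq)
    thus ?thesis unfolding t0_def r0_def mult_minus_right by linarith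
  qed
  have uniq: "t = t0 \<and> r = r0" if "t \<in> {0..n - 1}" "n * r - t - h = k" for t r
  proof -
    have "n * (r - r0) = t - t0" using that(2) r0 by (simp add: algebra_simps)
    moreover have "\<bar>t - t0\<bar> < n" using that(1) t0 by auto
    moreover have "n dvd t - t0" using calculation(1) by (metis dvd_triv_left)
    ultimately have "t - t0 = 0" using dvd_imp_le_int[of "t - t0" n] n_pos by linarith
    thus ?thesis using \<open>n * (r - r0) = t - t0\<close> n_pos by simp
  qed
  define S' where "S' = (\<lambda>v. \<Sum>\<^sub>\<infinity>r\<in>UNIV - {r0}. theta_term P (w v) r / (1 - Q powi (n * r - t0 - h) * (1 / Y v)))"
  define Z where "Z = (\<lambda>v. Y v / Q powi k)"
  define L where "L = (\<lambda>v. (-1) powi (k + 1) * Q powi (- tri k) * Z v powi (1 - k) *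
     (qpoch_inf (Q * Z v) Q * qpoch_inf (Q / Z v) Q * qpoch_inf Q Q))"
  define D where "D = (\<lambda>v. 1 - Q powi k * (1 / Y v))"
  \<comment> \<open>\<open>N / D\<close> collects the two singular contributions, the theta quotient
    and the summand \<open>(t0, r0)\<close>; \<open>H\<close> is the rest of
    \<open>E\<close>.\<close>
  define N where "N = (\<lambda>v. M v / L v - U t0 v * theta_term P (w v) r0)"
  define H where "H = (\<lambda>v. jtheta (w v) P * f v + w v * A v - (\<Sum>t\<in>{0..n - 1} - {t0}. T t v) - U t0 v * S' v)"
  have Zy: "Z y = 1" using bases by (simp add: Z_def Yk)
  have Z_ana: "Z analytic_on {y}"
    unfolding Z_def using analytic_basic(2)[OF y] bases by (intro analytic_intros) auto
  have Ly: "L y = (-1) powi (k + 1) * Q powi (- tri k) * qpoch_inf Q Q ^ 3"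
    by (simp add: L_def Zy power3_eq_cube)
  have Ly0: "L y \<noteq> 0" unfolding Ly using bases qpoch_inf_self_nonzero[OF bases(3)] by simp
  have L_ana: "L analytic_on {y}"
    unfolding L_def using Z_ana Zy
    by (intro analytic_intros analytic_at_powi analytic_at_qpoch_inf bases) auto
  have theta_ana: "(\<lambda>v. theta_term P (w v) r0) analytic_on {y}"
    unfolding theta_term_def using analytic_basic(1)[OF y] w_nz[OF y]
    by (intro analytic_intros analytic_at_powi)
  have N_ana: "N analytic_on {y}"
    unfolding N_def using analytic_M[OF y X] L_ana Ly0 theta_ana analytic_basic(5)[OF y]
    by (intro analytic_intros) auto
  have Ny: "N y = 0"
    unfolding N_def beta_at_pole[OF y k r0] M_at_pole[OF y Yk X] Ly[symmetric] using Ly0 by simp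
  have D_ana: "D analytic_on {y}"
    unfolding D_def using analytic_basic(2)[OF y] Y_nz[OF y] by (intro analytic_intros) auto
  have Dy: "D y = 0" using k by (simp add: D_def)
  have dD: "deriv D y \<noteq> 0"
  proof -
    define c where "c = - (q powi (2 * n + 8))"
    have c: "c \<noteq> 0" "Y v = c * v ^ 4" for v using q by (auto simp: c_def Y_def)
    have "(D has_field_derivative 4 * Q powi k / (c * y ^ 5)) (at y)"
      unfolding D_def c(2) using c(1) y
      by (auto intro!: derivative_eq_intros simp: field_simps eval_nat_numeral)
    hence "deriv D y = 4 * Q powi k / (c * y ^ 5)" by (rule DERIV_imp_deriv)
    thus ?thesis using c y bases by simp
  qed
  obtain g where g: "g analytic_on {y}" "eventually (\<lambda>v. N v / D v = g v) (at y)"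
    using removable_quotient[OF N_ana Ny D_ana Dy dD] by blast
  have "T t analytic_on {y}" if t: "t \<in> {0..n - 1} - {t0}" for t
    by (rule analytic_T[OF y]) (use only uniq[of t] t in auto)
  moreover have "S' analytic_on {y}"
    unfolding S'_def by (rule analytic_S[OF y]) (use only uniq[OF t0] in auto)
  ultimately have H_ana: "H analytic_on {y}"
    unfolding H_def using analytic_f[OF y] analytic_A[OF y X_regular[OF X]] analytic_basic[OF y] w_nz[OF y]
    by (intro analytic_intros analytic_at_jtheta_compose bases) auto
  have "eventually (\<lambda>v. E v = H v + g v) (at y)"
    using g(2) eventually_regular[OF y]
  proof eventually_elim
    case (elim v)
    have v: "v \<noteq> 0" using elim(2) by (simp add: regular_def)
    let ?f = "\<lambda>r. theta_term P (w v) r / (1 - Q powi (n * r - t0 - h) * (1 / Y v))"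
    have "?f summable_on UNIV - {r0}"
      by (rule summable_S[OF v]) (use elim(2) in \<open>auto simp: regular_def\<close>)
    hence "infsum ?f (insert r0 (UNIV - {r0})) = ?f r0 + S' v"
      unfolding S'_def by (rule infsum_insert) simp
    hence S: "S t0 v = theta_term P (w v) r0 / D v + S' v"
      unfolding S_def D_def r0 by (simp add: insert_Diff_single)
    have B: "B v = (U t0 v * theta_term P (w v) r0 / D v + U t0 v * S' v) + (\<Sum>t\<in>{0..n - 1} - {t0}. T t v)"
      unfolding B_def using t0 by (subst sum.remove[of _ t0]) (auto simp: T_def S distrib_left)
    have "jtheta (Y v) Q = D v * L v"
      unfolding D_def L_def Z_def by (rule jtheta_factor[OF bases(3,4) Y_nz[OF v]])
    hence "M v / jtheta (Y v) Q = M v / L v / D v" by simp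
    thus ?case
      unfolding E_def E0_def H_def elim(1)[symmetric] N_def B by (simp add: diff_divide_distrib)
  qed
  thus ?thesis using g(1) H_ana by (intro exI[of _ "\<lambda>v. H v + g v"] conjI analytic_intros)
qed

theorem E_eq_0:
  assumes "regular y" and X: "jtheta X Q \<noteq> 0"
  shows "E y = 0"
proof (rule removable_quasi_periodic_eq_0[OF bases(3,4), of E "Q powi (h + 1) / X"])
  fix v :: complex assume v: "v \<noteq> 0"
  show "\<exists>g. g analytic_on {v} \<and> eventually (\<lambda>u. E u = g u) (at v)"
  proof (cases "regular v")
    case True
    thus ?thesis using analytic_E_regular[OF True X] by (intro exI[of _ E]) simp
  next
    case False
    then obtain k where "Q powi k * (1 / Y v) = 1" using v by (auto simp: regular_def)
    thus ?thesis by (rule removable_E_pole[OF v X])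
  qed
  show "eventually (\<lambda>u. E (Q * u) = Q powi (h + 1) / X * E u) (at v)"
    using eventually_regular[OF v]
  proof eventually_elim
    case (elim u)
    have "u \<noteq> 0" using elim by (simp add: regular_def)
    thus ?case
      unfolding E_def using E0_mult_Q[OF elim X_regular[OF X]] M_mult_Q by (simp add: distrib_left)
  qed
next
  fix k :: int
  show "Q powi (h + 1) / X \<noteq> Q powi k"
  proof
    assume eq: "Q powi (h + 1) / X = Q powi k"
    have "Q powi (h + 1 - k) * (1 / X) = Q powi (h + 1) / X / Q powi k"
      using bases by (simp add: power_int_diff)
    also have "\<dots> = 1" unfolding eq using bases by simp
    finally show False using X_regular[OF X] by blast
  qed
next
  show "y \<noteq> 0" using assms by (simp add: regular_def)
  show "isCont E y" using analytic_E_regular[OF assms] by (rule analytic_at_imp_isCont)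
qed

section \<open>Translation to the definitions of the statement\<close>

lemma hecke_g_eq:
  assumes y: "y \<noteq> 0" and j: "jtheta (w y) P \<noteq> 0"
  shows "jtheta (w y) P * hecke_g n (n + 4) n x y q (y powi n / x powi n) (x powi n / y powi n) = B y - w y * A y"
proof -
  define m where "m = monomial x y q"
  note m = monomial_rules[OF x y q(2) m_def] and eq = monomial_eqI[OF m_def]
  have b: "(n + 4)\<^sup>2 - n * n = 8 * n + 16" by (simp add: power2_eq_square algebra_simps)
  have P: "q powi (n * ((n + 4)\<^sup>2 - n * n)) = P"
    unfolding b P_def Q_def using power_int_mult[of q "8 * n + 16" n] by (simp add: mult.commute)
  have z: "y powi n / x powi n = w y" "x powi n / y powi n = 1 / w y" by (simp_all add: w_def)
  have t: "tri (n + 4 + 1) = h * n + 4 * n + 6 + n + 4" "tri (n + 1) = h * n + n"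
    unfolding tri_Suc tri_n by simp_all
  \<comment> \<open>The third argument \<open>1 / w y\<close> is what cancels
    \<open>y powi n\<close> in \<open>hecke_g_arg\<close> and leaves \<open>x\<close> to the power
    -4, so that this half has no poles in \<open>y\<close>.\<close>
  have 1: "P powi (r - 1) * hecke_g_arg n (n + 4) n x y q t * (1 / w y) = Q powi (n * r - t - h) * (1 / X)" for r t
    unfolding hecke_g_arg_def b w_def X_def P_def Q_def t
    by (simp only: m, rule eq) (simp_all add: n_def algebra_simps)
  have 2: "P powi (r - 1) * hecke_g_arg n (n + 4) n y x q t * w y = Q powi (n * r - t - h) * (1 / Y y)" for r t
    unfolding hecke_g_arg_def b w_def Y_def P_def Q_def t
    by (simp only: m, rule eq) (simp_all add: n_def algebra_simps)
  have j': "jtheta (1 / w y) P = - jtheta (w y) P / w y"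
    by (rule jtheta_inverse[OF bases(5,6) w_nz[OF y]])
  have m1: "appell_m (hecke_g_arg n (n + 4) n x y q t) P (1 / w y) = - w y / jtheta (w y) P * R t y" for t
    unfolding appell_m_def 1 j' R_def theta_term_def by simp
  have m2: "appell_m (hecke_g_arg n (n + 4) n y x q t) P (w y) = 1 / jtheta (w y) P * S t y" for t
    unfolding appell_m_def 2 S_def theta_term_def by simp
  have "hecke_g n (n + 4) n x y q (y powi n / x powi n) (x powi n / y powi n) =
      (\<Sum>t\<in>{0..n - 1}. V t y * (- w y / jtheta (w y) P * R t y)) + (\<Sum>t\<in>{0..n - 1}. U t y * (1 / jtheta (w y) P * S t y))"
    unfolding hecke_g_def z P m1 m2 U_def V_def ..
  also have "\<dots> = - w y / jtheta (w y) P * A y + 1 / jtheta (w y) P * B y"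
    unfolding A_def B_def T_def sum_distrib_left by (simp only: mult_ac)
  finally show ?thesis using j by (simp add: field_simps)
qed

text \<open>The exponents split as \<open>6n + 16 = 2(2n + 4) + 2(n + 4)\<close> and
  \<open>3n + 8 = (2n + 4) + (n + 4)\<close>: multiples of \<open>2n + 4\<close> are powers of
  \<open>\<rho>\<close>, while each \<open>n + 4\<close> is absorbed by two factors
  \<open>sq\<close> attached to \<open>x\<close> and \<open>y\<close>.\<close>

lemma S1_S2_eq:
  assumes y: "y \<noteq> 0"
  shows "jtheta (y / x) Q * S1 n x y q = W1 \<rho> (sq * x) (sq * y)"
    and "jtheta (y / x) Q * S2 n x y q = q / sq * W2 \<rho> (sq * x) (sq * y)"
proof -
  define m where "m = monomial x y q"
  note m = monomial_rules[OF x y q(2) m_def] and eq = monomial_eqI[OF m_def]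
  have sx: "(sq * x)\<^sup>2 = q powi (n + 4) * x\<^sup>2" "(sq * y)\<^sup>2 = q powi (n + 4) * y\<^sup>2"
    "sq * x * (sq * y) = q powi (n + 4) * (x * y)"
    using sq(1) by (simp_all add: power_mult_distrib power2_eq_square mult_ac)
  have r: "sq * y / (sq * x) = y / x" "\<rho>\<^sup>2 * (sq * y) / (sq * x) = \<rho>\<^sup>2 * y / x"
    "\<rho>\<^sup>2 * (q powi (n + 4) * y\<^sup>2) / (q powi (n + 4) * x\<^sup>2) = \<rho>\<^sup>2 * y\<^sup>2 / x\<^sup>2"
    "\<rho> ^ 4 * (q powi (n + 4) * y\<^sup>2) / (q powi (n + 4) * x\<^sup>2) = \<rho> ^ 4 * y\<^sup>2 / x\<^sup>2"
    using sq(2) q by (simp_all add: mult.assoc)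
  have a: "\<rho>\<^sup>2 * (q powi (n + 4) * x\<^sup>2) * (q powi (n + 4) * y\<^sup>2) = q powi (6 * n + 16) * x\<^sup>2 * y\<^sup>2"
    "(q powi (n + 4) * x\<^sup>2) * (q powi (n + 4) * y\<^sup>2) = q powi (2 * n + 8) * x\<^sup>2 * y\<^sup>2"
    "q powi (n + 4) * (x * y) = q powi (n + 4) * x * y"
    unfolding \<rho>_def by (simp only: m, rule eq, simp, simp, simp, simp)+
  have "\<rho> * (q powi (n + 4) * (x * y)) = q powi (3 * n + 8) * x * y"
    unfolding \<rho>_def by (simp only: m, rule eq) simp_all
  hence a': "\<rho> * (sq * x) * (sq * y) = q powi (3 * n + 8) * x * y"
    unfolding sx(3)[symmetric] by (simp only: mult.assoc)
  have N: "q powi (2 * (2 * n + 4)) = \<rho>\<^sup>2" "q powi (4 * (2 * n + 4)) = \<rho> ^ 4" "q powi (8 * (2 * n + 4)) = \<rho> ^ 8"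
    unfolding \<rho>_def by (simp only: m, rule eq, simp, simp, simp, simp)+
  have J: "J1 (2 * (2 * n + 4)) q = qpoch_inf (\<rho>\<^sup>2) (\<rho>\<^sup>2)" "J1 (4 * (2 * n + 4)) q = qpoch_inf (\<rho> ^ 4) (\<rho> ^ 4)"
    "J1 (8 * (2 * n + 4)) q = qpoch_inf (\<rho> ^ 8) (\<rho> ^ 8)"
    unfolding N[symmetric] by (rule J1_eq_qpoch_inf; use q n_pos in simp)+
  show "jtheta (y / x) Q * S1 n x y q = W1 \<rho> (sq * x) (sq * y)"
    unfolding S1_def Let_def J N W1_def sx r a rho(3)[symmetric] by simp
  have c: "q powi (n + 1) / y = q / sq * (\<rho> / (sq * y))"
  proof -
    have "q powi (n + 1) / y = q * (\<rho> / (q powi (n + 4) * y))"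
      unfolding \<rho>_def by (simp only: m, rule eq) simp_all
    thus ?thesis unfolding sq(1)[symmetric] by (simp add: power2_eq_square mult.assoc)
  qed
  have alg: "j * (a / d * (qn * b * e * g / (y * k) + q * x * c / g)) =
      q / s * (j * a / d * (\<rho> * b * e * g / (s * y * k) + s * x * c / g))"
    if "qn / y = q / s * (\<rho> / (s * y))" "s \<noteq> 0" for j a d qn b e g k q s c \<rho> :: complex
  proof -
    have "qn * b * e * g / (y * k) = (qn / y) * (b * e * g / k)" by simp
    also have "\<dots> = q / s * (\<rho> * b * e * g / (s * y * k))" unfolding that(1) by (simp add: mult.assoc)
    finally show ?thesis using that(2) by (simp add: algebra_simps)
  qed
  show "jtheta (y / x) Q * S2 n x y q = q / sq * W2 \<rho> (sq * x) (sq * y)"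
    unfolding S2_def Let_def J N W2_def sx r a a' rho(3)[symmetric]
    using alg[OF c sq(2)] by (simp only: mult.assoc)
qed

lemma Theta4_eq:
  assumes y: "y \<noteq> 0" and j: "jtheta (w y) P \<noteq> 0"
  shows "jtheta (w y) P * Theta4 n x y q = M y / jtheta (Y y) Q"
proof -
  have Q: "q powi (4 * (2 * n + 4)) = Q" unfolding Q_def by (simp add: algebra_simps)
  have P: "q powi (4 * n * (2 * n + 4)) = P"
  proof -
    have "4 * n * (2 * n + 4) = (8 * n + 16) * n" by (simp add: algebra_simps)
    thus ?thesis unfolding P_def Q_def by (simp only: power_int_mult)
  qed
  have e: "- ((n - 3) div 2) = 1 - h" "(n + 1) div 2 = h + 1" by (simp_all add: n_def)
  have "Theta4 n x y q = q powi (- (n\<^sup>2 + n - 3)) * x powi (1 - h) * y powi (h + 1) /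
     (jtheta (w y) P * jtheta X Q * jtheta (Y y) Q) *
     (J2 (4 * n) (16 * n) q * (jtheta (y / x) Q * S1 n x y q) - q * J2 (8 * n) (16 * n) q * (jtheta (y / x) Q * S2 n x y q))"
    unfolding Theta4_def Let_def Q P e w_def[symmetric] X_def[symmetric] Y_def[of y, symmetric]
    by (simp add: divide_inverse algebra_simps)
  thus ?thesis unfolding S1_S2_eq[OF y] M_def using j by (simp add: power2_eq_square)
qed

end

theorem theorem0p14:
  fixes n :: int and q x y :: complex
  assumes "0 < norm q" and "norm q < 1"
    and "n > 0" and "odd n"
    and "x \<noteq> 0" and "y \<noteq> 0"
    and "hecke_g_no_pole n (n + 4) n x y q (y powi n / x powi n) (x powi n / y powi n)"
    and "Theta4_no_pole n x y q"
  shows "hecke_f n (n + 4) n x y q =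
    hecke_g n (n + 4) n x y q (y powi n / x powi n) (x powi n / y powi n) - Theta4 n x y q"
proof -
  obtain h where nh: "n = 2 * h + 1" using assms(4) by (elim oddE)
  interpret hecke_sums q x h
    using assms nh by unfold_locales auto
  have n: "hecke_sums.n h = n" by (simp add: n_def nh)
  have Q: "q powi (4 * (2 * n + 4)) = Q" unfolding Q_def n by (simp add: algebra_simps)
  have P: "q powi (4 * n * (2 * n + 4)) = P"
  proof -
    have "4 * n * (2 * n + 4) = (8 * n + 16) * n" by (simp add: algebra_simps)
    thus ?thesis unfolding P_def Q_def n by (simp only: power_int_mult)
  qed
  \<comment> \<open>The first condition allows \<open>jtheta (w y) P\<close> to be cancelled at the
    end, the second enters \<open>E_eq_0\<close>, and the third says that \<open>y\<close> is
    regular.\<close>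
  have np: "jtheta (w y) P \<noteq> 0" "jtheta X Q \<noteq> 0" "jtheta (Y y) Q \<noteq> 0"
    using assms(8) unfolding Theta4_no_pole_def Let_def Q P w_def X_def Y_def n by auto
  let ?g = "hecke_g n (n + 4) n x y q (y powi n / x powi n) (x powi n / y powi n)"
  have "jtheta (w y) P * (f y - ?g + Theta4 n x y q) =
      jtheta (w y) P * f y - jtheta (w y) P * ?g + jtheta (w y) P * Theta4 n x y q"
    by (simp add: algebra_simps)
  also have "\<dots> = E y"
    unfolding hecke_g_eq[OF assms(6) np(1), unfolded n] Theta4_eq[OF assms(6) np(1), unfolded n] E_def E0_def
    by simp
  also have "\<dots> = 0"
    using E_eq_0 regular_iff[OF assms(6)] np by blast
  finally have "jtheta (w y) P * (f y - ?g + Theta4 n x y q) = 0" .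
  hence "f y - ?g + Theta4 n x y q = 0" using np(1) by simp
  hence "f y = ?g - Theta4 n x y q" by (simp add: algebra_simps)
  thus ?thesis unfolding f_def n .
qed

end
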